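(* Let $n\ge1$, let $W=W(B_n)=(\mathbb Z/2\mathbb Z)^n\rtimes\mathcal S_n$, and let $\tilde{\mathcal O}_X$, $\tilde{\mathcal D}_Y$, their module structures and the higher Specht polynomials $F_T^S$ be as defined in the context. Let $\{e_T\}_{T\in\mathrm{STab}(n)}$ be a complete system of orthogonal primitive idempotents of $\mathbb C[W]$ indexed by standard 2-tableaux as in the context. For each $\lambda\in\mathcal P_{2,n}$ and $T\in\mathrm{STab}(\lambda)$ let $F_T:=F_T^S$ (for some $S\in\mathrm{STab}(\lambda)$) be the corresponding higher Specht polynomial such that $e_T\tilde{\mathcal O}_X=\tilde{\mathcal D}_Y F_T^S$. Then: (i) $$\tilde{\mathcal O}_X=\bigoplus_{T\in\mathrm{STab}(n)}\tilde{\mathcal D}_Y F_T=\bigoplus_{\lambda\in\mathcal P_{2,n}}\Big(\bigoplus_{T\in\mathrm{STab}(\lambda)}\tilde{\mathcal D}_Y F_T\Big);$$ (ii) if for each $\lambda\in\mathcal P_{2,n}$ a 2-tableau $T^*=T^*(\lambda)\in\mathrm{STab}(\lambda)$ is fixed, then, as $\tilde{\mathcal D}_Y$-modules, $$\tilde{\mathcal O}_X\cong\bigoplus_{\lambda\in\mathcal P_{2,n}} f^\lambda\,\tilde{\mathcal D}_Y F_{T^*},$$ where $f^\lambda=\dim_{\mathbb C}V(\lambda)$ and $f^\lambda M$ denotes the direct sum of $f^\lambda$ copies of $M$.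
   Context: Group action. Elements of $W=(\mathbb Z/2\mathbb Z)^n\rtimes\mathcal S_n$ are written $(\epsilon_1,\dots,\epsilon_n;\sigma)$ with $\epsilon_i\in\{\pm1\}$, $\sigma\in\mathcal S_n$, with product $(\epsilon;\sigma)(\delta;\pi)=(\epsilon_1\delta_{\sigma^{-1}(1)},\dots,\epsilon_n\delta_{\sigma^{-1}(n)};\sigma\pi)$. $W$ acts on $\mathbb C[x_1,\dots,x_n]$ by $(\epsilon;\sigma)f=f(\epsilon_{\sigma(1)}x_{\sigma(1)},\dots,\epsilon_{\sigma(n)}x_{\sigma(n)})$. Rings. Let $y_j=\sum_{i=1}^n x_i^{2j}$ for $1\le j\le n$, so $\mathbb C[x_1,\dots,x_n]^W=\mathbb C[y_1,\dots,y_n]$. Let $\Delta=2^n n!\,x_1\cdots x_n\prod_{1\le i<j\le n}(x_j^2-x_i^2)$; then $\Delta^2$ is $W$-invariant. Set $\tilde{\mathcal O}_X=\mathbb C[x_1,\dots,x_n,\Delta^{-1}]$ and $\tilde{\mathcal D}_Y=\mathbb C\langle y_1,\dots,y_n,\partial/\partial y_1,\dots,\partial/\partial y_n,\Delta^{-2}\rangle$, the Weyl algebra in $y_1,\dots,y_n$ localized at $\Delta^2$. The $W$-action on $\mathbb C[x_1,\dots,x_n]$ extends to $\tilde{\mathcal O}_X$ by algebra automorphisms, making it a $\mathbb C[W]$-module. $\tilde{\mathcal D}_Y$-module structure on $\tilde{\mathcal O}_X$: $y_j$ and $\Delta^{-2}$ act by multiplication, and $\partial/\partial y_j$ acts as $\sum_{i=1}^n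 (A^{-1})_{ji}\,\partial/\partial x_i$, where $A=(2j\,x_i^{2j-1})_{1\le i,j\le n}$ (row $i$, column $j$), which has $\det A=\Delta$. Tableaux. $\mathcal P_{2,n}$ is the set of pairs $\lambda=(\lambda^1,\lambda^2)$ of Young diagrams with $|\lambda^1|+|\lambda^2|=n$. $\mathrm{Tab}(\lambda)$ is the set of 2-tableaux $T=(T^1,T^2)$ of shape $\lambda$: fillings of the cells of $\lambda^1,\lambda^2$ by $1,\dots,n$, each used exactly once. $\mathrm{STab}(\lambda)\subset\mathrm{Tab}(\lambda)$ consists of those in which numbers increase along each row and each column of both components; $\mathrm{STab}(n)=\bigcup_{\lambda\in\mathcal P_{2,n}}\mathrm{STab}(\lambda)$. Write $k\in T^\nu$ if $k$ occurs in $T^\nu$, and $T^\nu(\xi)$ for the entry in cell $\xi$. Index tableau. For $S\in\mathrm{STab}(\lambda)$, the word $w(S)$ is obtained by reading each column of $S^1$ from bottom to top, starting from the leftmost column and moving right, and then doing the same for $S^2$. Indices of the letters: $1$ has index $0$; if $k$ has index $p$, then $k+1$ has index $p+1$ if it lies to the left of $k$ in $w(S)$ and index $p$ if it lies to the right. $i(S)=(i(S)^1,i(S)^2)$ is the filling of $\lambda$ obtained by replacing each entry of $S$ by its index. Higher Specht polynomials. For $T\in\mathrm{Tab}(\lambda)$ and $\nu\in\{1,2\}$, let $\mathbf e_{T^\nu}=\frac{1}{\alpha_{T^\nu}}\sum_{\sigma\in R(T^\nu),\,\tau\in C(T^\nu)}\mathrm{sgn}(\tau)\,\tau\sigma$,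 where $\alpha_{T^\nu}$ is the product of hook lengths of $\lambda^\nu$ and $R(T^\nu)$, $C(T^\nu)$ are the row and column stabilizers of $T^\nu$. For $S\in\mathrm{STab}(\lambda)$, $T\in\mathrm{Tab}(\lambda)$, $$F_T^S=\prod_{\nu=1}^{2}\Big(\mathbf e_{T^\nu}\big(x_{T^\nu}^{2i(S)^\nu}\big)\prod_{k\in T^\nu}x_k^{\nu}\Big),\qquad x_{T^\nu}^{2i(S)^\nu}=\prod_{\xi\in\lambda^\nu}x_{T^\nu(\xi)}^{2\,i(S)^\nu(\xi)}.$$ Representations and idempotents. For $S\in\mathrm{STab}(\lambda)$, $V_S(\lambda)=\sum_{T\in\mathrm{Tab}(\lambda)}\mathbb C F_T^S$ is an irreducible representation of $W$ whose isomorphism class depends only on $\lambda$; it is denoted $V(\lambda)$, has basis $\{F_T^S\}_{T\in\mathrm{STab}(\lambda)}$, and the $V(\lambda)$, $\lambda\in\mathcal P_{2,n}$, are all the irreducible representations of $W$ without repetition. $r_\lambda$ denotes the primitive central idempotent of $\mathbb C[W]$ attached to $V(\lambda)$. The system $\{e_T\}_{T\in\mathrm{STab}(n)}$ consists of pairwise orthogonal primitive idempotents with $1=\sum_{T\in\mathrm{STab}(n)}e_T$, and $e_T\in r_\lambda\mathbb C[W]$ (equivalently $\mathbb C[W]e_T\cong V(\lambda)$) whenever $T\in\mathrm{STab}(\lambda)$. *)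

theory Defs
  imports
    "HOL-Library.Poly_Mapping"
    "HOL-Library.Function_Algebras"
    "HOL-Computational_Algebra.Fraction_Field"
    "HOL-Computational_Algebra.Polynomial_Factorial"
    "HOL-Combinatorics.Permutations"
    "HOL-Algebra.QuotRing"
    "Jordan_Normal_Form.Gauss_Jordan_Elimination"
begin

text \<open>Exponent vectors are finitely supported maps on the variable indices; the polynomial ring
  in \<open>x\<^sub>1, \<dots>, x\<^sub>n\<close> is the subring \<open>poly_ring n\<close> of the ring in all variables \<open>x\<^sub>i\<close>, \<open>i :: nat\<close>.\<close>

type_synonym mpoly = "(nat \<Rightarrow>\<^sub>0 nat) \<Rightarrow>\<^sub>0 complex"
type_synonym ratf = "mpoly fract"

definition Cst :: "complex \<Rightarrow> mpoly" where
  "Cst c = Poly_Mapping.single 0 c"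

definition X :: "nat \<Rightarrow> mpoly" where
  "X i = Poly_Mapping.single (Poly_Mapping.single i 1) 1"

definition poly_ring :: "nat \<Rightarrow> mpoly set" where
  "poly_ring n = {p. \<forall>m \<in> Poly_Mapping.keys p. Poly_Mapping.keys m \<subseteq> {1..n}}"

definition cscale :: "complex \<Rightarrow> ratf \<Rightarrow> ratf" where
  "cscale c f = to_fract (Cst c) * f"

definition pderiv_poly :: "nat \<Rightarrow> mpoly \<Rightarrow> mpoly" where
  "pderiv_poly i p = (\<Sum>m \<in> Poly_Mapping.keys p.
     Poly_Mapping.single (m - Poly_Mapping.single i 1)
       (of_nat (Poly_Mapping.lookup m i) * Poly_Mapping.lookup p m))"

text \<open>A numerator and a denominator; the two functions below defined through it (quotient rule,
  substitution in numerator and denominator) do not depend on the choice.\<close>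

definition num_den :: "ratf \<Rightarrow> mpoly \<times> mpoly" where
  "num_den f = (SOME (p, q). q \<noteq> 0 \<and> f = Fract p q)"

definition pderiv_rat :: "nat \<Rightarrow> ratf \<Rightarrow> ratf" where
  "pderiv_rat i f = (case num_den f of (p, q) \<Rightarrow>
     Fract (pderiv_poly i p * q - p * pderiv_poly i q) (q * q))"

definition y :: "nat \<Rightarrow> nat \<Rightarrow> mpoly" where
  "y n j = (\<Sum>i = 1..n. X i ^ (2 * j))"

definition Delta :: "nat \<Rightarrow> mpoly" where
  "Delta n = of_nat (2 ^ n * fact n) * (\<Prod>i = 1..n. X i) *
     (\<Prod>j = 1..n. \<Prod>i = 1..<j. ((X j)\<^sup>2 - (X i)\<^sup>2))"

definition OX :: "nat \<Rightarrow> ratf set" where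
  "OX n = {Fract p (Delta n ^ k) | p k. p \<in> poly_ring n}"

text \<open>Rows and columns of \<open>mat\<close> are numbered from 0: the entry of \<open>A\<close> in row \<open>i\<close> and column \<open>j\<close>
  sits at \<open>(i - 1, j - 1)\<close>.\<close>

definition Amat :: "nat \<Rightarrow> ratf mat" where
  "Amat n = mat n n (\<lambda>(r, c). to_fract (of_nat (2 * (c + 1)) * X (r + 1) ^ (2 * (c + 1) - 1)))"

definition partial_y :: "nat \<Rightarrow> nat \<Rightarrow> ratf \<Rightarrow> ratf" where
  "partial_y n j f = (\<Sum>i = 1..n. the (mat_inverse (Amat n)) $$ (j - 1, i - 1) * pderiv_rat i f)"

text \<open>The complex monoid algebra; it is used both for the group algebra of \<open>W\<close> and, with the
  monoid of words, for free associative algebras.\<close>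

definition monoid_algebra :: "('g, 'm) monoid_scheme \<Rightarrow> ('g \<Rightarrow> complex) ring" where
  "monoid_algebra G =
     \<lparr>carrier = {f. finite {x. f x \<noteq> 0} \<and> {x. f x \<noteq> 0} \<subseteq> carrier G},
      mult = (\<lambda>f g z. \<Sum>x | f x \<noteq> 0. \<Sum>y | g y \<noteq> 0. if x \<otimes>\<^bsub>G\<^esub> y = z then f x * g y else 0),
      one = (\<lambda>z. if z = \<one>\<^bsub>G\<^esub> then 1 else 0),
      zero = (\<lambda>z. 0),
      add = (\<lambda>f g z. f z + g z)\<rparr>"

definition lin_act :: "('g \<Rightarrow> ratf \<Rightarrow> ratf) \<Rightarrow> ('g \<Rightarrow> complex) \<Rightarrow> ratf \<Rightarrow> ratf" where
  "lin_act \<rho> a v = (\<Sum>g | a g \<noteq> 0. cscale (a g) (\<rho> g v))"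

text \<open>A left \<open>R\<close>-module is given by its carrier set inside an additive type and the action of
  (the carrier of) \<open>R\<close>. All rings \<open>R\<close> below contain \<open>\<complex>\<close>, so isomorphisms are \<open>\<complex>\<close>-linear.\<close>

definition module_iso ::
  "('r, 'x) ring_scheme \<Rightarrow> 'm :: plus set \<Rightarrow> ('r \<Rightarrow> 'm \<Rightarrow> 'm) \<Rightarrow>
   'k :: plus set \<Rightarrow> ('r \<Rightarrow> 'k \<Rightarrow> 'k) \<Rightarrow> bool" where
  "module_iso R M actM N actN \<longleftrightarrow> (\<exists>\<phi>. bij_betw \<phi> M N \<and>
     (\<forall>u\<in>M. \<forall>v\<in>M. \<phi> (u + v) = \<phi> u + \<phi> v) \<and>
     (\<forall>a\<in>carrier R. \<forall>u\<in>M. \<phi> (actM a u) = actN a (\<phi> u)))"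

definition sum_of :: "'i set \<Rightarrow> ('i \<Rightarrow> 'm :: comm_monoid_add set) \<Rightarrow> 'm set" where
  "sum_of I M = {\<Sum>i\<in>I. m i | m. \<forall>i\<in>I. m i \<in> M i}"

definition is_direct_sum ::
  "'m :: comm_monoid_add set \<Rightarrow> 'i set \<Rightarrow> ('i \<Rightarrow> 'm set) \<Rightarrow> bool" where
  "is_direct_sum N I M \<longleftrightarrow> finite I \<and> N = sum_of I M \<and>
     (\<forall>m. (\<forall>i\<in>I. m i \<in> M i) \<and> (\<Sum>i\<in>I. m i) = 0 \<longrightarrow> (\<forall>i\<in>I. m i = 0))"

definition ext_dsum :: "'i set \<Rightarrow> ('i \<Rightarrow> 'm :: zero set) \<Rightarrow> ('i \<Rightarrow> 'm) set" where
  "ext_dsum I M = {g. (\<forall>i\<in>I. g i \<in> M i) \<and> (\<forall>i. i \<notin> I \<longrightarrow> g i = 0) \<and> finite {i. g i \<noteq> 0}}"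

definition ext_dsum_act :: "('r \<Rightarrow> 'm \<Rightarrow> 'm) \<Rightarrow> 'r \<Rightarrow> ('i \<Rightarrow> 'm) \<Rightarrow> 'i \<Rightarrow> 'm" where
  "ext_dsum_act act a g = (\<lambda>i. act a (g i))"

definition idempotent :: "('r, 'x) ring_scheme \<Rightarrow> 'r \<Rightarrow> bool" where
  "idempotent R e \<longleftrightarrow> e \<in> carrier R \<and> e \<otimes>\<^bsub>R\<^esub> e = e"

definition primitive_idempotent :: "('r, 'x) ring_scheme \<Rightarrow> 'r \<Rightarrow> bool" where
  "primitive_idempotent R e \<longleftrightarrow> idempotent R e \<and> e \<noteq> \<zero>\<^bsub>R\<^esub> \<and>
     (\<forall>a b. idempotent R a \<and> idempotent R b \<and> a \<otimes>\<^bsub>R\<^esub> b = \<zero>\<^bsub>R\<^esub> \<and> b \<otimes>\<^bsub>R\<^esub> a = \<zero>\<^bsub>R\<^esub> \<and>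
        e = a \<oplus>\<^bsub>R\<^esub> b \<longrightarrow> a = \<zero>\<^bsub>R\<^esub> \<or> b = \<zero>\<^bsub>R\<^esub>)"

text \<open>Sign vectors and permutations are extended to all of \<open>nat\<close> by 1 and by the identity.\<close>

type_synonym welt = "(nat \<Rightarrow> int) \<times> (nat \<Rightarrow> nat)"

definition W :: "nat \<Rightarrow> welt monoid" where
  "W n = \<lparr>carrier = {(\<epsilon>, \<sigma>). (\<forall>i\<in>{1..n}. \<epsilon> i = 1 \<or> \<epsilon> i = -1) \<and> (\<forall>i. i \<notin> {1..n} \<longrightarrow> \<epsilon> i = 1) \<and>
            \<sigma> permutes {1..n}},
     mult = (\<lambda>(\<epsilon>, \<sigma>) (\<delta>, \<pi>). (\<lambda>i. \<epsilon> i * \<delta> (Hilbert_Choice.inv \<sigma> i), \<sigma> \<circ> \<pi>)),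
     one = (\<lambda>i. 1, id)\<rparr>"

definition W_act_poly :: "welt \<Rightarrow> mpoly \<Rightarrow> mpoly" where
  "W_act_poly w p = (case w of (\<epsilon>, \<sigma>) \<Rightarrow>
     (\<Sum>m \<in> Poly_Mapping.keys p. Cst (Poly_Mapping.lookup p m) *
        (\<Prod>i \<in> Poly_Mapping.keys m.
           (Cst (of_int (\<epsilon> (\<sigma> i))) * X (\<sigma> i)) ^ Poly_Mapping.lookup m i)))"

definition W_act_rat :: "welt \<Rightarrow> ratf \<Rightarrow> ratf" where
  "W_act_rat w f = (case num_den f of (p, q) \<Rightarrow> Fract (W_act_poly w p) (W_act_poly w q))"

abbreviation CW :: "nat \<Rightarrow> (welt \<Rightarrow> complex) ring" where
  "CW n \<equiv> monoid_algebra (W n)"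

abbreviation CW_act :: "(welt \<Rightarrow> complex) \<Rightarrow> ratf \<Rightarrow> ratf" where
  "CW_act \<equiv> lin_act W_act_rat"

datatype dgen = GenY nat | GenD nat | GenInv

definition dwords :: "nat \<Rightarrow> dgen list monoid" where
  "dwords n = \<lparr>carrier = lists (GenY ` {1..n} \<union> GenD ` {1..n} \<union> {GenInv}), mult = (@), one = []\<rparr>"

definition word :: "dgen list \<Rightarrow> dgen list \<Rightarrow> complex" where
  "word w = (\<lambda>u. if u = w then 1 else 0)"

abbreviation free_alg :: "nat \<Rightarrow> (dgen list \<Rightarrow> complex) ring" where
  "free_alg n \<equiv> monoid_algebra (dwords n)"

fun gen_act :: "nat \<Rightarrow> dgen \<Rightarrow> ratf \<Rightarrow> ratf" where
  "gen_act n (GenY j) f = to_fract (y n j) * f"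
| "gen_act n (GenD j) f = partial_y n j f"
| "gen_act n GenInv f = f / to_fract ((Delta n)\<^sup>2)"

definition free_act :: "nat \<Rightarrow> (dgen list \<Rightarrow> complex) \<Rightarrow> ratf \<Rightarrow> ratf" where
  "free_act n = lin_act (foldr (gen_act n))"

text \<open>The elements of the free algebra that are expressions for \<open>\<Delta>\<^sup>2\<close> as a polynomial in the
  \<open>y\<^sub>j\<close>: only letters \<open>y\<^sub>j\<close> occur, and evaluation (the action on 1) gives \<open>\<Delta>\<^sup>2\<close>.\<close>

definition Delta_sq_exprs :: "nat \<Rightarrow> (dgen list \<Rightarrow> complex) set" where
  "Delta_sq_exprs n = {q \<in> carrier (free_alg n). (\<forall>w. q w \<noteq> 0 \<longrightarrow> w \<in> lists (GenY ` {1..n})) \<and>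
      free_act n q 1 = to_fract ((Delta n)\<^sup>2)}"

definition DY_relations :: "nat \<Rightarrow> (dgen list \<Rightarrow> complex) set" where
  "DY_relations n =
     {word [GenY i, GenY j] - word [GenY j, GenY i] | i j. i \<in> {1..n} \<and> j \<in> {1..n}} \<union>
     {word [GenD i, GenD j] - word [GenD j, GenD i] | i j. i \<in> {1..n} \<and> j \<in> {1..n}} \<union>
     {word [GenD i, GenY j] - word [GenY j, GenD i] - (if i = j then word [] else 0) | i j.
        i \<in> {1..n} \<and> j \<in> {1..n}} \<union>
     {word [GenInv] \<otimes>\<^bsub>free_alg n\<^esub> q - word [] | q. q \<in> Delta_sq_exprs n} \<union>
     {q \<otimes>\<^bsub>free_alg n\<^esub> word [GenInv] - word [] | q. q \<in> Delta_sq_exprs n}"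

definition DY :: "nat \<Rightarrow> (dgen list \<Rightarrow> complex) set ring" where
  "DY n = free_alg n Quot genideal (free_alg n) (DY_relations n)"

text \<open>A class in the quotient acts as any of its representatives.\<close>

definition DY_act :: "nat \<Rightarrow> (dgen list \<Rightarrow> complex) set \<Rightarrow> ratf \<Rightarrow> ratf" where
  "DY_act n P f = the_elem ((\<lambda>a. free_act n a f) ` P)"

definition DY_span :: "nat \<Rightarrow> ratf \<Rightarrow> ratf set" where
  "DY_span n f = {DY_act n P f | P. P \<in> carrier (DY n)}"

text \<open>Young diagrams are sets of cells \<open>(i, j)\<close>, row \<open>i\<close> and column \<open>j\<close> counted from 0, with row 0
  on top and column 0 leftmost. A filling is a partial map whose domain is its diagram.\<close>

type_synonym diagram = "(nat \<times> nat) set"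
type_synonym filling = "nat \<times> nat \<rightharpoonup> nat"
type_synonym tableau2 = "filling \<times> filling"

definition young_diagram :: "diagram \<Rightarrow> bool" where
  "young_diagram D \<longleftrightarrow> finite D \<and>
     (\<forall>i j i' j'. (i, j) \<in> D \<and> i' \<le> i \<and> j' \<le> j \<longrightarrow> (i', j') \<in> D)"

definition P2 :: "nat \<Rightarrow> (diagram \<times> diagram) set" where
  "P2 n = {(a, b). young_diagram a \<and> young_diagram b \<and> card a + card b = n}"

definition Tab :: "diagram \<times> diagram \<Rightarrow> tableau2 set" where
  "Tab lam = {(T1, T2). dom T1 = fst lam \<and> dom T2 = snd lam \<and>
     inj_on T1 (dom T1) \<and> inj_on T2 (dom T2) \<and> ran T1 \<inter> ran T2 = {} \<and>
     ran T1 \<union> ran T2 = {1..card (fst lam) + card (snd lam)}}"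

definition standard_filling :: "filling \<Rightarrow> bool" where
  "standard_filling T \<longleftrightarrow>
     (\<forall>i j j' k k'. T (i, j) = Some k \<and> T (i, j') = Some k' \<and> j < j' \<longrightarrow> k < k') \<and>
     (\<forall>i i' j k k'. T (i, j) = Some k \<and> T (i', j) = Some k' \<and> i < i' \<longrightarrow> k < k')"

definition STab :: "diagram \<times> diagram \<Rightarrow> tableau2 set" where
  "STab lam = {T \<in> Tab lam. standard_filling (fst T) \<and> standard_filling (snd T)}"

definition STabs :: "nat \<Rightarrow> tableau2 set" where
  "STabs n = (\<Union>lam \<in> P2 n. STab lam)"

text \<open>All row and column numbers in a Young diagram with \<open>m\<close> cells are below \<open>m\<close>.\<close>

definition column_word :: "filling \<Rightarrow> nat list" where
  "column_word T = (let m = card (dom T) in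
     concat (map (\<lambda>j. map (\<lambda>i. the (T (i, j))) (filter (\<lambda>i. (i, j) \<in> dom T) (rev [0..<m]))) [0..<m]))"

definition tab_word :: "tableau2 \<Rightarrow> nat list" where
  "tab_word S = column_word (fst S) @ column_word (snd S)"

definition left_of :: "nat list \<Rightarrow> nat \<Rightarrow> nat \<Rightarrow> bool" where
  "left_of w a b \<longleftrightarrow> (\<exists>p q. p < q \<and> q < length w \<and> w ! p = a \<and> w ! q = b)"

fun letter_index :: "nat list \<Rightarrow> nat \<Rightarrow> nat" where
  "letter_index w 0 = 0"
| "letter_index w (Suc 0) = 0"
| "letter_index w (Suc (Suc k)) =
     letter_index w (Suc k) + (if left_of w (Suc (Suc k)) (Suc k) then 1 else 0)"

definition tcomp :: "nat \<Rightarrow> tableau2 \<Rightarrow> filling" where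
  "tcomp \<nu> T = (if \<nu> = 1 then fst T else snd T)"

definition index_tab :: "nat \<Rightarrow> tableau2 \<Rightarrow> nat \<times> nat \<Rightarrow> nat" where
  "index_tab \<nu> S \<xi> = letter_index (tab_word S) (the (tcomp \<nu> S \<xi>))"

definition hook_length :: "diagram \<Rightarrow> nat \<times> nat \<Rightarrow> nat" where
  "hook_length D \<xi> = (case \<xi> of (i, j) \<Rightarrow>
     card {j'. j \<le> j' \<and> (i, j') \<in> D} + card {i'. i < i' \<and> (i', j) \<in> D})"

definition row_stab :: "filling \<Rightarrow> (nat \<Rightarrow> nat) set" where
  "row_stab T = {\<sigma>. \<sigma> permutes ran T \<and>
     (\<forall>i. \<sigma> ` {k. \<exists>j. T (i, j) = Some k} = {k. \<exists>j. T (i, j) = Some k})}"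

definition col_stab :: "filling \<Rightarrow> (nat \<Rightarrow> nat) set" where
  "col_stab T = {\<tau>. \<tau> permutes ran T \<and>
     (\<forall>j. \<tau> ` {k. \<exists>i. T (i, j) = Some k} = {k. \<exists>i. T (i, j) = Some k})}"

definition young_sym :: "filling \<Rightarrow> mpoly \<Rightarrow> mpoly" where
  "young_sym T p = Cst (1 / of_nat (\<Prod>\<xi> \<in> dom T. hook_length (dom T) \<xi>)) *
     (\<Sum>\<sigma> \<in> row_stab T. \<Sum>\<tau> \<in> col_stab T.
        Cst (of_int (sign \<tau>)) * W_act_poly (\<lambda>i. 1, \<tau> \<circ> \<sigma>) p)"

definition tab_monomial :: "nat \<Rightarrow> tableau2 \<Rightarrow> tableau2 \<Rightarrow> mpoly" where
  "tab_monomial \<nu> T S = (\<Prod>\<xi> \<in> dom (tcomp \<nu> S). X (the (tcomp \<nu> T \<xi>)) ^ (2 * index_tab \<nu> S \<xi>))"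

text \<open>In the last factor \<open>\<nu>\<close> is an exponent.\<close>

definition specht_poly :: "tableau2 \<Rightarrow> tableau2 \<Rightarrow> mpoly" where
  "specht_poly T S = (\<Prod>\<nu> \<in> {1, 2 :: nat}.
     young_sym (tcomp \<nu> T) (tab_monomial \<nu> T S) * (\<Prod>k \<in> ran (tcomp \<nu> T). X k ^ \<nu>))"

definition F :: "tableau2 \<Rightarrow> tableau2 \<Rightarrow> ratf" where
  "F T S = to_fract (specht_poly T S)"

definition V_S :: "diagram \<times> diagram \<Rightarrow> tableau2 \<Rightarrow> ratf set" where
  "V_S lam S = {\<Sum>T \<in> Tab lam. cscale (c T) (F T S) | c. True}"

text \<open>The isomorphism class of \<open>V_S lam S\<close> as a representation of \<open>W\<close> does not depend on the
  standard 2-tableau \<open>S\<close>, so any \<open>S\<close> gives a representative of \<open>V(\<lambda>)\<close>.\<close>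

definition V :: "diagram \<times> diagram \<Rightarrow> ratf set" where
  "V lam = V_S lam (SOME S. S \<in> STab lam)"

definition f_dim :: "diagram \<times> diagram \<Rightarrow> nat" where
  "f_dim lam = vector_space.dim cscale (V lam)"

text \<open>The condition \<open>e\<^sub>T \<in> r\<^sub>\<lambda> \<complex>[W]\<close>, with \<open>r\<^sub>\<lambda>\<close> the primitive central idempotent of \<open>V(\<lambda>)\<close>,
  is stated in the form that the left ideal generated by \<open>e\<^sub>T\<close> is isomorphic to \<open>V(\<lambda>)\<close>.\<close>

definition tableau_idempotents :: "nat \<Rightarrow> (tableau2 \<Rightarrow> welt \<Rightarrow> complex) \<Rightarrow> bool" where
  "tableau_idempotents n e \<longleftrightarrow>
     (\<forall>T \<in> STabs n. primitive_idempotent (CW n) (e T)) \<and>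
     (\<forall>T \<in> STabs n. \<forall>U \<in> STabs n. T \<noteq> U \<longrightarrow> e T \<otimes>\<^bsub>CW n\<^esub> e U = \<zero>\<^bsub>CW n\<^esub>) \<and>
     (\<Oplus>\<^bsub>CW n\<^esub>T \<in> STabs n. e T) = \<one>\<^bsub>CW n\<^esub> \<and>
     (\<forall>lam \<in> P2 n. \<forall>T \<in> STab lam.
        module_iso (CW n) {a \<otimes>\<^bsub>CW n\<^esub> e T | a. a \<in> carrier (CW n)} (mult (CW n)) (V lam) CW_act)"

end

theory Submission
  imports
    Defs
    "HOL-Computational_Algebra.Fundamental_Theorem_Algebra"
    "Jordan_Normal_Form.Determinant"
begin

text \<open>Differential operators in \<open>y\<^sub>1, \<dots>, y\<^sub>n\<close> commute with the group \<open>W\<close>, because \<open>W\<close> fixes the \<open>y\<^sub>j\<close> and a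
  derivation is determined by its values on them (\<open>derivation_eq_if_eq_on_y\<close>). Therefore every
  decomposition of \<open>1 \<in> \<complex>[W]\<close> into orthogonal idempotents \<open>e\<^sub>T\<close> decomposes \<open>\<O>\<^sub>X\<close> into the
  \<open>\<D>\<^sub>Y\<close>-submodules \<open>e\<^sub>T \<O>\<^sub>X\<close>, and these are the modules \<open>\<D>\<^sub>Y F\<^sub>T\<close> by hypothesis. This is the first part.
  That a class in the presented algebra \<open>\<D>\<^sub>Y\<close> acts unambiguously is \<open>DY_act_representative\<close>.

  For the second part, let \<open>T\<close> and \<open>T\<^sup>*\<close> have the same shape \<open>\<lambda>\<close>. The left ideals \<open>\<complex>[W] e\<^sub>T\<close> and \<open>\<complex>[W] e\<^sub>T\<^sub>*\<close>
  are both isomorphic to \<open>V(\<lambda>)\<close>, so there are \<open>a \<in> e\<^sub>T \<complex>[W] e\<^sub>T\<^sub>*\<close> and \<open>b \<in> e\<^sub>T\<^sub>* \<complex>[W] e\<^sub>T\<close> with \<open>a b = e\<^sub>T\<close> and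
  \<open>b a = e\<^sub>T\<^sub>*\<close>, and \<open>b\<close> is an isomorphism of \<open>\<D>\<^sub>Y\<close>-modules from \<open>e\<^sub>T \<O>\<^sub>X\<close> to \<open>e\<^sub>T\<^sub>* \<O>\<^sub>X\<close>. What remains
  is the count \<open>f\<^sup>\<lambda> = |STab(\<lambda>)|\<close> (\<open>f_dim_eq_card_STab\<close>), which needs two facts.

  The first is Schur's lemma for the ideals \<open>\<complex>[W] e\<^sub>T\<close>: nonzero elements of \<open>e\<^sub>U \<complex>[W] e\<^sub>T\<close> are invertible
  (\<open>primitive_hom_invertible\<close>) and \<open>e\<^sub>T \<complex>[W] e\<^sub>T = \<complex> e\<^sub>T\<close> (\<open>primitive_corner_scalar\<close>). Both follow from
  von Neumann regularity of \<open>\<complex>[W]\<close>, that is, from the positivity of \<open>f\<^sup>* f\<close>.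

  The second is that \<open>e\<^sub>U \<complex>[W] e\<^sub>T = 0\<close> when the shapes \<open>\<mu>\<close> of \<open>U\<close> and \<open>\<lambda>\<close> of \<open>T\<close> differ
  (\<open>corner_nonzero_same_shape\<close>). A higher Specht polynomial \<open>F\<^sub>Y\<close> in \<open>V(\<mu>)\<close> is antisymmetric in the columns
  of \<open>Y\<close>, and \<open>V(\<lambda>)\<close> is spanned by vectors that are symmetric in the rows of tableaux of shape \<open>\<lambda>\<close>. If
  \<open>V(\<mu>) \<cong> V(\<lambda>)\<close>, averaging (\<open>compatible_summand\<close>) produces a tableau of shape \<open>\<lambda>\<close> none of whose rows
  meets a column of \<open>Y\<close> in two entries. Hence \<open>\<mu>\<close> dominates \<open>\<lambda>\<close>, and by symmetry the shapes are equal.\<close>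

section \<open>Monoid algebras\<close>

lemma monoid_algebra_simps [simp]:
  "f \<in> carrier (monoid_algebra G) \<longleftrightarrow> finite {x. f x \<noteq> 0} \<and> {x. f x \<noteq> 0} \<subseteq> carrier G"
  "\<one>\<^bsub>monoid_algebra G\<^esub> = (\<lambda>z. if z = \<one>\<^bsub>G\<^esub> then 1 else 0)"
  "\<zero>\<^bsub>monoid_algebra G\<^esub> = (\<lambda>z. 0)"
  "f \<oplus>\<^bsub>monoid_algebra G\<^esub> g = (\<lambda>z. f z + g z)"
  by (simp_all add: monoid_algebra_def)

lemma monoid_algebra_mult:
  "(f \<otimes>\<^bsub>monoid_algebra G\<^esub> g) z =
     (\<Sum>x | f x \<noteq> 0. \<Sum>y | g y \<noteq> 0. if x \<otimes>\<^bsub>G\<^esub> y = z then f x * g y else 0)"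
  by (simp add: monoid_algebra_def)

lemma monoid_algebra_supp_mult:
  "{z. (f \<otimes>\<^bsub>monoid_algebra G\<^esub> g) z \<noteq> 0} \<subseteq> (\<lambda>(x, y). x \<otimes>\<^bsub>G\<^esub> y) ` ({x. f x \<noteq> 0} \<times> {y. g y \<noteq> 0})"
proof
  fix z assume "z \<in> {z. (f \<otimes>\<^bsub>monoid_algebra G\<^esub> g) z \<noteq> 0}"
  then have "(\<Sum>x | f x \<noteq> 0. \<Sum>y | g y \<noteq> 0. if x \<otimes>\<^bsub>G\<^esub> y = z then f x * g y else 0) \<noteq> 0"
    by (simp add: monoid_algebra_mult)
  then obtain x where x: "x \<in> {x. f x \<noteq> 0}"
    "(\<Sum>y | g y \<noteq> 0. if x \<otimes>\<^bsub>G\<^esub> y = z then f x * g y else 0) \<noteq> 0"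
    by (rule sum.not_neutral_contains_not_neutral)
  from x(2) obtain y where "y \<in> {y. g y \<noteq> 0}" "(if x \<otimes>\<^bsub>G\<^esub> y = z then f x * g y else 0) \<noteq> 0"
    by (rule sum.not_neutral_contains_not_neutral)
  with x(1) show "z \<in> (\<lambda>(x, y). x \<otimes>\<^bsub>G\<^esub> y) ` ({x. f x \<noteq> 0} \<times> {y. g y \<noteq> 0})"
    by (auto split: if_splits)
qed

lemma monoid_algebra_mult_closed:
  assumes "monoid G" "f \<in> carrier (monoid_algebra G)" "g \<in> carrier (monoid_algebra G)"
  shows "f \<otimes>\<^bsub>monoid_algebra G\<^esub> g \<in> carrier (monoid_algebra G)"
proof -
  interpret monoid G by fact
  have "finite ((\<lambda>(x, y). x \<otimes>\<^bsub>G\<^esub> y) ` ({x. f x \<noteq> 0} \<times> {y. g y \<noteq> 0}))"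
    using assms by simp
  moreover have "(\<lambda>(x, y). x \<otimes>\<^bsub>G\<^esub> y) ` ({x. f x \<noteq> 0} \<times> {y. g y \<noteq> 0}) \<subseteq> carrier G"
    using assms by auto
  ultimately show ?thesis
    using monoid_algebra_supp_mult[of G f g] by (auto intro: finite_subset)
qed

text \<open>Summing a product against a function \<open>\<phi>\<close>, with \<open>s\<close> as multiplication by scalars, replaces the
  support of the product by pairs of support elements of the factors. Associativity of the product
  and multiplicativity of the linear extension of an action are both instances.\<close>

lemma sum_mult_monoid_algebra:
  fixes s :: "complex \<Rightarrow> 'v \<Rightarrow> 'v :: comm_monoid_add"
  assumes f: "finite {x. f x \<noteq> 0}" and g: "finite {x. g x \<noteq> 0}"
    and s0: "\<And>v. s 0 v = 0" and sadd: "\<And>a b v. s (a + b) v = s a v + s b v"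
    and Z: "finite Z" "{z. (f \<otimes>\<^bsub>monoid_algebra G\<^esub> g) z \<noteq> 0} \<subseteq> Z"
  shows "(\<Sum>z\<in>Z. s ((f \<otimes>\<^bsub>monoid_algebra G\<^esub> g) z) (\<phi> z)) =
    (\<Sum>x | f x \<noteq> 0. \<Sum>y | g y \<noteq> 0. s (f x * g y) (\<phi> (x \<otimes>\<^bsub>G\<^esub> y)))"
proof -
  let ?Z = "(\<lambda>(x, y). x \<otimes>\<^bsub>G\<^esub> y) ` ({x. f x \<noteq> 0} \<times> {y. g y \<noteq> 0})"
  have fin: "finite ?Z" using f g by simp
  have ssum: "s (sum h A) v = (\<Sum>a\<in>A. s (h a) v)" for h :: "'b \<Rightarrow> complex" and A v
    by (induction A rule: infinite_finite_induct) (auto simp: s0 sadd)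
  have ssum': "s (sum h A) v = (\<Sum>a\<in>A. s (h a) v)" for h :: "'a \<Rightarrow> complex" and A v
    by (induction A rule: infinite_finite_induct) (auto simp: s0 sadd)
  have outZ: "(f \<otimes>\<^bsub>monoid_algebra G\<^esub> g) z = 0" if "z \<notin> Z" for z using that Z by auto
  have outZ': "(f \<otimes>\<^bsub>monoid_algebra G\<^esub> g) z = 0" if "z \<notin> ?Z" for z
    using that monoid_algebra_supp_mult[of G f g] by blast
  have "(\<Sum>z\<in>Z. s ((f \<otimes>\<^bsub>monoid_algebra G\<^esub> g) z) (\<phi> z)) = (\<Sum>z\<in>Z \<union> ?Z. s ((f \<otimes>\<^bsub>monoid_algebra G\<^esub> g) z) (\<phi> z))"
    by (rule sum.mono_neutral_left) (use Z fin outZ s0 in auto)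
  also have "\<dots> = (\<Sum>z\<in>?Z. s ((f \<otimes>\<^bsub>monoid_algebra G\<^esub> g) z) (\<phi> z))"
    by (rule sum.mono_neutral_right) (use Z fin outZ' s0 in auto)
  also have "\<dots> = (\<Sum>z\<in>?Z. \<Sum>x | f x \<noteq> 0. \<Sum>y | g y \<noteq> 0. s (if x \<otimes>\<^bsub>G\<^esub> y = z then f x * g y else 0) (\<phi> z))"
    by (simp add: monoid_algebra_mult ssum ssum')
  also have "\<dots> = (\<Sum>x | f x \<noteq> 0. \<Sum>y | g y \<noteq> 0. \<Sum>z\<in>?Z. s (if x \<otimes>\<^bsub>G\<^esub> y = z then f x * g y else 0) (\<phi> z))"
    by (subst sum.swap) (rule sum.cong[OF refl], rule sum.swap)
  also have "\<dots> = (\<Sum>x | f x \<noteq> 0. \<Sum>y | g y \<noteq> 0. s (f x * g y) (\<phi> (x \<otimes>\<^bsub>G\<^esub> y)))"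
  proof (intro sum.cong refl)
    fix x y assume "x \<in> {x. f x \<noteq> 0}" "y \<in> {y. g y \<noteq> 0}"
    then have "x \<otimes>\<^bsub>G\<^esub> y \<in> ?Z" by auto
    then have "(\<Sum>z\<in>?Z. if x \<otimes>\<^bsub>G\<^esub> y = z then s (f x * g y) (\<phi> z) else 0) = s (f x * g y) (\<phi> (x \<otimes>\<^bsub>G\<^esub> y))"
      using fin by (subst sum.delta') auto
    moreover have "s (if x \<otimes>\<^bsub>G\<^esub> y = z then f x * g y else 0) (\<phi> z) =
        (if x \<otimes>\<^bsub>G\<^esub> y = z then s (f x * g y) (\<phi> z) else 0)" for z
      by (simp add: s0)
    ultimately show "(\<Sum>z\<in>?Z. s (if x \<otimes>\<^bsub>G\<^esub> y = z then f x * g y else 0) (\<phi> z)) =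
        s (f x * g y) (\<phi> (x \<otimes>\<^bsub>G\<^esub> y))" by simp
  qed
  finally show ?thesis .
qed

lemma monoid_algebra_mult_superset:
  assumes "finite A" "{x. f x \<noteq> 0} \<subseteq> A" "finite B" "{x. g x \<noteq> 0} \<subseteq> B"
  shows "(f \<otimes>\<^bsub>monoid_algebra G\<^esub> g) z = (\<Sum>x\<in>A. \<Sum>y\<in>B. if x \<otimes>\<^bsub>G\<^esub> y = z then f x * g y else 0)"
proof -
  have "(\<Sum>y | g y \<noteq> 0. if x \<otimes>\<^bsub>G\<^esub> y = z then f x * g y else 0) = 
     (\<Sum>y\<in>B. if x \<otimes>\<^bsub>G\<^esub> y = z then f x * g y else 0)" for x
    by (rule sum.mono_neutral_left) (use assms in auto)
  then have "(f \<otimes>\<^bsub>monoid_algebra G\<^esub> g) z = (\<Sum>x | f x \<noteq> 0. \<Sum>y\<in>B. if x \<otimes>\<^bsub>G\<^esub> y = z then f x * g y else 0)"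
    by (simp add: monoid_algebra_mult)
  also have "\<dots> = (\<Sum>x\<in>A. \<Sum>y\<in>B. if x \<otimes>\<^bsub>G\<^esub> y = z then f x * g y else 0)"
    by (rule sum.mono_neutral_left) (use assms in \<open>auto intro!: sum.neutral split: if_splits\<close>)
  finally show ?thesis .
qed

lemma monoid_algebra_mult_assoc:
  assumes G: "monoid G" and f: "f \<in> carrier (monoid_algebra G)"
    and g: "g \<in> carrier (monoid_algebra G)" and h: "h \<in> carrier (monoid_algebra G)"
  shows "(f \<otimes>\<^bsub>monoid_algebra G\<^esub> g) \<otimes>\<^bsub>monoid_algebra G\<^esub> h = f \<otimes>\<^bsub>monoid_algebra G\<^esub> (g \<otimes>\<^bsub>monoid_algebra G\<^esub> h)"
proof
  interpret monoid G by fact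
  fix w
  let ?m = "\<lambda>f g. f \<otimes>\<^bsub>monoid_algebra G\<^esub> g"
  have fg: "?m f g \<in> carrier (monoid_algebra G)" and gh: "?m g h \<in> carrier (monoid_algebra G)"
    using monoid_algebra_mult_closed[OF G] f g h by blast+
  have "?m (?m f g) h w = (\<Sum>z | ?m f g z \<noteq> 0. ?m f g z * (\<Sum>k | h k \<noteq> 0. if z \<otimes>\<^bsub>G\<^esub> k = w then h k else 0))"
    by (subst monoid_algebra_mult) (auto simp: sum_distrib_left intro!: sum.cong)
  also have "\<dots> = (\<Sum>x | f x \<noteq> 0. \<Sum>y | g y \<noteq> 0. f x * g y * (\<Sum>k | h k \<noteq> 0. if x \<otimes>\<^bsub>G\<^esub> y \<otimes>\<^bsub>G\<^esub> k = w then h k else 0))"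
    by (rule sum_mult_monoid_algebra) (use f g h fg in \<open>auto simp: algebra_simps\<close>)
  also have "\<dots> = (\<Sum>x | f x \<noteq> 0. f x * (\<Sum>y | g y \<noteq> 0. \<Sum>k | h k \<noteq> 0. g y * h k * (if x \<otimes>\<^bsub>G\<^esub> (y \<otimes>\<^bsub>G\<^esub> k) = w then 1 else 0)))"
    unfolding sum_distrib_left
    by (intro sum.cong refl) (use f g h in \<open>auto simp: m_assoc subset_iff\<close>)
  also have "\<dots> = (\<Sum>x | f x \<noteq> 0. f x * (\<Sum>z | ?m g h z \<noteq> 0. ?m g h z * (if x \<otimes>\<^bsub>G\<^esub> z = w then 1 else 0)))"
    by (subst sum_mult_monoid_algebra[where s="\<lambda>a b. a * b"]) (use f g h gh in \<open>auto simp: algebra_simps\<close>)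
  also have "\<dots> = ?m f (?m g h) w"
    by (subst (2) monoid_algebra_mult) (auto simp: sum_distrib_left intro!: sum.cong)
  finally show "?m (?m f g) h w = ?m f (?m g h) w" .
qed

lemma monoid_algebra_one_mult:
  assumes G: "monoid G" and f: "f \<in> carrier (monoid_algebra G)"
  shows "\<one>\<^bsub>monoid_algebra G\<^esub> \<otimes>\<^bsub>monoid_algebra G\<^esub> f = f" "f \<otimes>\<^bsub>monoid_algebra G\<^esub> \<one>\<^bsub>monoid_algebra G\<^esub> = f"
proof -
  interpret monoid G by fact
  have 1: "(\<Sum>y | f y \<noteq> 0. if y = z then f y else 0) = f z" for z
    using f by (subst sum.delta) auto
  show "\<one>\<^bsub>monoid_algebra G\<^esub> \<otimes>\<^bsub>monoid_algebra G\<^esub> f = f"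
  proof
    fix z
    have "(\<one>\<^bsub>monoid_algebra G\<^esub> \<otimes>\<^bsub>monoid_algebra G\<^esub> f) z = 
      (\<Sum>y | f y \<noteq> 0. if \<one>\<^bsub>G\<^esub> \<otimes>\<^bsub>G\<^esub> y = z then f y else 0)"
      by (subst monoid_algebra_mult_superset[where A="{\<one>\<^bsub>G\<^esub>}" and B="{y. f y \<noteq> 0}"])
        (use f in \<open>auto intro!: sum.cong\<close>)
    also have "\<dots> = (\<Sum>y | f y \<noteq> 0. if y = z then f y else 0)"
      by (rule sum.cong) (use f in \<open>auto simp: subset_iff\<close>)
    finally show "(\<one>\<^bsub>monoid_algebra G\<^esub> \<otimes>\<^bsub>monoid_algebra G\<^esub> f) z = f z" using 1 by simp
  qed
  show "f \<otimes>\<^bsub>monoid_algebra G\<^esub> \<one>\<^bsub>monoid_algebra G\<^esub> = f"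
  proof
    fix z
    have "(f \<otimes>\<^bsub>monoid_algebra G\<^esub> \<one>\<^bsub>monoid_algebra G\<^esub>) z = 
      (\<Sum>y | f y \<noteq> 0. if y \<otimes>\<^bsub>G\<^esub> \<one>\<^bsub>G\<^esub> = z then f y else 0)"
      by (subst monoid_algebra_mult_superset[where B="{\<one>\<^bsub>G\<^esub>}" and A="{y. f y \<noteq> 0}"])
        (use f in \<open>auto intro!: sum.cong\<close>)
    also have "\<dots> = (\<Sum>y | f y \<noteq> 0. if y = z then f y else 0)"
      by (rule sum.cong) (use f in \<open>auto simp: subset_iff\<close>)
    finally show "(f \<otimes>\<^bsub>monoid_algebra G\<^esub> \<one>\<^bsub>monoid_algebra G\<^esub>) z = f z" using 1 by simp
  qed
qed

lemma finite_supp_add: "finite {x. f x \<noteq> (0::complex)} \<Longrightarrow> finite {x. g x \<noteq> 0} \<Longrightarrow> finite {x. f x + g x \<noteq> 0}"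
  by (rule finite_subset[of _ "{x. f x \<noteq> 0} \<union> {x. g x \<noteq> 0}"]) auto

lemma monoid_algebra_distr:
  assumes f: "f \<in> carrier (monoid_algebra G)" and g: "g \<in> carrier (monoid_algebra G)" and h: "h \<in> carrier (monoid_algebra G)"
  shows "(f \<oplus>\<^bsub>monoid_algebra G\<^esub> g) \<otimes>\<^bsub>monoid_algebra G\<^esub> h = f \<otimes>\<^bsub>monoid_algebra G\<^esub> h \<oplus>\<^bsub>monoid_algebra G\<^esub> g \<otimes>\<^bsub>monoid_algebra G\<^esub> h"
    and "h \<otimes>\<^bsub>monoid_algebra G\<^esub> (f \<oplus>\<^bsub>monoid_algebra G\<^esub> g) = h \<otimes>\<^bsub>monoid_algebra G\<^esub> f \<oplus>\<^bsub>monoid_algebra G\<^esub> h \<otimes>\<^bsub>monoid_algebra G\<^esub> g"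
proof -
  let ?A = "{x. f x \<noteq> 0} \<union> {x. g x \<noteq> 0}" and ?B = "{x. h x \<noteq> 0}"
  have fin: "finite ?A" "finite ?B" using f g h by auto
  have sub: "{x. f x + g x \<noteq> 0} \<subseteq> ?A" "{x. f x \<noteq> 0} \<subseteq> ?A" "{x. g x \<noteq> 0} \<subseteq> ?A" by auto
  note m = monoid_algebra_mult_superset[OF fin(1) _ fin(2) order.refl]
  note m' = monoid_algebra_mult_superset[OF fin(2) order.refl fin(1)]
  show "(f \<oplus>\<^bsub>monoid_algebra G\<^esub> g) \<otimes>\<^bsub>monoid_algebra G\<^esub> h = f \<otimes>\<^bsub>monoid_algebra G\<^esub> h \<oplus>\<^bsub>monoid_algebra G\<^esub> g \<otimes>\<^bsub>monoid_algebra G\<^esub> h"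
    by (rule ext) (simp add: m sub sum.distrib[symmetric], intro sum.cong refl, auto simp: algebra_simps)
  show "h \<otimes>\<^bsub>monoid_algebra G\<^esub> (f \<oplus>\<^bsub>monoid_algebra G\<^esub> g) = h \<otimes>\<^bsub>monoid_algebra G\<^esub> f \<oplus>\<^bsub>monoid_algebra G\<^esub> h \<otimes>\<^bsub>monoid_algebra G\<^esub> g"
    by (rule ext) (simp add: m' sub sum.distrib[symmetric], intro sum.cong refl, auto simp: algebra_simps)
qed

lemma ring_monoid_algebra:
  assumes "monoid G"
  shows "ring (monoid_algebra G)"
proof (rule ringI)
  interpret monoid G by fact
  show "abelian_group (monoid_algebra G)"
  proof (rule abelian_groupI)
    fix f g assume "f \<in> carrier (monoid_algebra G)" "g \<in> carrier (monoid_algebra G)"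
    then show "f \<oplus>\<^bsub>monoid_algebra G\<^esub> g \<in> carrier (monoid_algebra G)"
      using finite_supp_add[of f g] unfolding monoid_algebra_simps
      by (auto simp: subset_iff) (metis add.right_neutral)
  next
    fix f assume f: "f \<in> carrier (monoid_algebra G)"
    then show "\<exists>g\<in>carrier (monoid_algebra G). g \<oplus>\<^bsub>monoid_algebra G\<^esub> f = \<zero>\<^bsub>monoid_algebra G\<^esub>"
      by (intro bexI[of _ "\<lambda>x. - f x"]) auto
  qed (auto simp: add_ac)
  show "Group.monoid (monoid_algebra G)"
  proof (rule monoidI)
    show "\<one>\<^bsub>monoid_algebra G\<^esub> \<in> carrier (monoid_algebra G)"
      by (auto intro: finite_subset[of _ "{\<one>\<^bsub>G\<^esub>}"])
  qed (auto simp del: monoid_algebra_simps simp: monoid_algebra_mult_assoc[OF assms]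
         monoid_algebra_one_mult[OF assms] monoid_algebra_mult_closed[OF assms])
qed (auto simp del: monoid_algebra_simps simp: monoid_algebra_distr)

lemma finsum_monoid_algebra:
  assumes "monoid G" "finite I" "\<And>i. i \<in> I \<Longrightarrow> f i \<in> carrier (monoid_algebra G)"
  shows "(\<Oplus>\<^bsub>monoid_algebra G\<^esub>i\<in>I. f i) = (\<lambda>z. \<Sum>i\<in>I. f i z)"
  using assms(2,3)
proof (induction I rule: finite_induct)
  interpret ring "monoid_algebra G" by (rule ring_monoid_algebra) fact
  case empty
  then show ?case by simp
next
  interpret ring "monoid_algebra G" by (rule ring_monoid_algebra) fact
  case (insert i I)
  then have "(\<Oplus>\<^bsub>monoid_algebra G\<^esub>i\<in>insert i I. f i) = f i \<oplus>\<^bsub>monoid_algebra G\<^esub> (\<Oplus>\<^bsub>monoid_algebra G\<^esub>i\<in>I. f i)"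
    by (intro finsum_insert) (auto simp del: monoid_algebra_simps)
  with insert show ?case by simp
qed

section \<open>Linear extension of an action\<close>

lemma Cst_0 [simp]: "Cst 0 = 0" and Cst_1 [simp]: "Cst 1 = 1"
  and Cst_add: "Cst (a + b) = Cst a + Cst b" and Cst_mult: "Cst (a * b) = Cst a * Cst b"
  and Cst_uminus: "Cst (- a) = - Cst a"
  and Cst_eq_0_iff [simp]: "Cst a = 0 \<longleftrightarrow> a = 0"
  unfolding Cst_def
  by (simp_all add: single_add mult_single single_uminus) (metis lookup_single_eq lookup_zero single_zero)

lemma cscale_simps [simp]: "cscale 0 f = 0" "cscale 1 f = f" "cscale c 0 = 0" "cscale (-1) f = - f"
  by (simp_all add: cscale_def Cst_uminus)

lemma cscale_add_left: "cscale (a + b) f = cscale a f + cscale b f"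
  and cscale_add_right: "cscale a (f + g) = cscale a f + cscale a g"
  and cscale_cscale: "cscale a (cscale b f) = cscale (a * b) f"
  by (simp_all add: cscale_def Cst_add Cst_mult algebra_simps)

lemma cscale_eq_0_iff [simp]: "cscale a f = 0 \<longleftrightarrow> a = 0 \<or> f = 0"
  by (simp add: cscale_def)

interpretation cvs: vector_space cscale
  by unfold_locales (simp_all add: cscale_add_left cscale_add_right cscale_cscale)

definition clinear :: "(ratf \<Rightarrow> ratf) \<Rightarrow> bool" where
  "clinear h \<longleftrightarrow> (\<forall>f g. h (f + g) = h f + h g) \<and> (\<forall>c f. h (cscale c f) = cscale c (h f))"

lemma clinearD:
  assumes "clinear h"
  shows "h (f + g) = h f + h g" "h (cscale c f) = cscale c (h f)" "h 0 = 0" "h (- f) = - h f"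
    "h (f - g) = h f - h g" "h (\<Sum>i\<in>I. k i) = (\<Sum>i\<in>I. h (k i))"
proof -
  show a: "h (f + g) = h f + h g" and b: "h (cscale c f) = cscale c (h f)" for f g c
    using assms by (auto simp: clinear_def)
  show z: "h 0 = 0" using b[of 0 0] by simp
  show n: "h (- f) = - h f" for f using b[of "-1" f] by simp
  show "h (f - g) = h f - h g" using a[of f "- g"] n[of g] by simp
  show "h (\<Sum>i\<in>I. k i) = (\<Sum>i\<in>I. h (k i))"
    by (induction I rule: infinite_finite_induct) (auto simp: z a)
qed

lemma lin_act_superset:
  assumes "finite A" "{g. a g \<noteq> 0} \<subseteq> A"
  shows "lin_act \<rho> a v = (\<Sum>g\<in>A. cscale (a g) (\<rho> g v))"
  unfolding lin_act_def by (rule sum.mono_neutral_left) (use assms in auto)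

lemma clinear_lin_act:
  assumes "\<And>g. a g \<noteq> 0 \<Longrightarrow> clinear (\<rho> g)"
  shows "clinear (lin_act \<rho> a)"
  unfolding clinear_def
proof (intro conjI allI)
  show "lin_act \<rho> a (f + g) = lin_act \<rho> a f + lin_act \<rho> a g" for f g
    unfolding lin_act_def sum.distrib[symmetric]
    by (intro sum.cong refl) (use assms in \<open>auto simp: clinearD cscale_add_right\<close>)
  show "lin_act \<rho> a (cscale c f) = cscale c (lin_act \<rho> a f)" for c f
    unfolding lin_act_def cvs.scale_sum_right
    by (intro sum.cong refl) (use assms in \<open>auto simp: clinearD cscale_cscale mult.commute\<close>)
qed

lemma lin_act_add:
  assumes "finite {x. a x \<noteq> 0}" "finite {x. b x \<noteq> 0}"
  shows "lin_act \<rho> (\<lambda>x. a x + b x) v = lin_act \<rho> a v + lin_act \<rho> b v"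
proof -
  let ?A = "{x. a x \<noteq> 0} \<union> {x. b x \<noteq> 0}"
  have fin: "finite ?A" using assms by simp
  have "{x. a x + b x \<noteq> 0} \<subseteq> ?A" "{x. a x \<noteq> 0} \<subseteq> ?A" "{x. b x \<noteq> 0} \<subseteq> ?A" by auto
  from this[THEN lin_act_superset[OF fin]] show ?thesis
    by (simp add: cscale_add_left sum.distrib)
qed

lemma lin_act_scale: "lin_act \<rho> (\<lambda>x. c * a x) v = cscale c (lin_act \<rho> a v)"
  by (cases "c = 0") (simp_all add: lin_act_def cvs.scale_sum_right cscale_cscale)

lemma lin_act_zero [simp]: "lin_act \<rho> (\<lambda>x. 0) v = 0"
  by (simp add: lin_act_def)

lemma lin_act_sum:
  assumes "finite I" "\<And>i. i \<in> I \<Longrightarrow> finite {x. a i x \<noteq> 0}"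
  shows "lin_act \<rho> (\<lambda>x. \<Sum>i\<in>I. a i x) v = (\<Sum>i\<in>I. lin_act \<rho> (a i) v)"
  using assms
proof (induction I rule: finite_induct)
  case (insert i I)
  have "finite {x. (\<Sum>i\<in>I. a i x) \<noteq> 0}"
    by (rule finite_subset[of _ "\<Union>i\<in>I. {x. a i x \<noteq> 0}"]) (use insert in \<open>auto intro: ccontr sum.neutral\<close>)
  with insert show ?case by (simp add: lin_act_add)
qed simp

lemma lin_act_single [simp]: "lin_act \<rho> (\<lambda>x. if x = g then c else 0) v = cscale c (\<rho> g v)"
  by (subst lin_act_superset[of "{g}"]) auto

lemma lin_act_mult:
  assumes a: "a \<in> carrier (monoid_algebra G)" and b: "b \<in> carrier (monoid_algebra G)" and G: "monoid G"
    and lin: "\<And>g. g \<in> carrier G \<Longrightarrow> clinear (\<rho> g)"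
    and hom: "\<And>g h v. g \<in> carrier G \<Longrightarrow> h \<in> carrier G \<Longrightarrow> \<rho> (g \<otimes>\<^bsub>G\<^esub> h) v = \<rho> g (\<rho> h v)"
  shows "lin_act \<rho> (a \<otimes>\<^bsub>monoid_algebra G\<^esub> b) v = lin_act \<rho> a (lin_act \<rho> b v)"
proof -
  have "a \<otimes>\<^bsub>monoid_algebra G\<^esub> b \<in> carrier (monoid_algebra G)"
    using monoid_algebra_mult_closed[OF G a b] .
  then have "lin_act \<rho> (a \<otimes>\<^bsub>monoid_algebra G\<^esub> b) v =
      (\<Sum>x | a x \<noteq> 0. \<Sum>y | b y \<noteq> 0. cscale (a x * b y) (\<rho> (x \<otimes>\<^bsub>G\<^esub> y) v))"
    unfolding lin_act_def
    by (intro sum_mult_monoid_algebra[where s=cscale]) (use a b in \<open>auto simp: cscale_add_left\<close>)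
  also have "\<dots> = (\<Sum>x | a x \<noteq> 0. cscale (a x) (\<rho> x (lin_act \<rho> b v)))"
  proof (intro sum.cong refl)
    fix x assume "x \<in> {x. a x \<noteq> 0}"
    then have x: "x \<in> carrier G" using a by auto
    have "(\<Sum>y | b y \<noteq> 0. cscale (a x * b y) (\<rho> (x \<otimes>\<^bsub>G\<^esub> y) v)) =
      (\<Sum>y | b y \<noteq> 0. cscale (a x) (\<rho> x (cscale (b y) (\<rho> y v))))"
      by (intro sum.cong refl) (use b x in \<open>auto simp: hom subset_iff clinearD(2)[OF lin] cscale_cscale\<close>)
    then show "(\<Sum>y | b y \<noteq> 0. cscale (a x * b y) (\<rho> (x \<otimes>\<^bsub>G\<^esub> y) v)) = cscale (a x) (\<rho> x (lin_act \<rho> b v))"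
      by (simp add: lin_act_def clinearD(6)[OF lin[OF x]] cvs.scale_sum_right)
  qed
  finally show ?thesis by (simp add: lin_act_def)
qed

section \<open>Algebras with a positive involution\<close>

text \<open>The value of a complex polynomial at an element of a noncommutative ring, by Horner's scheme;
  \<open>sc\<close> embeds the scalars.\<close>

definition poly_at :: "('a, 'm) ring_scheme \<Rightarrow> (complex \<Rightarrow> 'a) \<Rightarrow> 'a \<Rightarrow> complex poly \<Rightarrow> 'a" where
  "poly_at R sc z p = fold_coeffs (\<lambda>a b. sc a \<oplus>\<^bsub>R\<^esub> z \<otimes>\<^bsub>R\<^esub> b) p \<zero>\<^bsub>R\<^esub>"

locale complex_algebra = ring R for R (structure) +
  fixes sc :: "complex \<Rightarrow> 'a"
  assumes sc_closed [simp, intro]: "sc c \<in> carrier R"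
    and sc_0 [simp]: "sc 0 = \<zero>" and sc_1 [simp]: "sc 1 = \<one>"
    and sc_add: "sc (a + b) = sc a \<oplus> sc b" and sc_mult: "sc (a * b) = sc a \<otimes> sc b"
    and sc_comm: "x \<in> carrier R \<Longrightarrow> x \<otimes> sc c = sc c \<otimes> x"
begin

abbreviation ev where "ev z p \<equiv> poly_at R sc z p"

lemma eq_if_minus_zero:
  assumes "a \<in> carrier R" "b \<in> carrier R" "a \<ominus> b = \<zero>"
  shows "a = b"
  using assms minus_equality[of a "\<ominus> b"] by (simp add: minus_eq)

lemma ev_0 [simp]: "ev z 0 = \<zero>" by (simp add: poly_at_def)

lemma ev_pCons: "z \<in> carrier R \<Longrightarrow> ev z (pCons a p) = sc a \<oplus> z \<otimes> ev z p"
  by (cases "a = 0 \<and> p = 0") (auto simp: poly_at_def)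

lemma ev_closed [simp, intro]: "z \<in> carrier R \<Longrightarrow> ev z p \<in> carrier R"
  by (induction p) (auto simp: ev_pCons)

lemma ev_add: "z \<in> carrier R \<Longrightarrow> ev z (p + q) = ev z p \<oplus> ev z q"
proof (induction p arbitrary: q)
  case (pCons a p)
  obtain b r where q: "q = pCons b r" by (cases q)
  have "sc a \<oplus> sc b \<oplus> (z \<otimes> ev z p \<oplus> z \<otimes> ev z r) = sc a \<oplus> z \<otimes> ev z p \<oplus> (sc b \<oplus> z \<otimes> ev z r)"
    using pCons by (simp add: a_ac)
  with pCons q show ?case by (simp add: ev_pCons sc_add r_distr)
qed simp

lemma ev_smult: "z \<in> carrier R \<Longrightarrow> ev z (Polynomial.smult c p) = sc c \<otimes> ev z p"
proof (induction p)
  case (pCons a p)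
  then have "z \<otimes> (sc c \<otimes> ev z p) = sc c \<otimes> (z \<otimes> ev z p)"
    by (metis sc_comm m_assoc sc_closed ev_closed)
  with pCons show ?case by (simp add: ev_pCons sc_mult r_distr)
qed simp

lemma ev_commute: "z \<in> carrier R \<Longrightarrow> z \<otimes> ev z p = ev z p \<otimes> z"
proof (induction p)
  case (pCons a p)
  then have "z \<otimes> (z \<otimes> ev z p) = z \<otimes> ev z p \<otimes> z" by (metis m_assoc ev_closed)
  with pCons.prems show ?case by (simp add: ev_pCons l_distr r_distr sc_comm)
qed simp

end

text \<open>The model is \<open>\<complex>[G]\<close> with \<open>f\<^sup>*(g) = cnj (f (g\<^sup>-\<^sup>1))\<close>. Positivity of the involution and algebraicity of the
  elements together take the place of semisimplicity.\<close>

locale star_algebra = complex_algebra +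
  fixes star :: "'a \<Rightarrow> 'a"
  assumes star_closed [simp, intro]: "x \<in> carrier R \<Longrightarrow> star x \<in> carrier R"
    and star_mult: "x \<in> carrier R \<Longrightarrow> v \<in> carrier R \<Longrightarrow> star (x \<otimes> v) = star v \<otimes> star x"
    and star_star [simp]: "x \<in> carrier R \<Longrightarrow> star (star x) = x"
    and star_pos: "x \<in> carrier R \<Longrightarrow> star x \<otimes> x = \<zero> \<Longrightarrow> x = \<zero>"
    and algebraic: "z \<in> carrier R \<Longrightarrow> \<exists>p. p \<noteq> 0 \<and> poly_at R sc z p = \<zero>"
begin

text \<open>In a relation \<open>p(k) = 0\<close> of least degree for a positive element \<open>k = h\<^sup>* h\<close>, the factor
  \<open>X\<close> divides \<open>p\<close> at most once, because \<open>k\<^sup>2 x = 0\<close> implies \<open>k x = 0\<close>.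
  Solving the relation for \<open>k\<close> shows that \<open>k\<close> is a multiple of \<open>k\<^sup>2\<close>.\<close>

lemma positive_square_divides:
  assumes h: "h \<in> carrier R" and k: "k = star h \<otimes> h"
  shows "\<exists>q. k = k \<otimes> k \<otimes> ev k q"
proof -
  have kc [simp]: "k \<in> carrier R" using h k by simp
  have star_k: "star k = k" using h k by (simp add: star_mult)
  have sq0: "k \<otimes> x = \<zero>" if x: "x \<in> carrier R" and kk: "k \<otimes> (k \<otimes> x) = \<zero>" for x
  proof (rule star_pos)
    show "star (k \<otimes> x) \<otimes> (k \<otimes> x) = \<zero>"
      using x kk by (simp add: star_mult star_k m_assoc)
  qed (use x in simp)
  define P where "P p \<longleftrightarrow> p \<noteq> 0 \<and> ev k p = \<zero>" for p
  have "\<exists>p. P p" using algebraic[of k] by (auto simp: P_def)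
  then obtain p where p: "P p" and min: "\<And>q. P q \<Longrightarrow> degree p \<le> degree q"
    using ex_has_least_nat[of P _ degree] by blast
  have solve: "k = k \<otimes> k \<otimes> ev k (Polynomial.smult (- 1 / d) r)"
    if d: "d \<noteq> 0" and z: "k \<otimes> (sc d \<oplus> k \<otimes> ev k r) = \<zero>" for d r
  proof -
    have "sc (1 / d) \<otimes> (sc d \<otimes> k) = k"
      using d by (simp add: m_assoc[symmetric] sc_mult[symmetric])
    moreover have "sc d \<otimes> k \<oplus> k \<otimes> k \<otimes> ev k r = \<zero>"
      using z by (simp add: r_distr sc_comm m_assoc)
    then have "sc (1 / d) \<otimes> (sc d \<otimes> k) \<oplus> sc (1 / d) \<otimes> (k \<otimes> k \<otimes> ev k r) = \<zero>"
      by (metis r_distr r_null sc_closed kc m_closed ev_closed)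
    ultimately have *: "k \<oplus> sc (1 / d) \<otimes> (k \<otimes> k \<otimes> ev k r) = \<zero>" by simp
    have neg: "sc (- 1 / d) \<otimes> x \<oplus> sc (1 / d) \<otimes> x = \<zero>" if "x \<in> carrier R" for x
      using that by (simp add: l_distr[symmetric] sc_add[symmetric])
    have "k = sc (- 1 / d) \<otimes> (k \<otimes> k \<otimes> ev k r)"
      using minus_equality[OF *] minus_equality[OF neg[of "k \<otimes> k \<otimes> ev k r"]] by simp
    also have "\<dots> = k \<otimes> k \<otimes> ev k (Polynomial.smult (- 1 / d) r)"
    proof -
      have "sc c \<otimes> (k \<otimes> k \<otimes> x) = k \<otimes> k \<otimes> (sc c \<otimes> x)" if "x \<in> carrier R" for c x
        using that by (simp add: m_assoc[symmetric] sc_comm)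
      then show ?thesis by (simp only: ev_smult[OF kc] ev_closed[OF kc])
    qed
    finally show ?thesis .
  qed
  obtain c q where pq: "p = pCons c q" by (cases p)
  have rel: "sc c \<oplus> k \<otimes> ev k q = \<zero>" using p by (simp add: P_def pq ev_pCons)
  show ?thesis
  proof (cases "c = 0")
    case False
    have "k \<otimes> (sc c \<oplus> k \<otimes> ev k q) = \<zero>" by (simp add: rel)
    from solve[OF False this] show ?thesis by blast
  next
    case True
    then have kq: "k \<otimes> ev k q = \<zero>" and q0: "q \<noteq> 0" using rel p by (auto simp: P_def pq)
    have "\<not> P q" using min[of q] q0 by (auto simp: pq)
    then have evq: "ev k q \<noteq> \<zero>" using q0 by (simp add: P_def)
    obtain d r where qr: "q = pCons d r" by (cases q)
    have "d \<noteq> 0"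
    proof
      assume "d = 0"
      then have "k \<otimes> (k \<otimes> ev k r) = \<zero>" using kq by (simp add: qr ev_pCons)
      with sq0[of "ev k r"] \<open>d = 0\<close> evq show False by (simp add: qr ev_pCons)
    qed
    from solve[OF this, of r] kq show ?thesis by (auto simp: qr ev_pCons)
  qed
qed

text \<open>Write \<open>k = h\<^sup>* h = k\<^sup>2 s\<close> with \<open>s\<close> a polynomial in \<open>k\<close>. Positivity applied to \<open>h (k s - 1)\<close> gives
  \<open>h = h k s = h (s h\<^sup>*) h\<close>.\<close>

lemma von_neumann_regular:
  assumes h: "h \<in> carrier R"
  shows "\<exists>h'\<in>carrier R. h \<otimes> h' \<otimes> h = h"
proof -
  define k where "k = star h \<otimes> h"
  have kc [simp]: "k \<in> carrier R" using h k_def by simp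
  obtain q where q: "k = k \<otimes> k \<otimes> ev k q" using positive_square_divides[OF h k_def] by blast
  define s where "s = ev k q"
  have sc' [simp]: "s \<in> carrier R" by (simp add: s_def)
  define w where "w = k \<otimes> s \<ominus> \<one>"
  have w [simp]: "w \<in> carrier R" by (simp add: w_def)
  have "star h \<otimes> (h \<otimes> w) = k \<otimes> k \<otimes> s \<ominus> k"
    using h by (simp add: k_def[symmetric] w_def m_assoc[symmetric] minus_eq r_distr r_minus)
  also have "\<dots> = \<zero>" using q by (simp add: s_def[symmetric] minus_eq r_neg)
  finally have "star h \<otimes> (h \<otimes> w) = \<zero>" .
  then have "star (h \<otimes> w) \<otimes> (h \<otimes> w) = \<zero>"
    using h by (simp add: star_mult m_assoc)
  then have "h \<otimes> w = \<zero>" using star_pos h by simp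
  then have "h \<otimes> (k \<otimes> s) \<ominus> h = \<zero>"
    using h by (simp add: w_def minus_eq r_distr r_minus)
  then have "h \<otimes> (k \<otimes> s) = h" using h eq_if_minus_zero[of "h \<otimes> (k \<otimes> s)" h] by simp
  moreover have "k \<otimes> s = s \<otimes> k" by (simp add: s_def ev_commute)
  ultimately have "h \<otimes> (s \<otimes> star h) \<otimes> h = h" using h by (simp add: k_def m_assoc)
  with h show ?thesis by (intro bexI[of _ "s \<otimes> star h"]) auto
qed

lemma primitive_idempotentD:
  assumes "primitive_idempotent R e"
  shows "e \<in> carrier R" "e \<otimes> e = e" "e \<noteq> \<zero>"
  using assms by (auto simp: primitive_idempotent_def idempotent_def)

text \<open>Otherwise \<open>e = a + (e - a)\<close> would split \<open>e\<close> into two nonzero orthogonal idempotents.\<close>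

lemma primitive_corner_idempotent:
  assumes e: "primitive_idempotent R e"
    and a: "a \<in> carrier R" "a \<otimes> a = a" "e \<otimes> a = a" "a \<otimes> e = a" "a \<noteq> \<zero>"
  shows "a = e"
proof -
  note e' [simp] = primitive_idempotentD[OF e]
  have "idempotent R (e \<ominus> a)" "idempotent R a"
    using a by (simp_all add: idempotent_def minus_eq l_distr r_distr l_minus r_minus r_neg l_neg)
  moreover have "a \<otimes> (e \<ominus> a) = \<zero>" "(e \<ominus> a) \<otimes> a = \<zero>"
    using a by (simp_all add: minus_eq l_distr r_distr l_minus r_minus r_neg l_neg)
  moreover have "e = a \<oplus> (e \<ominus> a)" using a by (simp add: minus_eq a_lcomm[of a e] r_neg)
  ultimately have "e \<ominus> a = \<zero>" using e a unfolding primitive_idempotent_def by blast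
  then show ?thesis using a eq_if_minus_zero[of e a] by simp
qed

text \<open>By regularity a nonzero element of \<open>f R e\<close> has a one-sided quasi-inverse; both products are
  nonzero idempotents in the corners \<open>f R f\<close> and \<open>e R e\<close>, hence equal to \<open>f\<close> and \<open>e\<close>. This is
  Schur's lemma for the left ideals \<open>R e\<close> and \<open>R f\<close>.\<close>

lemma primitive_hom_invertible:
  assumes e: "primitive_idempotent R e" and f: "primitive_idempotent R f"
    and z: "z \<in> carrier R" "f \<otimes> z = z" "z \<otimes> e = z" "z \<noteq> \<zero>"
  shows "\<exists>v\<in>carrier R. e \<otimes> v = v \<and> v \<otimes> f = v \<and> z \<otimes> v = f \<and> v \<otimes> z = e"
proof -
  note [simp] = primitive_idempotentD[OF e] primitive_idempotentD[OF f]
  obtain h where h [simp]: "h \<in> carrier R" and zhz: "z \<otimes> h \<otimes> z = z"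
    using von_neumann_regular z by blast
  define y where "y = e \<otimes> h \<otimes> f"
  have y: "y \<in> carrier R" "e \<otimes> y = y" "y \<otimes> f = y"
    by (simp_all add: y_def m_assoc) (simp_all add: m_assoc[symmetric])
  have "z \<otimes> y \<otimes> z = (z \<otimes> e) \<otimes> h \<otimes> (f \<otimes> z)" using z(1) by (simp add: y_def m_assoc)
  then have zyz: "z \<otimes> y \<otimes> z = z" using z zhz by simp
  have "z \<otimes> y = f"
  proof (rule primitive_corner_idempotent[OF f])
    show "z \<otimes> y \<otimes> (z \<otimes> y) = z \<otimes> y" using z(1) y zyz by (simp add: m_assoc[symmetric])
    show "f \<otimes> (z \<otimes> y) = z \<otimes> y" using z y by (simp add: m_assoc[symmetric])
    show "z \<otimes> y \<otimes> f = z \<otimes> y" using z y by (simp add: m_assoc)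
    show "z \<otimes> y \<noteq> \<zero>" using zyz z by auto
  qed (use z y in simp)
  moreover have "y \<otimes> z = e"
  proof (rule primitive_corner_idempotent[OF e])
    show "y \<otimes> z \<otimes> (y \<otimes> z) = y \<otimes> z" using z(1) y zyz by (simp add: m_assoc)
    show "e \<otimes> (y \<otimes> z) = y \<otimes> z" using z y by (simp add: m_assoc[symmetric])
    show "y \<otimes> z \<otimes> e = y \<otimes> z" using z y by (simp add: m_assoc)
    show "y \<otimes> z \<noteq> \<zero>" using zyz z y by (auto simp: m_assoc)
  qed (use z y in simp)
  ultimately show ?thesis using y by blast
qed

text \<open>A root \<open>\<alpha>\<close> of a polynomial relation of least degree for \<open>z\<close> makes \<open>z - \<alpha> e\<close> a zero divisor in the
  corner \<open>e R e\<close>. All nonzero elements of the corner are invertible in it, so \<open>z = \<alpha> e\<close>.\<close>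

lemma primitive_corner_scalar:
  assumes e: "primitive_idempotent R e"
    and z: "z \<in> carrier R" "e \<otimes> z = z" "z \<otimes> e = z"
  shows "\<exists>c. z = sc c \<otimes> e"
proof -
  note e' [simp] = primitive_idempotentD[OF e]
  define P where "P p \<longleftrightarrow> p \<noteq> 0 \<and> e \<otimes> ev z p \<otimes> e = \<zero>" for p
  have "\<exists>p. P p" using algebraic[OF z(1)] by (auto simp: P_def)
  then obtain p where p: "P p" and min: "\<And>q. P q \<Longrightarrow> degree p \<le> degree q"
    using ex_has_least_nat[of P _ degree] by blast
  have "degree p \<noteq> 0"
  proof
    assume "degree p = 0"
    then obtain c where c: "p = [:c:]" by (metis degree_eq_zeroE)
    then have "c \<noteq> 0" "e \<otimes> sc c \<otimes> e = \<zero>" using p z by (auto simp: P_def ev_pCons)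
    then have "sc c \<otimes> e = \<zero>" by (simp add: sc_comm m_assoc)
    then have "sc (1 / c) \<otimes> (sc c \<otimes> e) = \<zero>" by simp
    then show False using \<open>c \<noteq> 0\<close> by (simp add: m_assoc[symmetric] sc_mult[symmetric])
  qed
  then obtain \<alpha> where "poly p \<alpha> = 0"
    using fundamental_theorem_of_algebra[of p] constant_degree[of p] by metis
  then obtain q where pq: "p = [:-\<alpha>, 1:] * q" by (metis dvdE poly_eq_0_iff_dvd)
  have "q \<noteq> 0" using p pq by (auto simp: P_def)
  then have "degree p = Suc (degree q)" unfolding pq by (subst degree_mult_eq) simp_all
  with \<open>q \<noteq> 0\<close> have q0: "q \<noteq> 0" "degree q < degree p" by simp_all
  define x where "x = e \<otimes> ev z q \<otimes> e"
  have x: "x \<in> carrier R" "e \<otimes> x = x" "x \<noteq> \<zero>"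
  proof -
    show "x \<noteq> \<zero>" using q0 min[of q] by (auto simp: P_def x_def)
  qed (use z in \<open>simp_all add: x_def m_assoc[symmetric]\<close>)
  define h where "h = z \<oplus> sc (-\<alpha>) \<otimes> e"
  have h: "h \<in> carrier R" "e \<otimes> h = h" "h \<otimes> e = h"
  proof -
    have "e \<otimes> (sc (-\<alpha>) \<otimes> e) = sc (-\<alpha>) \<otimes> e" by (simp add: m_assoc[symmetric] sc_comm) (simp add: m_assoc)
    then show "e \<otimes> h = h" using z by (simp add: h_def r_distr)
  qed (use z in \<open>simp_all add: h_def l_distr m_assoc\<close>)
  have "p = Polynomial.smult (-\<alpha>) q + pCons 0 q" by (simp add: pq)
  then have evp: "ev z p = sc (-\<alpha>) \<otimes> ev z q \<oplus> z \<otimes> ev z q"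
    using z by (simp only: ev_add ev_smult ev_pCons sc_0) simp
  have "h \<otimes> x = \<zero>"
  proof -
    have ze: "z \<otimes> (e \<otimes> v) = e \<otimes> (z \<otimes> v)" if "v \<in> carrier R" for v
      using that z by (simp add: m_assoc[symmetric])
    have ee: "e \<otimes> (e \<otimes> v) = e \<otimes> v" if "v \<in> carrier R" for v
      using that by (simp add: m_assoc[symmetric])
    have se: "e \<otimes> (sc c \<otimes> v) = sc c \<otimes> (e \<otimes> v)" if "v \<in> carrier R" for v c
      using that by (simp add: m_assoc[symmetric] sc_comm)
    have "h \<otimes> x = e \<otimes> ev z p \<otimes> e"
      unfolding h_def x_def evp using z(1)
      by (simp add: l_distr r_distr m_assoc ze se ee a_comm)
    then show ?thesis using p by (simp add: P_def)
  qed
  have "h = \<zero>"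
  proof (rule ccontr)
    assume "h \<noteq> \<zero>"
    then obtain y where "y \<in> carrier R" "y \<otimes> h = e"
      using primitive_hom_invertible[OF e e h] by blast
    then have "x = y \<otimes> (h \<otimes> x)" using x h by (simp add: m_assoc[symmetric])
    then show False using \<open>h \<otimes> x = \<zero>\<close> x \<open>y \<in> carrier R\<close> by simp
  qed
  have "z = h \<oplus> sc \<alpha> \<otimes> e"
    unfolding h_def using z(1)
    by (simp add: a_assoc l_distr[symmetric] sc_add[symmetric])
  with \<open>h = \<zero>\<close> show ?thesis by auto
qed

end

section \<open>The group algebra of a finite group\<close>

definition scalar :: "('g, 'm) monoid_scheme \<Rightarrow> complex \<Rightarrow> 'g \<Rightarrow> complex" where
  "scalar G c = (\<lambda>z. if z = \<one>\<^bsub>G\<^esub> then c else 0)"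

text \<open>The conjugate-linear involution for which the elements of \<open>G\<close> are unitary.\<close>

definition adjoint :: "('g, 'm) monoid_scheme \<Rightarrow> ('g \<Rightarrow> complex) \<Rightarrow> 'g \<Rightarrow> complex" where
  "adjoint G f = (\<lambda>g. if g \<in> carrier G then cnj (f (inv\<^bsub>G\<^esub> g)) else 0)"

lemma scalar_closed: "monoid G \<Longrightarrow> scalar G c \<in> carrier (monoid_algebra G)"
  by (auto simp: scalar_def monoid.one_closed intro: finite_subset[of _ "{\<one>\<^bsub>G\<^esub>}"])

lemma scalar_mult:
  assumes G: "monoid G" and f: "f \<in> carrier (monoid_algebra G)"
  shows "scalar G c \<otimes>\<^bsub>monoid_algebra G\<^esub> f = (\<lambda>z. c * f z)"
    and "f \<otimes>\<^bsub>monoid_algebra G\<^esub> scalar G c = (\<lambda>z. c * f z)"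
proof -
  interpret monoid G by fact
  have 1: "(\<Sum>u | f u \<noteq> 0. if u = z then c * f u else 0) = c * f z" for z
    using f by (subst sum.delta) auto
  have "(scalar G c \<otimes>\<^bsub>monoid_algebra G\<^esub> f) z = (\<Sum>u | f u \<noteq> 0. if u = z then c * f u else 0)" for z
    by (subst monoid_algebra_mult_superset[where A="{\<one>\<^bsub>G\<^esub>}" and B="{u. f u \<noteq> 0}"])
      (use f in \<open>auto simp: scalar_def subset_iff split: if_splits intro!: sum.cong\<close>)
  then show "scalar G c \<otimes>\<^bsub>monoid_algebra G\<^esub> f = (\<lambda>z. c * f z)" using 1 by auto
  have "(f \<otimes>\<^bsub>monoid_algebra G\<^esub> scalar G c) z = (\<Sum>u | f u \<noteq> 0. if u = z then c * f u else 0)" for z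
    by (subst monoid_algebra_mult_superset[where B="{\<one>\<^bsub>G\<^esub>}" and A="{u. f u \<noteq> 0}"])
      (use f in \<open>auto simp: scalar_def subset_iff split: if_splits intro!: sum.cong\<close>)
  then show "f \<otimes>\<^bsub>monoid_algebra G\<^esub> scalar G c = (\<lambda>z. c * f z)" using 1 by auto
qed

lemma complex_algebra_monoid_algebra:
  assumes G: "monoid G"
  shows "complex_algebra (monoid_algebra G) (scalar G)"
proof -
  interpret ring "monoid_algebra G" by (rule ring_monoid_algebra) fact
  show ?thesis
  proof
    show "scalar G c \<in> carrier (monoid_algebra G)" for c by (rule scalar_closed[OF G])
    show "scalar G (a * b) = scalar G a \<otimes>\<^bsub>monoid_algebra G\<^esub> scalar G b" for a b
      using scalar_mult(1)[OF G scalar_closed[OF G]] by (auto simp: scalar_def)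
    show "f \<otimes>\<^bsub>monoid_algebra G\<^esub> scalar G c = scalar G c \<otimes>\<^bsub>monoid_algebra G\<^esub> f"
      if "f \<in> carrier (monoid_algebra G)" for f c
      by (simp only: scalar_mult[OF G that])
  qed (auto simp: scalar_def)
qed

lemma sum_fun_eval: "(\<Sum>i\<in>A. h i) x = (\<Sum>i\<in>A. (h i x :: complex))"
  by (induction A rule: infinite_finite_induct) auto

interpretation fvs: vector_space "\<lambda>c (f :: 'g \<Rightarrow> complex) x. c * f x"
  by unfold_locales (auto simp: fun_eq_iff algebra_simps)

text \<open>More than \<open>|G|\<close> powers of an element are linearly dependent.\<close>

lemma finite_monoid_algebra_algebraic:
  assumes G: "monoid G" and fin: "finite (carrier G)" and z: "z \<in> carrier (monoid_algebra G)"
  shows "\<exists>p. p \<noteq> 0 \<and> poly_at (monoid_algebra G) (scalar G) z p = \<zero>\<^bsub>monoid_algebra G\<^esub>"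
proof (rule ccontr)
  interpret complex_algebra "monoid_algebra G" "scalar G"
    by (rule complex_algebra_monoid_algebra) fact
  assume "\<not> ?thesis"
  then have inj: "p = 0" if "ev z p = (\<lambda>x. 0)" for p using that by auto
  have smult: "ev z (Polynomial.smult c p) = (\<lambda>x. c * ev z p x)" for c p
    using ev_smult[OF z] scalar_mult(1)[OF G ev_closed[OF z]] by simp
  have add: "ev z (p + q) = (\<lambda>x. ev z p x + ev z q x)" for p q
    using ev_add[OF z] by simp
  have sum: "ev z (sum h A) = (\<lambda>x. \<Sum>a\<in>A. ev z (h a) x)" for h :: "nat \<Rightarrow> complex poly" and A
    by (induction A rule: infinite_finite_induct) (auto simp: add)
  have eq: "p = q" if "ev z p = ev z q" for p q
  proof -
    have "ev z (p + Polynomial.smult (-1) q) = (\<lambda>x. 0)"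
      by (simp only: add smult that) auto
    from inj[OF this] show ?thesis by simp
  qed
  define N where "N = card (carrier G)"
  define S where "S = (\<lambda>i. ev z (Polynomial.monom 1 i)) ` {..N}"
  have injS: "inj_on (\<lambda>i. ev z (Polynomial.monom 1 i)) {..N}"
    by (rule inj_onI) (auto dest!: eq simp: monom_eq_iff' )
  have "fvs.independent S"
  proof
    assume "fvs.dependent S"
    then obtain u where u: "\<exists>v\<in>S. u v \<noteq> 0" "(\<Sum>v\<in>S. (\<lambda>x. u v * v x)) = 0"
      using fvs.dependent_finite[of S] by (auto simp: S_def)
    have "(\<Sum>i\<le>N. (\<lambda>x. u (ev z (Polynomial.monom 1 i)) * ev z (Polynomial.monom 1 i) x)) = 0"
      using u(2) unfolding S_def by (subst (asm) sum.reindex[OF injS]) simp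
    then have "ev z (\<Sum>i\<le>N. Polynomial.smult (u (ev z (Polynomial.monom 1 i))) (Polynomial.monom 1 i)) = (\<lambda>x. 0)"
      unfolding sum smult by (auto simp: fun_eq_iff sum_fun_eval)
    then have "(\<Sum>i\<le>N. Polynomial.monom (u (ev z (Polynomial.monom 1 i))) i) = 0"
      by (auto dest!: inj simp: smult_monom)
    then have *: "coeff (\<Sum>i\<le>N. Polynomial.monom (u (ev z (Polynomial.monom 1 i))) i) j = 0" for j
      by simp
    then have "u (ev z (Polynomial.monom 1 j)) = 0" if "j \<le> N" for j
      using *[of j] that by (simp add: coeff_sum)
    then show False using u(1) by (auto simp: S_def)
  qed
  moreover have "S \<subseteq> fvs.span ((\<lambda>g x. if x = g then 1 else 0) ` carrier G)"
  proof
    fix f assume "f \<in> S"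
    then have f: "f \<in> carrier (monoid_algebra G)" using z ev_closed by (auto simp: S_def)
    have "f = (\<Sum>g\<in>carrier G. (\<lambda>x. f g * (if x = g then 1 else 0)))"
      using f fin by (auto simp: fun_eq_iff sum_fun_eval if_distrib cong: if_cong)
    also have "\<dots> \<in> fvs.span ((\<lambda>g x. if x = g then 1 else 0) ` carrier G)"
      by (intro fvs.span_sum fvs.span_scale fvs.span_base) auto
    finally show "f \<in> fvs.span ((\<lambda>g x. if x = g then 1 else 0) ` carrier G)" .
  qed
  ultimately have "card S \<le> card ((\<lambda>g x. if x = g then (1 :: complex) else 0) ` carrier G)"
    using fvs.independent_span_bound[of "(\<lambda>g x. if x = g then 1 else 0) ` carrier G" S] fin by blast
  also have "\<dots> \<le> N" using fin by (simp add: N_def card_image_le)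
  finally show False using card_image[OF injS] by (simp add: S_def)
qed

text \<open>Positivity holds because the coefficient of \<open>f\<^sup>* f\<close> at the unit is \<open>\<Sum> |f g|\<^sup>2\<close>.\<close>

lemma star_algebra_group_algebra:
  assumes G: "group G" and fin: "finite (carrier G)"
  shows "star_algebra (monoid_algebra G) (scalar G) (adjoint G)"
proof -
  interpret G: group G by fact
  have mon: "monoid G" ..
  interpret complex_algebra "monoid_algebra G" "scalar G"
    by (rule complex_algebra_monoid_algebra) fact
  have sub: "{x. f x \<noteq> 0} \<subseteq> carrier G" if "f \<in> carrier (monoid_algebra G)" for f
    using that by simp
  have adj [simp]: "adjoint G f \<in> carrier (monoid_algebra G)" for f
    by (auto simp: adjoint_def intro: finite_subset[OF _ fin])
  have mult: "(f \<otimes>\<^bsub>monoid_algebra G\<^esub> g) z =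
      (\<Sum>a\<in>carrier G. \<Sum>b\<in>carrier G. if a \<otimes>\<^bsub>G\<^esub> b = z then f a * g b else 0)"
    if "f \<in> carrier (monoid_algebra G)" "g \<in> carrier (monoid_algebra G)" for f g z
    by (rule monoid_algebra_mult_superset[OF fin sub[OF that(1)] fin sub[OF that(2)]])
  show ?thesis
  proof
    fix f v assume f: "f \<in> carrier (monoid_algebra G)" and v: "v \<in> carrier (monoid_algebra G)"
    have fv: "f \<otimes>\<^bsub>monoid_algebra G\<^esub> v \<in> carrier (monoid_algebra G)"
      using f v by (rule m_closed)
    show "adjoint G (f \<otimes>\<^bsub>monoid_algebra G\<^esub> v) = adjoint G v \<otimes>\<^bsub>monoid_algebra G\<^esub> adjoint G f"
    proof
      fix z
      show "adjoint G (f \<otimes>\<^bsub>monoid_algebra G\<^esub> v) z = (adjoint G v \<otimes>\<^bsub>monoid_algebra G\<^esub> adjoint G f) z"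
      proof (cases "z \<in> carrier G")
        case True
        have iff: "inv\<^bsub>G\<^esub> b \<otimes>\<^bsub>G\<^esub> inv\<^bsub>G\<^esub> a = inv\<^bsub>G\<^esub> z \<longleftrightarrow> a \<otimes>\<^bsub>G\<^esub> b = z"
          if "a \<in> carrier G" "b \<in> carrier G" for a b
          using that True by (metis G.inv_mult_group G.inv_inv G.m_closed)
        have "adjoint G (f \<otimes>\<^bsub>monoid_algebra G\<^esub> v) z =
          (\<Sum>b\<in>carrier G. \<Sum>a\<in>carrier G. if b \<otimes>\<^bsub>G\<^esub> a = inv\<^bsub>G\<^esub> z then cnj (f b) * cnj (v a) else 0)"
          using True by (auto simp: adjoint_def mult[OF f v] intro!: sum.cong)
        also have "\<dots> = (\<Sum>b\<in>carrier G. \<Sum>a\<in>carrier G.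
            if inv\<^bsub>G\<^esub> b \<otimes>\<^bsub>G\<^esub> inv\<^bsub>G\<^esub> a = inv\<^bsub>G\<^esub> z then cnj (f (inv\<^bsub>G\<^esub> b)) * cnj (v (inv\<^bsub>G\<^esub> a)) else 0)"
          by (intro sum.reindex_bij_witness[of _ "\<lambda>b. inv\<^bsub>G\<^esub> b" "\<lambda>b. inv\<^bsub>G\<^esub> b"]) auto
        also have "\<dots> = (\<Sum>b\<in>carrier G. \<Sum>a\<in>carrier G.
            if a \<otimes>\<^bsub>G\<^esub> b = z then adjoint G v a * adjoint G f b else 0)"
          by (intro sum.cong refl) (simp add: iff adjoint_def)
        also have "\<dots> = (adjoint G v \<otimes>\<^bsub>monoid_algebra G\<^esub> adjoint G f) z"
          unfolding mult[OF adj adj] by (rule sum.swap)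
        finally show ?thesis .
      next
        case False
        have "adjoint G v \<otimes>\<^bsub>monoid_algebra G\<^esub> adjoint G f \<in> carrier (monoid_algebra G)"
          by (rule m_closed[OF adj adj])
        then show ?thesis using False by (auto simp: adjoint_def)
      qed
    qed
  next
    fix f assume f: "f \<in> carrier (monoid_algebra G)"
    then show "adjoint G (adjoint G f) = f" by (auto simp: adjoint_def fun_eq_iff)
    assume 0: "adjoint G f \<otimes>\<^bsub>monoid_algebra G\<^esub> f = \<zero>\<^bsub>monoid_algebra G\<^esub>"
    have iff: "a \<otimes>\<^bsub>G\<^esub> b = \<one>\<^bsub>G\<^esub> \<longleftrightarrow> a = inv\<^bsub>G\<^esub> b" if "a \<in> carrier G" "b \<in> carrier G" for a b
      using that by (metis G.inv_equality G.l_inv)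
    have "0 = (\<Sum>a\<in>carrier G. \<Sum>b\<in>carrier G. if a \<otimes>\<^bsub>G\<^esub> b = \<one>\<^bsub>G\<^esub> then adjoint G f a * f b else 0)"
      using fun_cong[OF 0, of "\<one>\<^bsub>G\<^esub>"] unfolding mult[OF adj f] by simp
    also have "\<dots> = (\<Sum>b\<in>carrier G. \<Sum>a\<in>carrier G. if a = inv\<^bsub>G\<^esub> b then adjoint G f a * f b else 0)"
      by (subst sum.swap) (intro sum.cong refl, simp add: iff)
    also have "\<dots> = (\<Sum>b\<in>carrier G. cnj (f b) * f b)"
      by (intro sum.cong refl) (simp add: fin sum.delta' adjoint_def)
    also have "\<dots> = of_real (\<Sum>b\<in>carrier G. (cmod (f b))\<^sup>2)"
      by (simp only: of_real_sum complex_norm_square) (simp add: mult.commute)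
    finally have "(\<Sum>b\<in>carrier G. (cmod (f b))\<^sup>2) = 0" by (metis of_real_eq_0_iff)
    then have "f b = 0" if "b \<in> carrier G" for b
      using that fin by (simp add: sum_nonneg_eq_0_iff)
    then show "f = \<zero>\<^bsub>monoid_algebra G\<^esub>" using f by (auto simp: fun_eq_iff)
  qed (use adj finite_monoid_algebra_algebraic[OF mon fin] in auto)
qed

section \<open>Substitutions in polynomials\<close>

lemma poly_mapping_sum_single: "(\<Sum>m\<in>Poly_Mapping.keys p. Poly_Mapping.single m (Poly_Mapping.lookup p m)) = p"
proof (rule poly_mapping_eqI)
  fix k
  show "Poly_Mapping.lookup (\<Sum>m\<in>Poly_Mapping.keys p. Poly_Mapping.single m (Poly_Mapping.lookup p m)) k = Poly_Mapping.lookup p k"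
    by (auto simp: lookup_sum lookup_single when_def sum.delta' in_keys_iff)
qed

lemma poly_mapping_additive_induct [case_names single add]:
  assumes "\<And>m c. P (Poly_Mapping.single m c)" and add: "\<And>p q. P p \<Longrightarrow> P q \<Longrightarrow> P (p + q)"
  shows "P (p :: 'a \<Rightarrow>\<^sub>0 'b :: comm_monoid_add)"
proof -
  have 0: "P 0" using assms(1)[of undefined 0] by simp
  have "P (\<Sum>m\<in>A. Poly_Mapping.single m (Poly_Mapping.lookup p m))" for A
    by (induction A rule: infinite_finite_induct) (auto simp: 0 assms)
  from this[of "Poly_Mapping.keys p"] show ?thesis by (simp add: poly_mapping_sum_single)
qed

text \<open>Every polynomial is a sum of products of constants and variables; this is the induction
  that determines ring homomorphisms and derivations by their values on the variables.\<close>

lemma mpoly_induct [case_names Cst X add mult]: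
  assumes C: "\<And>c. P (Cst c)" and X: "\<And>i. P (X i)"
    and add: "\<And>p q. P p \<Longrightarrow> P q \<Longrightarrow> P (p + q)" and mult: "\<And>p q. P p \<Longrightarrow> P q \<Longrightarrow> P (p * q)"
  shows "P p"
proof (induction p rule: poly_mapping_additive_induct)
  case (single m c)
  have "P (Poly_Mapping.single m 1)" for m
  proof (induction m rule: poly_mapping_additive_induct)
    case (single i k)
    show ?case
    proof (induction k)
      case 0
      then show ?case using C[of 1] by simp
    next
      case (Suc k)
      have "Poly_Mapping.single (Poly_Mapping.single i (Suc k)) 1 = X i * Poly_Mapping.single (Poly_Mapping.single i k) (1 :: complex)"
        by (simp add: X_def mult_single single_add[symmetric])
      then show ?case using mult[OF X Suc] by simp
    qed
  next
    case (add p q)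
    then show ?case using mult[OF add] by (simp add: mult_single)
  qed
  then show ?case using mult[OF C] by (metis Cst_def mult_single add_0 mult.right_neutral)
qed (rule add)

definition is_hom :: "('a :: ring_1 \<Rightarrow> 'b :: ring_1) \<Rightarrow> bool" where
  "is_hom h \<longleftrightarrow> (\<forall>p q. h (p + q) = h p + h q) \<and> (\<forall>p q. h (p * q) = h p * h q) \<and> h 1 = 1"

lemma is_homD:
  assumes "is_hom h"
  shows "h (p + q) = h p + h q" "h (p * q) = h p * h q" "h 1 = 1" "h 0 = 0" "h (- p) = - h p"
    "h (p - q) = h p - h q" "h (p ^ k) = h p ^ k" "h (of_nat k) = of_nat k"
    "h (sum g A) = (\<Sum>a\<in>A. h (g a))"
proof -
  show a: "h (p + q) = h p + h q" and m: "h (p * q) = h p * h q" and o: "h 1 = 1" for p q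
    using assms by (auto simp: is_hom_def)
  show z: "h 0 = 0" using a[of 0 0] by simp
  show n: "h (- p) = - h p" for p using a[of p "- p"] z by (simp add: add_eq_0_iff)
  show "h (p - q) = h p - h q" using a[of p "- q"] n[of q] by simp
  show "h (p ^ k) = h p ^ k" by (induction k) (auto simp: o m)
  show "h (of_nat k) = of_nat k" by (induction k) (auto simp: o a z)
  show "h (sum g A) = (\<Sum>a\<in>A. h (g a))"
    by (induction A rule: infinite_finite_induct) (auto simp: z a)
qed

lemma is_hom_prod: "is_hom h \<Longrightarrow> h (prod g A) = (\<Prod>a\<in>A. h (g a :: 'a :: comm_ring_1) :: 'b :: comm_ring_1)"
  by (induction A rule: infinite_finite_induct) (auto simp: is_homD)

lemma mpoly_hom_eq:
  assumes "is_hom h" "is_hom k" "\<And>c. h (Cst c) = k (Cst c)" "\<And>i. h (X i) = k (X i)"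
  shows "h p = k p"
  by (induction p rule: mpoly_induct) (auto simp: assms is_homD[OF assms(1)] is_homD[OF assms(2)])

text \<open>\<open>W_act_poly w\<close> is the substitution of these terms for the variables.\<close>

definition W_var :: "welt \<Rightarrow> nat \<Rightarrow> mpoly" where
  "W_var w i = Cst (of_int (fst w (snd w i))) * X (snd w i)"

lemma W_act_poly_superset:
  assumes "finite A" "Poly_Mapping.keys p \<subseteq> A"
  shows "W_act_poly w p = (\<Sum>m\<in>A. Cst (Poly_Mapping.lookup p m) *
    (\<Prod>i \<in> Poly_Mapping.keys m. W_var w i ^ Poly_Mapping.lookup m i))"
  unfolding W_act_poly_def W_var_def case_prod_beta
  by (rule sum.mono_neutral_left) (use assms in \<open>auto simp: in_keys_iff\<close>)

lemma W_act_poly_single: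
  "W_act_poly w (Poly_Mapping.single m c) = Cst c * (\<Prod>i \<in> Poly_Mapping.keys m. W_var w i ^ Poly_Mapping.lookup m i)"
  by (subst W_act_poly_superset[of "{m}"]) (auto simp: lookup_single)

lemma monomial_subst_mult:
  "(\<Prod>i \<in> Poly_Mapping.keys (m + m'). v i ^ Poly_Mapping.lookup (m + m') i) =
   (\<Prod>i \<in> Poly_Mapping.keys m. v i ^ Poly_Mapping.lookup m i) *
   (\<Prod>i \<in> Poly_Mapping.keys m'. v i ^ Poly_Mapping.lookup m' i :: 'a :: comm_monoid_mult)"
proof -
  let ?A = "Poly_Mapping.keys m \<union> Poly_Mapping.keys m'"
  have ext: "(\<Prod>i \<in> Poly_Mapping.keys k. v i ^ Poly_Mapping.lookup k i) = (\<Prod>i\<in>?A. v i ^ Poly_Mapping.lookup k i)"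
    if "Poly_Mapping.keys k \<subseteq> ?A" for k
    by (rule prod.mono_neutral_left) (use that in \<open>auto simp: in_keys_iff\<close>)
  show ?thesis
    by (subst (1 2 3) ext) (use keys_add[of m m'] in \<open>auto simp: lookup_add power_add prod.distrib\<close>)
qed

lemma is_hom_W_act_poly: "is_hom (W_act_poly w)"
proof -
  have add: "W_act_poly w (p + q) = W_act_poly w p + W_act_poly w q" for p q
  proof -
    have "Poly_Mapping.keys (p + q) \<subseteq> Poly_Mapping.keys p \<union> Poly_Mapping.keys q"
      by (rule keys_add)
    then show ?thesis
      by (subst (1 2 3) W_act_poly_superset[of "Poly_Mapping.keys p \<union> Poly_Mapping.keys q"])
        (auto simp: lookup_add Cst_add algebra_simps sum.distrib)
  qed
  have "W_act_poly w (p * q) = W_act_poly w p * W_act_poly w q" for p q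
  proof (induction p rule: poly_mapping_additive_induct)
    case (single m c)
    show ?case
    proof (induction q rule: poly_mapping_additive_induct)
      case (single m' c')
      show ?case
        by (simp only: mult_single W_act_poly_single monomial_subst_mult Cst_mult) (simp add: algebra_simps)
    qed (simp add: add algebra_simps)
  qed (simp add: add algebra_simps)
  moreover have "W_act_poly w 1 = 1"
    using W_act_poly_single[of w 0 1] by simp
  ultimately show ?thesis using add by (simp add: is_hom_def)
qed

lemmas W_act_poly_hom = is_homD[OF is_hom_W_act_poly]

lemma W_act_poly_Cst [simp]: "W_act_poly w (Cst c) = Cst c"
  by (simp add: Cst_def[of c] W_act_poly_single)

lemma W_act_poly_X [simp]: "W_act_poly w (X i) = W_var w i"
  by (simp add: X_def W_act_poly_single)

lemma W_act_poly_one: "W_act_poly (\<lambda>i. 1, id) p = p"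
  using mpoly_hom_eq[OF is_hom_W_act_poly, of "\<lambda>p. p"] by (simp add: is_hom_def W_var_def)

section \<open>The signed permutations and their action on rational functions\<close>

lemma W_carrier: "w \<in> carrier (W n) \<longleftrightarrow> (\<forall>i\<in>{1..n}. fst w i = 1 \<or> fst w i = -1) \<and>
    (\<forall>i. i \<notin> {1..n} \<longrightarrow> fst w i = 1) \<and> snd w permutes {1..n}"
  by (auto simp: W_def)

lemma W_mult: "v \<otimes>\<^bsub>W n\<^esub> w = (\<lambda>i. fst v i * fst w (Hilbert_Choice.inv (snd v) i), snd v \<circ> snd w)"
  by (auto simp: W_def split: prod.splits)

lemma W_one: "\<one>\<^bsub>W n\<^esub> = (\<lambda>i. 1, id)"
  by (simp add: W_def)

lemma permutes_in_image': "\<sigma> permutes S \<Longrightarrow> Hilbert_Choice.inv \<sigma> x \<in> S \<longleftrightarrow> x \<in> S"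
  by (meson permutes_in_image permutes_inv)

lemma W_sign: "w \<in> carrier (W n) \<Longrightarrow> fst w i = 1 \<or> fst w i = -1"
  by (cases "i \<in> {1..n}") (auto simp: W_carrier)

lemma group_W: "group (W n)"
proof (rule groupI)
  fix u v assume u: "u \<in> carrier (W n)" and v: "v \<in> carrier (W n)"
  have p: "snd u permutes {1..n}" using u by (simp add: W_carrier)
  have "fst u i * fst v k = 1 \<or> fst u i * fst v k = -1" for i k
    using W_sign[OF u, of i] W_sign[OF v, of k] by auto
  moreover have "fst u i * fst v (Hilbert_Choice.inv (snd u) i) = 1" if "i \<notin> {1..n}" for i
    using that u v permutes_in_image'[OF p, of i] by (simp only: W_carrier) simp
  moreover have "snd u \<circ> snd v permutes {1..n}"
    using u v by (simp only: W_carrier) (auto intro: permutes_compose)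
  ultimately show "u \<otimes>\<^bsub>W n\<^esub> v \<in> carrier (W n)"
    by (simp only: W_carrier W_mult) simp
next
  fix u v w assume *: "u \<in> carrier (W n)" "v \<in> carrier (W n)" "w \<in> carrier (W n)"
  then have "bij (snd u)" "bij (snd v)" by (auto simp: W_carrier permutes_bij)
  then have "Hilbert_Choice.inv (snd u \<circ> snd v) = Hilbert_Choice.inv (snd v) \<circ> Hilbert_Choice.inv (snd u)"
    by (rule o_inv_distrib)
  then show "u \<otimes>\<^bsub>W n\<^esub> v \<otimes>\<^bsub>W n\<^esub> w = u \<otimes>\<^bsub>W n\<^esub> (v \<otimes>\<^bsub>W n\<^esub> w)"
    by (simp add: W_mult mult.assoc o_assoc)
next
  fix u assume u: "u \<in> carrier (W n)"
  define v where "v = (\<lambda>i. fst u (snd u i), Hilbert_Choice.inv (snd u))"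
  have p: "snd u permutes {1..n}" using u by (simp add: W_carrier)
  have "v \<in> carrier (W n)"
    using u permutes_in_image[OF p] unfolding W_carrier v_def by (auto intro: permutes_inv)
  moreover have "v \<otimes>\<^bsub>W n\<^esub> u = \<one>\<^bsub>W n\<^esub>"
  proof -
    have "Hilbert_Choice.inv (Hilbert_Choice.inv (snd u)) = snd u"
      using p by (simp add: permutes_inv_inv)
    moreover have "fst u (snd u i) * fst u (snd u i) = 1" for i
      using W_sign[OF u, of "snd u i"] by auto
    ultimately show ?thesis using p by (auto simp: W_mult W_one v_def permutes_inv_o)
  qed
  ultimately show "\<exists>v\<in>carrier (W n). v \<otimes>\<^bsub>W n\<^esub> u = \<one>\<^bsub>W n\<^esub>" by blast
qed (auto simp: W_carrier W_one W_mult permutes_id)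

lemma finite_W: "finite (carrier (W n))"
proof (rule finite_subset)
  let ?E = "(\<lambda>K i. if i \<in> K then -1 else (1 :: int)) ` Pow {1..n}"
  show "carrier (W n) \<subseteq> ?E \<times> {\<sigma>. \<sigma> permutes {1..n}}"
  proof
    fix w assume w: "w \<in> carrier (W n)"
    have "fst w = (\<lambda>i. if i \<in> {i \<in> {1..n}. fst w i = -1} then -1 else 1)"
      using w by (auto simp: W_carrier fun_eq_iff)
    then have "fst w \<in> ?E" by blast
    moreover have "snd w permutes {1..n}" using w by (simp add: W_carrier)
    ultimately show "w \<in> ?E \<times> {\<sigma>. \<sigma> permutes {1..n}}" by (auto simp: mem_Times_iff)
  qed
  show "finite (?E \<times> {\<sigma>. \<sigma> permutes {1..n}})" by (simp add: finite_permutations)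
qed

lemma W_act_poly_mult:
  assumes "v \<in> carrier (W n)"
  shows "W_act_poly (v \<otimes>\<^bsub>W n\<^esub> w) p = W_act_poly v (W_act_poly w p)"
proof (rule mpoly_hom_eq[of _ "\<lambda>p. W_act_poly v (W_act_poly w p)"])
  show "is_hom (\<lambda>p. W_act_poly v (W_act_poly w p))"
    by (simp add: is_hom_def W_act_poly_hom)
  have "snd v permutes {1..n}" using assms by (simp add: W_carrier)
  then show "W_act_poly (v \<otimes>\<^bsub>W n\<^esub> w) (X i) = W_act_poly v (W_act_poly w (X i))" for i
    by (simp add: W_var_def W_mult W_act_poly_hom permutes_inverses Cst_mult algebra_simps)
qed (simp_all add: is_hom_W_act_poly)

lemma inj_W_act_poly:
  assumes w: "w \<in> carrier (W n)" and "W_act_poly w p = 0"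
  shows "p = 0"
proof -
  interpret group "W n" by (rule group_W)
  have "p = W_act_poly (inv\<^bsub>W n\<^esub> w \<otimes>\<^bsub>W n\<^esub> w) p"
    unfolding l_inv[OF w] by (simp add: W_one W_act_poly_one)
  also have "\<dots> = W_act_poly (inv\<^bsub>W n\<^esub> w) (W_act_poly w p)"
    by (rule W_act_poly_mult) (use w in simp)
  also have "\<dots> = 0" using assms(2) by (simp add: W_act_poly_hom)
  finally show ?thesis .
qed

lemma num_denE:
  obtains p q where "num_den f = (p, q)" "q \<noteq> 0" "f = Fract p q"
proof -
  obtain a b where "f = Fract a b" "b \<noteq> 0" by (cases f) auto
  then have "(\<lambda>x. snd x \<noteq> 0 \<and> f = Fract (fst x) (snd x)) (a, b)" by simp
  then have "(\<lambda>x. snd x \<noteq> 0 \<and> f = Fract (fst x) (snd x)) (SOME x. snd x \<noteq> 0 \<and> f = Fract (fst x) (snd x))"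
    by (rule someI)
  then have "snd (num_den f) \<noteq> 0 \<and> f = Fract (fst (num_den f)) (snd (num_den f))"
    unfolding num_den_def case_prod_unfold .
  then show ?thesis using that[of "fst (num_den f)" "snd (num_den f)"] by simp
qed

lemma W_act_rat_Fract:
  assumes w: "w \<in> carrier (W n)" and q: "q \<noteq> 0"
  shows "W_act_rat w (Fract p q) = Fract (W_act_poly w p) (W_act_poly w q)"
proof -
  obtain a b where ab: "num_den (Fract p q) = (a, b)" "b \<noteq> 0" "Fract p q = Fract a b"
    by (rule num_denE)
  have nz: "W_act_poly w b \<noteq> 0" "W_act_poly w q \<noteq> 0" using inj_W_act_poly[OF w] ab(2) q by auto
  have "a * q = p * b" using ab q by (simp add: eq_fract)
  then have "W_act_poly w a * W_act_poly w q = W_act_poly w p * W_act_poly w b"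
    by (metis W_act_poly_hom(2))
  with nz show ?thesis by (simp add: W_act_rat_def ab(1) eq_fract)
qed

lemma W_act_rat_to_fract: "w \<in> carrier (W n) \<Longrightarrow> W_act_rat w (to_fract p) = to_fract (W_act_poly w p)"
  by (simp add: to_fract_def W_act_rat_Fract W_act_poly_hom)

lemma W_act_rat_1: "W_act_rat \<one>\<^bsub>W n\<^esub> f = f"
  by (rule num_denE[of f]) (simp add: W_act_rat_def W_one W_act_poly_one)

lemma W_act_rat_mult:
  assumes "v \<in> carrier (W n)" "w \<in> carrier (W n)"
  shows "W_act_rat (v \<otimes>\<^bsub>W n\<^esub> w) f = W_act_rat v (W_act_rat w f)"
proof -
  interpret group "W n" by (rule group_W)
  obtain p q where f: "f = Fract p q" "q \<noteq> 0" by (cases f) auto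
  have nz: "W_act_poly w q \<noteq> 0" using inj_W_act_poly[OF assms(2)] f(2) by auto
  have vw: "v \<otimes>\<^bsub>W n\<^esub> w \<in> carrier (W n)" using assms by simp
  show ?thesis using f nz
    by (simp add: W_act_rat_Fract[OF assms(1)] W_act_rat_Fract[OF assms(2)] W_act_rat_Fract[OF vw]
        W_act_poly_mult[OF assms(1)])
qed

lemma is_hom_W_act_rat:
  assumes w: "w \<in> carrier (W n)"
  shows "is_hom (W_act_rat w)"
proof -
  have nz: "W_act_poly w q \<noteq> 0" if "q \<noteq> 0" for q using inj_W_act_poly[OF w] that by auto
  have "W_act_rat w (f + g) = W_act_rat w f + W_act_rat w g" for f g
    by (cases f, cases g) (simp add: W_act_rat_Fract[OF w] nz W_act_poly_hom)
  moreover have "W_act_rat w (f * g) = W_act_rat w f * W_act_rat w g" for f g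
    by (cases f, cases g) (simp add: W_act_rat_Fract[OF w] nz W_act_poly_hom)
  moreover have "W_act_rat w 1 = 1"
    using W_act_rat_to_fract[OF w, of 1] by (simp add: W_act_poly_hom)
  ultimately show ?thesis by (simp add: is_hom_def)
qed

lemmas W_act_rat_hom = is_homD[OF is_hom_W_act_rat]

lemma W_act_rat_divide:
  assumes w: "w \<in> carrier (W n)"
  shows "W_act_rat w (f / g) = W_act_rat w f / W_act_rat w g"
proof (cases "g = 0")
  case False
  have "W_act_rat w (f / g) * W_act_rat w g = W_act_rat w f"
    using False by (simp add: W_act_rat_hom(2)[OF w, symmetric])
  moreover have "W_act_rat w g \<noteq> 0"
  proof
    assume "W_act_rat w g = 0"
    then have "W_act_rat w (1 / g * g) = 0" by (simp only: W_act_rat_hom(2)[OF w]) simp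
    then show False using False by (simp add: W_act_rat_hom[OF w])
  qed
  ultimately show ?thesis by (simp add: field_simps)
qed (simp add: W_act_rat_hom[OF w])

lemma clinear_W_act_rat:
  assumes w: "w \<in> carrier (W n)"
  shows "clinear (W_act_rat w)"
  by (simp add: clinear_def cscale_def W_act_rat_hom[OF w] W_act_rat_to_fract[OF w])

section \<open>Derivations\<close>

definition derivation :: "(ratf \<Rightarrow> ratf) \<Rightarrow> bool" where
  "derivation D \<longleftrightarrow> (\<forall>f g. D (f + g) = D f + D g) \<and> (\<forall>f g. D (f * g) = D f * g + f * D g) \<and>
     (\<forall>c. D (to_fract (Cst c)) = 0)"

lemma derivationD:
  assumes "derivation D"
  shows "D (f + g) = D f + D g" "D (f * g) = D f * g + f * D g" "D (to_fract (Cst c)) = 0"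
    "D 0 = 0" "D 1 = 0" "D (- f) = - D f" "D (f - g) = D f - D g" "D (f ^ k) = of_nat k * f ^ (k - 1) * D f"
    "D (sum h A) = (\<Sum>a\<in>A. D (h a))"
proof -
  show a: "D (f + g) = D f + D g" and m: "D (f * g) = D f * g + f * D g"
    and c: "D (to_fract (Cst c)) = 0" for f g c
    using assms by (auto simp: derivation_def)
  show z: "D 0 = 0" using c[of 0] by simp
  show o: "D 1 = 0" using c[of 1] by simp
  show n: "D (- f) = - D f" for f using a[of f "- f"] z by (simp add: add_eq_0_iff)
  show "D (f - g) = D f - D g" using a[of f "- g"] n[of g] by simp
  show "D (f ^ k) = of_nat k * f ^ (k - 1) * D f"
  proof (induction k)
    case (Suc k)
    then show ?case by (cases k) (simp_all add: m o algebra_simps)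
  qed (simp add: o)
  show "D (sum h A) = (\<Sum>a\<in>A. D (h a))"
    by (induction A rule: infinite_finite_induct) (auto simp: z a)
qed

lemma clinear_derivation: "derivation D \<Longrightarrow> clinear D"
  by (simp add: clinear_def cscale_def derivationD)

lemma derivation_diff: "derivation D \<Longrightarrow> derivation E \<Longrightarrow> derivation (\<lambda>f. D f - E f)"
  by (simp add: derivation_def algebra_simps)

lemma derivation_zero_if_zero_on_vars:
  assumes D: "derivation D" and X: "\<And>i. D (to_fract (X i)) = 0"
  shows "D f = 0"
proof -
  have poly: "D (to_fract p) = 0" for p
    by (induction p rule: mpoly_induct) (simp_all add: X derivationD[OF D])
  obtain p q where f: "f = Fract p q" "q \<noteq> 0" by (cases f) auto
  then have "f * to_fract q = to_fract p" by (simp add: Fract_conv_to_fract)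
  then have "D (f * to_fract q) = 0" using poly by simp
  then show ?thesis using f(2) by (simp add: derivationD(2)[OF D] poly)
qed

lemma pderiv_poly_superset:
  assumes "finite A" "Poly_Mapping.keys p \<subseteq> A"
  shows "pderiv_poly i p = (\<Sum>m\<in>A. Poly_Mapping.single (m - Poly_Mapping.single i 1)
       (of_nat (Poly_Mapping.lookup m i) * Poly_Mapping.lookup p m))"
  unfolding pderiv_poly_def
  by (rule sum.mono_neutral_left) (use assms in \<open>auto simp: in_keys_iff\<close>)

lemma pderiv_poly_single:
  "pderiv_poly i (Poly_Mapping.single m c) =
     Poly_Mapping.single (m - Poly_Mapping.single i 1) (of_nat (Poly_Mapping.lookup m i) * c)"
  by (subst pderiv_poly_superset[of "{m}"]) (auto simp: lookup_single)

lemma pderiv_poly_add: "pderiv_poly i (p + q) = pderiv_poly i p + pderiv_poly i q"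
proof -
  have "Poly_Mapping.keys (p + q) \<subseteq> Poly_Mapping.keys p \<union> Poly_Mapping.keys q"
    by (rule keys_add)
  then show ?thesis
    by (subst (1 2 3) pderiv_poly_superset[of "Poly_Mapping.keys p \<union> Poly_Mapping.keys q"])
      (auto simp: lookup_add ring_distribs single_add sum.distrib)
qed

lemma pderiv_poly_single_mult:
  "pderiv_poly i (Poly_Mapping.single m c * Poly_Mapping.single m' c') =
     pderiv_poly i (Poly_Mapping.single m c) * Poly_Mapping.single m' c' +
     Poly_Mapping.single m c * pderiv_poly i (Poly_Mapping.single m' c')"
proof -
  let ?e = "Poly_Mapping.single i (1 :: nat)"
  \<comment> \<open>The truncated subtraction of exponents matters only for monomials without \<open>x\<^sub>i\<close>, whose coefficient in
    the derivative is 0.\<close>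
  have shift: "Poly_Mapping.single (k - ?e + k') (of_nat (Poly_Mapping.lookup k i) * d) =
      Poly_Mapping.single (k + k' - ?e) (of_nat (Poly_Mapping.lookup k i) * d)" for k k' :: "nat \<Rightarrow>\<^sub>0 nat" and d :: complex
  proof (cases "Poly_Mapping.lookup k i")
    case (Suc j)
    then have "k - ?e + k' = k + k' - ?e"
      by (intro poly_mapping_eqI) (auto simp: lookup_add lookup_minus lookup_single when_def)
    then show ?thesis by simp
  qed simp
  show ?thesis
    using shift[of m m' "c * c'"] shift[of m' m "c * c'"]
    by (simp add: mult_single pderiv_poly_single lookup_add ring_distribs single_add mult_ac add.commute)
qed

lemma pderiv_poly_mult: "pderiv_poly i (p * q) = pderiv_poly i p * q + p * pderiv_poly i q"
proof (induction p rule: poly_mapping_additive_induct)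
  case (single m c)
  show ?case
    by (induction q rule: poly_mapping_additive_induct)
      (simp_all add: pderiv_poly_add pderiv_poly_single_mult algebra_simps)
qed (simp add: pderiv_poly_add algebra_simps)

lemma pderiv_poly_Cst [simp]: "pderiv_poly i (Cst c) = 0"
  by (simp add: Cst_def pderiv_poly_single)

lemma pderiv_poly_X [simp]: "pderiv_poly i (X j) = (if i = j then 1 else 0)"
  by (simp add: X_def pderiv_poly_single lookup_single)

lemma pderiv_rat_Fract:
  assumes q: "q \<noteq> 0"
  shows "pderiv_rat i (Fract p q) = Fract (pderiv_poly i p * q - p * pderiv_poly i q) (q * q)"
proof -
  obtain a b where ab: "num_den (Fract p q) = (a, b)" "b \<noteq> 0" "Fract p q = Fract a b"
    by (rule num_denE)
  have eq: "p * b = a * q" using ab q by (simp add: eq_fract)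
  from arg_cong[OF this, of "pderiv_poly i"]
  have "pderiv_poly i p * b + p * pderiv_poly i b = pderiv_poly i a * q + a * pderiv_poly i q"
    by (simp add: pderiv_poly_mult)
  then have a': "pderiv_poly i a * q = pderiv_poly i p * b + p * pderiv_poly i b - a * pderiv_poly i q"
    by simp
  have "(pderiv_poly i a * b - a * pderiv_poly i b) * (q * q) =
      (pderiv_poly i a * q) * (b * q) - (a * q) * (pderiv_poly i b * q)"
    by (simp add: algebra_simps)
  also have "\<dots> = pderiv_poly i p * (b * b * q) - (a * q) * (pderiv_poly i q * b)"
    unfolding a' eq[symmetric] by (simp add: algebra_simps) (use eq in \<open>simp add: mult.commute\<close>)
  also have "\<dots> = (pderiv_poly i p * q - p * pderiv_poly i q) * (b * b)"
    unfolding eq[symmetric] by (simp add: algebra_simps)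
  finally have "(pderiv_poly i a * b - a * pderiv_poly i b) * (q * q) = (pderiv_poly i p * q - p * pderiv_poly i q) * (b * b)" .
  with ab(2) q show ?thesis by (simp add: pderiv_rat_def ab(1) eq_fract)
qed

lemma pderiv_rat_to_fract: "pderiv_rat i (to_fract p) = to_fract (pderiv_poly i p)"
  using pderiv_rat_Fract[of 1 i p] pderiv_poly_Cst[of i 1] by (simp add: to_fract_def)

lemma derivation_pderiv_rat: "derivation (pderiv_rat i)"
  unfolding derivation_def
proof (intro conjI allI)
  fix f g :: ratf
  obtain p q where f: "f = Fract p q" "q \<noteq> 0" by (cases f) auto
  obtain r s where g: "g = Fract r s" "s \<noteq> 0" by (cases g) auto
  show "pderiv_rat i (f + g) = pderiv_rat i f + pderiv_rat i g"
    using f g by (simp add: pderiv_rat_Fract pderiv_poly_add pderiv_poly_mult eq_fract algebra_simps)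
  show "pderiv_rat i (f * g) = pderiv_rat i f * g + f * pderiv_rat i g"
    using f g by (simp add: pderiv_rat_Fract pderiv_poly_mult eq_fract algebra_simps)
qed (simp add: pderiv_rat_to_fract)

section \<open>The matrix of partial derivatives of the power sums\<close>

lemma X_eq_iff [simp]: "X i = X j \<longleftrightarrow> i = j"
  unfolding X_def by (metis lookup_single_eq lookup_single_not_eq one_neq_zero)

lemma X_neq_0 [simp]: "X i \<noteq> 0"
  unfolding X_def by (metis lookup_single_eq lookup_zero one_neq_zero)

lemma X_neq_uminus_X: "X i \<noteq> - X j"
proof
  assume "X i = - X j"
  then have "Poly_Mapping.lookup (X i) (Poly_Mapping.single i 1) =
      - Poly_Mapping.lookup (X j) (Poly_Mapping.single i 1)"
    by simp
  then have "1 = - (if i = j then 1 else (0 :: complex))"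
    by (auto simp: X_def lookup_single when_def split: if_splits)
  then show False by (auto split: if_splits simp: complex_eq_iff)
qed

lemma X_power2_eq_iff: "(X i)\<^sup>2 = (X j)\<^sup>2 \<longleftrightarrow> i = j"
  by (simp add: power2_eq_iff X_neq_uminus_X)

lemma of_nat_mpoly_eq_0_iff [simp]: "(of_nat k :: mpoly) = 0 \<longleftrightarrow> k = 0"
  by simp

lemma Amat_carrier: "Amat n \<in> carrier_mat n n" by (simp add: Amat_def)

text \<open>A column vector \<open>v\<close> in the kernel gives the coefficients of a polynomial of degree less than
  \<open>n\<close> in one variable that vanishes at the \<open>n\<close> distinct squares \<open>x\<^sub>i\<^sup>2\<close>.\<close>

lemma det_Amat: "det (Amat n) \<noteq> 0"
proof
  assume "det (Amat n) = 0"
  then obtain v where v: "v \<in> carrier_vec n" "v \<noteq> 0\<^sub>v n" "Amat n *\<^sub>v v = 0\<^sub>v n"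
    using det_0_iff_vec_prod_zero_field[OF Amat_carrier] by blast
  define p :: "ratf poly" where "p = (\<Sum>c<n. Polynomial.monom (to_fract (of_nat (2 * (c + 1))) * v $ c) c)"
  have coeff_p: "coeff p c = (if c < n then to_fract (of_nat (2 * (c + 1))) * v $ c else 0)" for c
    by (simp add: p_def coeff_sum)
  have root: "poly p (to_fract ((X (r + 1))\<^sup>2)) = 0" if r: "r < n" for r
  proof -
    let ?x = "to_fract (X (r + 1))"
    have "(Amat n *\<^sub>v v) $ r = 0" using v(3) r by simp
    then have "0 = (\<Sum>c<n. to_fract (of_nat (2 * (c + 1)) * X (r + 1) ^ (2 * (c + 1) - 1)) * v $ c)"
      using r v(1) by (simp add: Amat_def scalar_prod_def atLeast0LessThan)
    also have "\<dots> = (\<Sum>c<n. ?x * (to_fract (of_nat (2 * (c + 1))) * v $ c * to_fract ((X (r + 1))\<^sup>2) ^ c))"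
    proof (intro sum.cong refl)
      fix c
      have tp: "to_fract (p ^ k) = to_fract p ^ k" for p :: mpoly and k by (induction k) auto
      show "to_fract (of_nat (2 * (c + 1)) * X (r + 1) ^ (2 * (c + 1) - 1)) * v $ c =
        ?x * (to_fract (of_nat (2 * (c + 1))) * v $ c * to_fract ((X (r + 1))\<^sup>2) ^ c)"
        unfolding to_fract_mult tp by (simp add: power_mult[symmetric] algebra_simps)
    qed
    also have "\<dots> = ?x * poly p (to_fract ((X (r + 1))\<^sup>2))"
      by (simp add: p_def poly_sum poly_monom sum_distrib_left)
    finally show ?thesis by simp
  qed
  have "p = 0"
  proof (rule ccontr)
    assume p: "p \<noteq> 0"
    let ?R = "(\<lambda>r. to_fract ((X (r + 1))\<^sup>2)) ` {..<n}"
    have "card ?R = n" by (subst card_image) (auto simp: inj_on_def X_power2_eq_iff)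
    moreover have "card ?R \<le> card {t. poly p t = 0}"
      by (intro card_mono poly_roots_finite p) (use root in auto)
    moreover have "card {t. poly p t = 0} \<le> degree p" by (rule card_poly_roots_bound[OF p])
    moreover have "degree p < n"
      using p coeff_p[of "degree p"] by (auto split: if_splits)
    ultimately show False by simp
  qed
  then have "v $ c = 0" if "c < n" for c
  proof -
    have "to_fract (of_nat (2 * (c + 1)) :: mpoly) \<noteq> 0"
      by (simp only: to_fract_eq_0_iff of_nat_mpoly_eq_0_iff) simp
    moreover have "to_fract (of_nat (2 * (c + 1)) :: mpoly) * v $ c = 0"
      using coeff_p[of c] that \<open>p = 0\<close> by (simp only: if_True coeff_0)
    ultimately show ?thesis by (simp only: mult_eq_0_iff) blast
  qed
  with v(1,2) show False by auto
qed

definition Ainv :: "nat \<Rightarrow> ratf mat" where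
  "Ainv n = the (mat_inverse (Amat n))"

lemma Ainv: "Amat n * Ainv n = 1\<^sub>m n" "Ainv n * Amat n = 1\<^sub>m n" "Ainv n \<in> carrier_mat n n"
proof -
  have "Amat n \<in> Units (ring_mat TYPE(ratf) n ())"
    by (rule det_non_zero_imp_unit[OF Amat_carrier det_Amat])
  then obtain B where B: "mat_inverse (Amat n) = Some B"
    using mat_inverse(1)[OF Amat_carrier, of n "()"] by (cases "mat_inverse (Amat n)") auto
  from mat_inverse(2)[OF Amat_carrier B] B
  show "Amat n * Ainv n = 1\<^sub>m n" "Ainv n * Amat n = 1\<^sub>m n" "Ainv n \<in> carrier_mat n n"
    by (simp_all add: Ainv_def)
qed

lemma derivation_y:
  assumes "derivation D" "1 \<le> k" "k \<le> n"
  shows "D (to_fract (y n k)) = (\<Sum>i = 1..n. Amat n $$ (i - 1, k - 1) * D (to_fract (X i)))"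
proof -
  have tp: "to_fract (p ^ k) = to_fract p ^ k" for p :: mpoly and k by (induction k) auto
  have ts: "to_fract (sum h A) = (\<Sum>a\<in>A. to_fract (h a))" for h :: "nat \<Rightarrow> mpoly" and A
    by (induction A rule: infinite_finite_induct) auto
  have tn: "to_fract (of_nat k :: mpoly) = of_nat k" for k
    by (induction k) auto
  have "D (to_fract (X i ^ (2 * k))) = Amat n $$ (i - 1, k - 1) * D (to_fract (X i))"
    if "i \<in> {1..n}" for i
  proof -
    define i' k' where "i' = i - 1" and "k' = k - 1"
    then have [simp]: "i = Suc i'" "k = Suc k'" "i' < n" "k' < n"
      using that assms(2,3) by auto
    have "Amat n $$ (i', k') = of_nat (2 * k) * to_fract (X i) ^ (2 * k - 1)"
      by (simp add: Amat_def tp tn del: of_nat_mult of_nat_add of_nat_Suc)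
    then show ?thesis unfolding tp derivationD(8)[OF assms(1)] by simp
  qed
  then show ?thesis
    by (simp add: y_def ts derivationD[OF assms(1)])
qed

lemma partial_y_eq: "partial_y n j f = (\<Sum>i = 1..n. Ainv n $$ (j - 1, i - 1) * pderiv_rat i f)"
  by (simp add: partial_y_def Ainv_def)

lemma derivation_partial_y: "derivation (partial_y n j)"
  unfolding derivation_def partial_y_eq
  by (simp add: derivationD[OF derivation_pderiv_rat] sum.distrib[symmetric] sum_distrib_left
      sum_distrib_right algebra_simps)

lemma partial_y_X_outside: "i \<notin> {1..n} \<Longrightarrow> partial_y n j (to_fract (X i)) = 0"
  unfolding partial_y_eq by (intro sum.neutral) (auto simp: pderiv_rat_to_fract)

lemma partial_y_y:
  assumes j: "1 \<le> j" "j \<le> n" and k: "1 \<le> k" "k \<le> n"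
  shows "partial_y n j (to_fract (y n k)) = (if j = k then 1 else 0)"
proof -
  have "pderiv_rat i (to_fract (y n k)) = Amat n $$ (i - 1, k - 1)" if "i \<in> {1..n}" for i
  proof -
    have "pderiv_rat i (to_fract (y n k)) =
        (\<Sum>l = 1..n. if l = i then Amat n $$ (l - 1, k - 1) else 0)"
      unfolding derivation_y[OF derivation_pderiv_rat k]
      by (intro sum.cong refl) (simp add: pderiv_rat_to_fract)
    with that show ?thesis by simp
  qed
  then have "partial_y n j (to_fract (y n k)) = (\<Sum>i = 1..n. Ainv n $$ (j - 1, i - 1) * Amat n $$ (i - 1, k - 1))"
    unfolding partial_y_eq by (intro sum.cong) auto
  also have "\<dots> = (\<Sum>i<n. Ainv n $$ (j - 1, i) * Amat n $$ (i, k - 1))"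
    by (rule sum.reindex_bij_witness[of _ Suc "\<lambda>i. i - 1"]) auto
  also have "\<dots> = (Ainv n * Amat n) $$ (j - 1, k - 1)"
    using j k Ainv(3)[of n] Amat_carrier[of n] by (auto simp: scalar_prod_def atLeast0LessThan)
  also have "\<dots> = (if j = k then 1 else 0)"
    using j k unfolding Ainv by auto
  finally show ?thesis .
qed

text \<open>Because \<open>A\<close> is invertible, a derivation that does not move the \<open>y\<^sub>j\<close> and the variables beyond
  \<open>x\<^sub>n\<close> vanishes. Every commutation rule for the \<open>\<partial>/\<partial>y\<^sub>j\<close> reduces to this.\<close>

lemma derivation_eq_if_eq_on_y:
  assumes D: "derivation D" and E: "derivation E"
    and out: "\<And>i. i \<notin> {1..n} \<Longrightarrow> D (to_fract (X i)) = E (to_fract (X i))"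
    and y: "\<And>k. 1 \<le> k \<Longrightarrow> k \<le> n \<Longrightarrow> D (to_fract (y n k)) = E (to_fract (y n k))"
  shows "D f = E f"
proof -
  define H where "H f = D f - E f" for f
  have H: "derivation H" unfolding H_def using derivation_diff[OF D E] .
  have "H (to_fract (X l)) = 0" for l
  proof (cases "l \<in> {1..n}")
    case False
    then show ?thesis using out by (simp add: H_def)
  next
    case l: True
    have "H (to_fract (X l)) = (\<Sum>i = 1..n. if i = l then H (to_fract (X i)) else 0)"
      using l by simp
    also have "\<dots> = (\<Sum>i = 1..n. (Amat n * Ainv n) $$ (i - 1, l - 1) * H (to_fract (X i)))"
      by (intro sum.cong refl) (use l in \<open>auto simp: Ainv\<close>)
    also have "\<dots> = (\<Sum>i = 1..n. \<Sum>k<n. Amat n $$ (i - 1, k) * Ainv n $$ (k, l - 1) * H (to_fract (X i)))"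
      by (intro sum.cong refl)
        (use l Ainv(3)[of n] Amat_carrier[of n] in \<open>auto simp: scalar_prod_def atLeast0LessThan sum_distrib_right\<close>)
    also have "\<dots> = (\<Sum>k<n. Ainv n $$ (k, l - 1) * H (to_fract (y n (Suc k))))"
      by (subst sum.swap) (auto simp: derivation_y[OF H] sum_distrib_left mult_ac intro!: sum.cong)
    also have "\<dots> = 0" by (intro sum.neutral) (auto simp: H_def y)
    finally show ?thesis .
  qed
  from derivation_zero_if_zero_on_vars[OF H this, of f] show ?thesis by (simp add: H_def)
qed

text \<open>The commutator is a derivation that sends every \<open>y\<^sub>k\<close> to 0.\<close>

lemma partial_y_commute:
  assumes "1 \<le> i" "i \<le> n" "1 \<le> j" "j \<le> n"
  shows "partial_y n i (partial_y n j f) = partial_y n j (partial_y n i f)"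
proof -
  let ?i = "partial_y n i" and ?j = "partial_y n j"
  note di = derivationD[OF derivation_partial_y, of n i] and dj = derivationD[OF derivation_partial_y, of n j]
  have D: "derivation (\<lambda>f. ?i (?j f) - ?j (?i f))"
    unfolding derivation_def by (simp add: di dj algebra_simps)
  have E: "derivation (\<lambda>f. 0)" by (simp add: derivation_def)
  have "?i (?j f) - ?j (?i f) = 0"
  proof (rule derivation_eq_if_eq_on_y[OF D E, where n = n])
    show "?i (?j (to_fract (X k))) - ?j (?i (to_fract (X k))) = 0" if "k \<notin> {1..n}" for k
      by (simp add: partial_y_X_outside[OF that] di dj)
    show "?i (?j (to_fract (y n k))) - ?j (?i (to_fract (y n k))) = 0" if "1 \<le> k" "k \<le> n" for k
      using that assms by (auto simp: partial_y_y derivationD[OF derivation_partial_y])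
  qed
  then show ?thesis by simp
qed

section \<open>Invariance of the power sums and of the squared discriminant\<close>

lemma W_var_power_even:
  assumes "w \<in> carrier (W n)"
  shows "W_var w i ^ (2 * k) = X (snd w i) ^ (2 * k)"
proof -
  have "(Cst (of_int (fst w (snd w i))))\<^sup>2 = 1"
    using W_sign[OF assms, of "snd w i"] by (auto simp: Cst_uminus)
  then show ?thesis by (simp add: W_var_def power_mult power_mult_distrib)
qed

lemma W_act_poly_y:
  assumes "w \<in> carrier (W n)"
  shows "W_act_poly w (y n k) = y n k"
proof -
  have p: "snd w permutes {1..n}" using assms by (simp add: W_carrier)
  have "W_act_poly w (y n k) = (\<Sum>i = 1..n. X (snd w i) ^ (2 * k))"
    by (simp add: y_def W_act_poly_hom W_var_power_even[OF assms])
  also have "\<dots> = y n k" unfolding y_def by (subst sum.permute[OF p]) simp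
  finally show ?thesis .
qed

text \<open>The square of the Vandermonde product is, up to sign, a product over all ordered pairs of
  distinct indices, and in that form it is visibly symmetric.\<close>

lemma vandermonde_square:
  fixes n :: nat and x :: "nat \<Rightarrow> 'a :: comm_ring_1"
  defines "c \<equiv> (\<Prod>j = 1..n. \<Prod>i = 1..<j. - 1)"
  shows "(\<Prod>j = 1..n. \<Prod>i = 1..<j. (x j - x i))\<^sup>2 =
    c * (\<Prod>j = 1..n. \<Prod>i = 1..n. if i = j then 1 else x j - x i)"
proof -
  define D where "D = (\<Prod>j = 1..n. \<Prod>i = 1..<j. (x j - x i))"
  have cc: "c * c = 1"
    unfolding c_def by (simp add: prod.distrib[symmetric])
  have "(\<Prod>i = 1..n. if i = j then 1 else x j - x i) = (\<Prod>i = 1..<j. (x j - x i)) * (\<Prod>i \<in> {j<..n}. (x j - x i))"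
    if "j \<in> {1..n}" for j
  proof -
    have "{1..n} = {1..<j} \<union> ({j} \<union> {j<..n})" using that by auto
    moreover have "(\<Prod>i \<in> {1..<j} \<union> ({j} \<union> {j<..n}). if i = j then 1 else x j - x i) =
        (\<Prod>i = 1..<j. if i = j then 1 else x j - x i) *
        ((\<Prod>i \<in> {j}. if i = j then 1 else x j - x i) * (\<Prod>i \<in> {j<..n}. if i = j then 1 else x j - x i))"
      by (subst prod.union_disjoint, simp, simp, force, subst prod.union_disjoint) auto
    ultimately show ?thesis by (simp cong: prod.cong_simp)
  qed
  then have "(\<Prod>j = 1..n. \<Prod>i = 1..n. if i = j then 1 else x j - x i) =
     D * (\<Prod>j = 1..n. \<Prod>i \<in> {j<..n}. (x j - x i))"
    by (simp add: D_def prod.distrib[symmetric])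
  also have "(\<Prod>j = 1..n. \<Prod>i \<in> {j<..n}. (x j - x i)) = (\<Prod>j = 1..n. \<Prod>i | i \<in> {1..n} \<and> j < i. x j - x i)"
    by (intro prod.cong) auto
  also have "\<dots> = (\<Prod>i = 1..n. \<Prod>j | j \<in> {1..n} \<and> j < i. x j - x i)"
    by (rule prod.swap_restrict) auto
  also have "\<dots> = (\<Prod>i = 1..n. \<Prod>j = 1..<i. (- 1) * (x i - x j))"
    by (intro prod.cong) auto
  also have "\<dots> = c * D" by (simp only: prod.distrib c_def D_def)
  finally have "c * (\<Prod>j = 1..n. \<Prod>i = 1..n. if i = j then 1 else x j - x i) = (c * c) * D\<^sup>2"
    by (simp add: power2_eq_square algebra_simps)
  then show ?thesis by (simp add: cc D_def)
qed

lemma W_act_poly_Delta_square: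
  assumes w: "w \<in> carrier (W n)"
  shows "W_act_poly w ((Delta n)\<^sup>2) = (Delta n)\<^sup>2"
proof -
  let ?h = "W_act_poly w"
  have p: "snd w permutes {1..n}" using w by (simp add: W_carrier)
  have perm: "(\<Prod>i = 1..n. g (snd w i)) = (\<Prod>i = 1..n. g i)" for g :: "nat \<Rightarrow> mpoly"
    using prod.permute[OF p, of g] by (simp add: comp_def)
  have sq: "?h ((X i)\<^sup>2) = (X (snd w i))\<^sup>2" for i
    using W_var_power_even[OF w, of i 1] by (simp add: W_act_poly_hom)
  let ?c = "\<Prod>j = 1..n. \<Prod>i = 1..<j. - 1 :: mpoly"
  let ?P = "\<Prod>j = 1..n. \<Prod>i = 1..n. if i = j then 1 else (X j)\<^sup>2 - (X i)\<^sup>2"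
  have D: "(Delta n)\<^sup>2 = (of_nat (2 ^ n * fact n))\<^sup>2 * (\<Prod>i = 1..n. (X i)\<^sup>2) * (?c * ?P)"
    unfolding Delta_def power_mult_distrib vandermonde_square by (simp only: prod_power_distrib)
  have c: "?h ?c = ?c"
    by (simp only: is_hom_prod[OF is_hom_W_act_poly] W_act_poly_hom)
  have "?h ?P = (\<Prod>j = 1..n. \<Prod>i = 1..n. if i = j then 1 else (X (snd w j))\<^sup>2 - (X (snd w i))\<^sup>2)"
    by (auto simp: is_hom_prod[OF is_hom_W_act_poly] W_act_poly_hom(1-6) sq intro!: prod.cong)
  also have "\<dots> = (\<Prod>j = 1..n. \<Prod>i = 1..n. if snd w i = snd w j then 1 else (X (snd w j))\<^sup>2 - (X (snd w i))\<^sup>2)"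
    using permutes_inj[OF p] by (simp add: inj_eq)
  also have "\<dots> = (\<Prod>j = 1..n. \<Prod>i = 1..n. if i = snd w j then 1 else (X (snd w j))\<^sup>2 - (X i)\<^sup>2)"
    by (intro prod.cong refl perm)
  also have "\<dots> = ?P" by (rule perm)
  finally have P: "?h ?P = ?P" .
  have "?h (\<Prod>i = 1..n. (X i)\<^sup>2) = (\<Prod>i = 1..n. (X (snd w i))\<^sup>2)"
    by (simp only: is_hom_prod[OF is_hom_W_act_poly] sq)
  also have "\<dots> = (\<Prod>i = 1..n. (X i)\<^sup>2)" by (rule perm)
  finally show ?thesis
    unfolding D W_act_poly_hom(2) P c W_act_poly_hom(7,8) by simp
qed

lemma W_act_poly_Delta:
  assumes "w \<in> carrier (W n)"
  shows "W_act_poly w (Delta n) = Delta n \<or> W_act_poly w (Delta n) = - Delta n"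
proof -
  have "(W_act_poly w (Delta n))\<^sup>2 = (Delta n)\<^sup>2"
    using W_act_poly_Delta_square[OF assms] by (simp add: W_act_poly_hom)
  then show ?thesis by (simp add: power2_eq_iff)
qed

lemma Delta_neq_0: "Delta n \<noteq> 0"
proof -
  have "(X j)\<^sup>2 - (X i)\<^sup>2 \<noteq> 0" if "i < j" for i j
    using that X_power2_eq_iff[of j i] by simp
  then show ?thesis by (auto simp: Delta_def)
qed

lemma poly_ring_add [intro]: "p \<in> poly_ring n \<Longrightarrow> q \<in> poly_ring n \<Longrightarrow> p + q \<in> poly_ring n"
  unfolding poly_ring_def using keys_add[of p q] by blast

lemma poly_ring_Cst [intro, simp]: "Cst c \<in> poly_ring n"
  unfolding poly_ring_def Cst_def by (auto split: if_splits)

lemma poly_ring_X [intro]: "i \<in> {1..n} \<Longrightarrow> X i \<in> poly_ring n"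
  unfolding poly_ring_def X_def by auto

lemma poly_ring_mult [intro]:
  assumes "p \<in> poly_ring n" "q \<in> poly_ring n"
  shows "p * q \<in> poly_ring n"
  unfolding poly_ring_def
proof (intro CollectI ballI)
  fix m assume "m \<in> Poly_Mapping.keys (p * q)"
  then obtain a b where "a \<in> Poly_Mapping.keys p" "b \<in> Poly_Mapping.keys q" "m = a + b"
    using keys_mult[of p q] by blast
  with assms show "Poly_Mapping.keys m \<subseteq> {1..n}"
    using keys_add[of a b] unfolding poly_ring_def by blast
qed

lemma poly_ring_0 [simp, intro]: "0 \<in> poly_ring n" and poly_ring_1 [simp, intro]: "1 \<in> poly_ring n"
  using poly_ring_Cst[of 0 n] poly_ring_Cst[of 1 n] by simp_all

lemma poly_ring_uminus [intro]: "p \<in> poly_ring n \<Longrightarrow> - p \<in> poly_ring n"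
  using poly_ring_mult[OF poly_ring_Cst[of "-1" n], of p] by (simp add: Cst_uminus)

lemma poly_ring_diff [intro]: "p \<in> poly_ring n \<Longrightarrow> q \<in> poly_ring n \<Longrightarrow> p - q \<in> poly_ring n"
  using poly_ring_add[of p n "- q"] by auto

lemma poly_ring_prod: "(\<And>a. a \<in> A \<Longrightarrow> h a \<in> poly_ring n) \<Longrightarrow> prod h A \<in> poly_ring n"
  by (induction A rule: infinite_finite_induct) auto

lemma poly_ring_sum: "(\<And>a. a \<in> A \<Longrightarrow> h a \<in> poly_ring n) \<Longrightarrow> sum h A \<in> poly_ring n"
  by (induction A rule: infinite_finite_induct) auto

lemma poly_ring_power: "p \<in> poly_ring n \<Longrightarrow> p ^ k \<in> poly_ring n"
  by (induction k) auto

lemma poly_ring_of_nat: "of_nat k \<in> poly_ring n"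
  by (induction k) auto

lemma Delta_in_poly_ring: "Delta n \<in> poly_ring n"
  unfolding Delta_def
  by (intro poly_ring_mult poly_ring_of_nat poly_ring_prod poly_ring_diff poly_ring_power poly_ring_X) auto

lemma poly_ring_W:
  assumes w: "w \<in> carrier (W n)" and p: "p \<in> poly_ring n"
  shows "W_act_poly w p \<in> poly_ring n"
proof -
  have "snd w permutes {1..n}" using w by (simp add: W_carrier)
  then have "W_var w i \<in> poly_ring n" if "i \<in> {1..n}" for i
    unfolding W_var_def using that by (intro poly_ring_mult poly_ring_Cst poly_ring_X) (simp only: permutes_in_image)
  moreover have "Poly_Mapping.keys m \<subseteq> {1..n}" if "m \<in> Poly_Mapping.keys p" for m
    using that p by (auto simp: poly_ring_def)
  ultimately show ?thesis
    unfolding W_act_poly_superset[OF finite_keys order.refl]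
    by (intro poly_ring_sum poly_ring_mult poly_ring_Cst poly_ring_prod poly_ring_power; blast)
qed

lemma OX_I: "p \<in> poly_ring n \<Longrightarrow> Fract p (Delta n ^ k) \<in> OX n"
  by (auto simp: OX_def)

lemma OX_0: "0 \<in> OX n"
  using OX_I[of 0 n 0] by (simp add: Zero_fract_def)

lemma OX_add:
  assumes "f \<in> OX n" "g \<in> OX n"
  shows "f + g \<in> OX n"
proof -
  obtain p k where f: "f = Fract p (Delta n ^ k)" "p \<in> poly_ring n" using assms by (auto simp: OX_def)
  obtain q l where g: "g = Fract q (Delta n ^ l)" "q \<in> poly_ring n" using assms by (auto simp: OX_def)
  have "f + g = Fract (p * Delta n ^ l + q * Delta n ^ k) (Delta n ^ (k + l))"
    using f g Delta_neq_0[of n] by (simp add: power_add)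
  also have "\<dots> \<in> OX n"
    by (intro OX_I poly_ring_add poly_ring_mult poly_ring_power Delta_in_poly_ring f g)
  finally show ?thesis .
qed

lemma OX_sum: "(\<And>a. a \<in> A \<Longrightarrow> h a \<in> OX n) \<Longrightarrow> sum h A \<in> OX n"
  by (induction A rule: infinite_finite_induct) (auto intro: OX_0 OX_add)

lemma OX_cscale: "f \<in> OX n \<Longrightarrow> cscale c f \<in> OX n"
  unfolding cscale_def to_fract_def by (auto simp: OX_def) (metis poly_ring_mult poly_ring_Cst)

lemma OX_W:
  assumes w: "w \<in> carrier (W n)" and f: "f \<in> OX n"
  shows "W_act_rat w f \<in> OX n"
proof -
  obtain p k where f: "f = Fract p (Delta n ^ k)" "p \<in> poly_ring n" using f by (auto simp: OX_def)
  have wf: "W_act_rat w f = Fract (W_act_poly w p) (W_act_poly w (Delta n) ^ k)"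
    using f Delta_neq_0 by (simp add: W_act_rat_Fract[OF w] W_act_poly_hom)
  have "(- Delta n) ^ k = Delta n ^ k \<or> (- Delta n) ^ k = - (Delta n ^ k)"
    by (metis power_minus_even power_minus_odd)
  then have "W_act_poly w (Delta n) ^ k = Delta n ^ k \<or> W_act_poly w (Delta n) ^ k = - (Delta n ^ k)"
    using W_act_poly_Delta[OF w] by auto
  then consider "W_act_rat w f = Fract (W_act_poly w p) (Delta n ^ k)"
    | "W_act_rat w f = Fract (- W_act_poly w p) (Delta n ^ k)"
    using wf Delta_neq_0[of n] by (metis minus_fract_cancel minus_minus)
  then show ?thesis
    by cases (use poly_ring_W[OF w f(2)] in \<open>auto intro: OX_I\<close>)
qed

lemma OX_CW_act:
  assumes "a \<in> carrier (CW n)" "f \<in> OX n"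
  shows "CW_act a f \<in> OX n"
  unfolding lin_act_def
  by (intro OX_sum OX_cscale OX_W) (use assms in auto)

section \<open>Commutation of the differential operators with the group\<close>

text \<open>The conjugate of \<open>\<partial>/\<partial>y\<^sub>j\<close> by \<open>w\<close> is a derivation with the same values on the invariants \<open>y\<^sub>k\<close>.\<close>

lemma W_act_rat_partial_y:
  assumes w: "w \<in> carrier (W n)" and j: "1 \<le> j" "j \<le> n"
  shows "W_act_rat w (partial_y n j f) = partial_y n j (W_act_rat w f)"
proof -
  interpret group "W n" by (rule group_W)
  let ?v = "inv\<^bsub>W n\<^esub> w"
  have v: "?v \<in> carrier (W n)" using w by simp
  have vw: "W_act_rat ?v (W_act_rat w f) = f" and wv: "W_act_rat w (W_act_rat ?v f) = f" for f
    using W_act_rat_mult[OF v w, of f] W_act_rat_mult[OF w v, of f] w W_act_rat_1 by auto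
  note hw = W_act_rat_hom[OF w] and hv = W_act_rat_hom[OF v]
  have D: "derivation (\<lambda>f. W_act_rat ?v (partial_y n j (W_act_rat w f)))"
    unfolding derivation_def
    by (simp add: hw hv vw derivationD[OF derivation_partial_y] W_act_rat_to_fract[OF w])
  have "W_act_rat ?v (partial_y n j (W_act_rat w f)) = partial_y n j f"
  proof (rule derivation_eq_if_eq_on_y[OF D derivation_partial_y, where n = n])
    fix i assume i: "i \<notin> {1..n}"
    have "snd w permutes {1..n}" using w by (simp add: W_carrier)
    from permutes_not_in[OF this i] have "snd w i = i" .
    moreover have "fst w i = 1" using w i by (auto simp: W_carrier)
    ultimately have "W_act_rat w (to_fract (X i)) = to_fract (X i)"
      by (simp add: W_act_rat_to_fract[OF w] W_var_def)
    then show "W_act_rat ?v (partial_y n j (W_act_rat w (to_fract (X i)))) = partial_y n j (to_fract (X i))"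
      by (simp add: partial_y_X_outside[OF i] hv)
  next
    fix k assume "1 \<le> k" "k \<le> n"
    then show "W_act_rat ?v (partial_y n j (W_act_rat w (to_fract (y n k)))) = partial_y n j (to_fract (y n k))"
      using j by (simp add: W_act_rat_to_fract[OF w] W_act_poly_y[OF w] partial_y_y hv)
  qed
  then show ?thesis by (metis wv)
qed

lemma clinear_gen_act: "clinear (gen_act n d)"
proof (cases d)
  case (GenD j)
  then show ?thesis using clinear_derivation[OF derivation_partial_y, of n j] by (simp add: clinear_def)
qed (simp_all add: clinear_def cscale_def algebra_simps add_divide_distrib)

lemma clinear_words: "clinear (foldr (gen_act n) u)"
  by (induction u) (use clinearD[OF clinear_gen_act] in \<open>simp_all add: clinear_def\<close>)

lemma monoid_dwords: "monoid (dwords n)"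
  by (rule monoidI) (auto simp: dwords_def)

lemma dwords_simps [simp]:
  "carrier (dwords n) = lists (GenY ` {1..n} \<union> GenD ` {1..n} \<union> {GenInv})"
  "u \<otimes>\<^bsub>dwords n\<^esub> v = u @ v" "\<one>\<^bsub>dwords n\<^esub> = []"
  by (simp_all add: dwords_def)

lemma free_act_mult:
  assumes "a \<in> carrier (free_alg n)" "b \<in> carrier (free_alg n)"
  shows "free_act n (a \<otimes>\<^bsub>free_alg n\<^esub> b) f = free_act n a (free_act n b f)"
  unfolding free_act_def
  by (rule lin_act_mult[OF assms monoid_dwords clinear_words]) simp

lemma clinear_free_act: "clinear (free_act n a)"
  unfolding free_act_def by (rule clinear_lin_act[OF clinear_words])

lemma word_closed: "w \<in> carrier (dwords n) \<Longrightarrow> word w \<in> carrier (free_alg n)"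
  by (auto simp: word_def intro: finite_subset[of _ "{w}"])

lemma free_act_word [simp]: "free_act n (word w) f = foldr (gen_act n) w f"
  unfolding free_act_def word_def by simp

lemma free_alg_diff:
  assumes "a \<in> carrier (free_alg n)" "b \<in> carrier (free_alg n)"
  shows "a - b \<in> carrier (free_alg n)" "free_act n (a - b) f = free_act n a f - free_act n b f"
proof -
  interpret ring "free_alg n" by (rule ring_monoid_algebra[OF monoid_dwords])
  define c where "c = (\<lambda>x. -1 * b x)"
  have c: "c \<in> carrier (free_alg n)" using assms(2) by (simp add: c_def)
  have ab: "a - b = a \<oplus>\<^bsub>free_alg n\<^esub> c" by (auto simp: c_def)
  show "a - b \<in> carrier (free_alg n)" unfolding ab by (rule a_closed[OF assms(1) c])
  have "free_act n (a - b) f = free_act n a f + free_act n c f"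
    unfolding ab free_act_def monoid_algebra_simps by (rule lin_act_add) (use assms(1) c in auto)
  also have "free_act n c f = - free_act n b f"
    unfolding c_def free_act_def lin_act_scale by simp
  finally show "free_act n (a - b) f = free_act n a f - free_act n b f"
    unfolding diff_conv_add_uminus[of "free_act n a f"] .
qed

lemma gen_act_W:
  assumes w: "w \<in> carrier (W n)" and d: "d \<in> GenY ` {1..n} \<union> GenD ` {1..n} \<union> {GenInv}"
  shows "W_act_rat w (gen_act n d f) = gen_act n d (W_act_rat w f)"
  using d
  by (auto simp: W_act_rat_hom[OF w] W_act_rat_to_fract[OF w] W_act_poly_y[OF w] W_act_rat_partial_y[OF w]
      W_act_rat_divide[OF w] W_act_poly_Delta_square[OF w])

lemma words_W:
  assumes w: "w \<in> carrier (W n)" and "u \<in> carrier (dwords n)"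
  shows "W_act_rat w (foldr (gen_act n) u f) = foldr (gen_act n) u (W_act_rat w f)"
  using assms(2) by (induction u) (auto simp: gen_act_W[OF w])

lemma CW_act_free_act:
  assumes a: "a \<in> carrier (free_alg n)" and b: "b \<in> carrier (CW n)"
  shows "CW_act b (free_act n a f) = free_act n a (CW_act b f)"
proof -
  have "W_act_rat w (free_act n a f) = free_act n a (W_act_rat w f)" if w: "w \<in> carrier (W n)" for w
    unfolding free_act_def lin_act_def clinearD(6)[OF clinear_W_act_rat[OF w]]
    by (intro sum.cong refl) (use a words_W[OF w] in \<open>auto simp: clinearD(2)[OF clinear_W_act_rat[OF w]] subset_iff\<close>)
  then show ?thesis
    unfolding lin_act_def[of W_act_rat] clinearD(6)[OF clinear_free_act] clinearD(2)[OF clinear_free_act]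
    by (intro sum.cong refl) (use b in auto)
qed

section \<open>The action factors through the presented algebra\<close>

text \<open>Words in the letters \<open>y\<^sub>j\<close> act by multiplication operators, so their action is determined by the value at 1.\<close>

lemma Delta_sq_exprs_act:
  assumes "q \<in> Delta_sq_exprs n"
  shows "free_act n q f = to_fract ((Delta n)\<^sup>2) * f"
proof -
  have word: "foldr (gen_act n) w f = foldr (gen_act n) w 1 * f" if "w \<in> lists (GenY ` {1..n})" for w
    using that by (induction w) (auto simp: mult.assoc)
  have "free_act n q f = (\<Sum>w | q w \<noteq> 0. cscale (q w) (foldr (gen_act n) w 1) * f)"
    unfolding free_act_def lin_act_def
  proof (intro sum.cong refl)
    fix w assume "w \<in> {w. q w \<noteq> 0}"
    then have "w \<in> lists (GenY ` {1..n})" using assms unfolding Delta_sq_exprs_def by blast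
    from word[OF this] show "cscale (q w) (foldr (gen_act n) w f) = cscale (q w) (foldr (gen_act n) w 1) * f"
      by (simp add: cscale_def mult.assoc)
  qed
  also have "\<dots> = free_act n q 1 * f" by (simp add: free_act_def lin_act_def sum_distrib_right)
  finally show ?thesis using assms by (simp add: Delta_sq_exprs_def)
qed

definition annihilator :: "nat \<Rightarrow> (dgen list \<Rightarrow> complex) set" where
  "annihilator n = {a \<in> carrier (free_alg n). \<forall>f. free_act n a f = 0}"

lemma annihilator_ideal: "ideal (annihilator n) (free_alg n)"
proof (rule idealI)
  interpret ring "free_alg n" by (rule ring_monoid_algebra[OF monoid_dwords])
  show "ring (free_alg n)" ..
  have zero: "free_act n a 0 = 0" for a by (rule clinearD(3)[OF clinear_free_act])
  have add: "free_act n (a \<oplus>\<^bsub>free_alg n\<^esub> b) f = free_act n a f + free_act n b f"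
    if "a \<in> carrier (free_alg n)" "b \<in> carrier (free_alg n)" for a b f
    unfolding free_act_def monoid_algebra_simps by (rule lin_act_add) (use that in auto)
  show "subgroup (annihilator n) (add_monoid (free_alg n))"
  proof (rule add.subgroupI)
    show "annihilator n \<noteq> {}"
      using zero_closed by (auto simp: annihilator_def free_act_def)
    show "a \<oplus>\<^bsub>free_alg n\<^esub> b \<in> annihilator n" if "a \<in> annihilator n" "b \<in> annihilator n" for a b
      using that add a_closed unfolding annihilator_def by (simp del: monoid_algebra_simps)
    show "\<ominus>\<^bsub>free_alg n\<^esub> a \<in> annihilator n" if "a \<in> annihilator n" for a
    proof -
      have a: "a \<in> carrier (free_alg n)" "\<And>f. free_act n a f = 0" using that by (auto simp: annihilator_def)
      have "free_act n (\<ominus>\<^bsub>free_alg n\<^esub> a \<oplus>\<^bsub>free_alg n\<^esub> a) f = free_act n (\<ominus>\<^bsub>free_alg n\<^esub> a) f" for f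
        using add[OF a_inv_closed[OF a(1)] a(1)] a(2) by simp
      moreover have "free_act n (\<ominus>\<^bsub>free_alg n\<^esub> a \<oplus>\<^bsub>free_alg n\<^esub> a) f = 0" for f
        unfolding l_neg[OF a(1)] by (simp add: free_act_def)
      ultimately show ?thesis using a_inv_closed[OF a(1)] by (simp only: annihilator_def mem_Collect_eq) simp
    qed
  qed (auto simp: annihilator_def)
  show "b \<otimes>\<^bsub>free_alg n\<^esub> a \<in> annihilator n" "a \<otimes>\<^bsub>free_alg n\<^esub> b \<in> annihilator n"
    if "a \<in> annihilator n" "b \<in> carrier (free_alg n)" for a b
    using that free_act_mult m_closed zero unfolding annihilator_def
    by (simp_all del: monoid_algebra_simps)
qed

lemma DY_relations_annihilate: "DY_relations n \<subseteq> annihilator n"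
proof
  interpret ring "free_alg n" by (rule ring_monoid_algebra[OF monoid_dwords])
  fix a assume "a \<in> DY_relations n"
  note ann = annihilator_def mem_Collect_eq
  then consider (YY) i j where "a = word [GenY i, GenY j] - word [GenY j, GenY i]" "i \<in> {1..n}" "j \<in> {1..n}"
    | (DD) i j where "a = word [GenD i, GenD j] - word [GenD j, GenD i]" "i \<in> {1..n}" "j \<in> {1..n}"
    | (DY) i j where "a = word [GenD i, GenY j] - word [GenY j, GenD i] - (if i = j then word [] else 0)" "i \<in> {1..n}" "j \<in> {1..n}"
    | (L) q where "a = word [GenInv] \<otimes>\<^bsub>free_alg n\<^esub> q - word []" "q \<in> Delta_sq_exprs n"
    | (R) q where "a = q \<otimes>\<^bsub>free_alg n\<^esub> word [GenInv] - word []" "q \<in> Delta_sq_exprs n"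
    using \<open>a \<in> DY_relations n\<close> unfolding DY_relations_def by blast
  then show "a \<in> annihilator n"
  proof cases
    case YY
    then have "word [GenY i, GenY j] \<in> carrier (free_alg n)" "word [GenY j, GenY i] \<in> carrier (free_alg n)"
      by (intro word_closed; simp)+
    from free_alg_diff[OF this] show ?thesis by (simp add: ann YY(1) mult.left_commute del: monoid_algebra_simps)
  next
    case DD
    then have "word [GenD i, GenD j] \<in> carrier (free_alg n)" "word [GenD j, GenD i] \<in> carrier (free_alg n)"
      by (intro word_closed; simp)+
    from free_alg_diff[OF this] DD(2,3) show ?thesis
      by (simp add: ann DD(1) partial_y_commute[of i n j] del: monoid_algebra_simps)
  next
    case DY
    have 1: "word [GenD i, GenY j] \<in> carrier (free_alg n)" "word [GenY j, GenD i] \<in> carrier (free_alg n)"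
      using DY by (intro word_closed; simp)+
    have 2: "(if i = j then word [] else 0) \<in> carrier (free_alg n)"
      using word_closed[of "[]" n] by auto
    have 3: "free_act n (if i = j then word [] else 0) f = (if i = j then f else 0)" for f
      by (cases "i = j") (simp, simp add: free_act_def lin_act_def)
    show ?thesis
      unfolding ann DY(1)
      using free_alg_diff[OF 1] free_alg_diff[OF free_alg_diff(1)[OF 1] 2] DY(2,3)
      by (simp add: 3 partial_y_y derivationD(2)[OF derivation_partial_y] del: monoid_algebra_simps)
  next
    case L
    have c: "word [GenInv] \<in> carrier (free_alg n)" "word [] \<in> carrier (free_alg n)" "q \<in> carrier (free_alg n)"
      using L(2) word_closed[of "[GenInv]" n] word_closed[of "[]" n] by (auto simp: Delta_sq_exprs_def)
    show ?thesis
      unfolding ann L(1)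
      using free_alg_diff[OF m_closed[OF c(1,3)] c(2)] free_act_mult[OF c(1,3)] Delta_neq_0[of n]
      by (simp add: Delta_sq_exprs_act[OF L(2)] del: monoid_algebra_simps)
  next
    case R
    have c: "word [GenInv] \<in> carrier (free_alg n)" "word [] \<in> carrier (free_alg n)" "q \<in> carrier (free_alg n)"
      using R(2) word_closed[of "[GenInv]" n] word_closed[of "[]" n] by (auto simp: Delta_sq_exprs_def)
    show ?thesis
      unfolding ann R(1)
      using free_alg_diff[OF m_closed[OF c(3,1)] c(2)] free_act_mult[OF c(3,1)] Delta_neq_0[of n]
      by (simp add: Delta_sq_exprs_act[OF R(2)] del: monoid_algebra_simps)
  qed
qed

text \<open>The defining relations annihilate every rational function, hence so does the ideal that they
  generate, and all representatives of a class act in the same way.\<close>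

lemma DY_act_representative:
  assumes "P \<in> carrier (DY n)"
  shows "\<exists>a\<in>carrier (free_alg n). \<forall>f. DY_act n P f = free_act n a f"
proof -
  interpret ring "free_alg n" by (rule ring_monoid_algebra[OF monoid_dwords])
  let ?I = "genideal (free_alg n) (DY_relations n)"
  have sub: "DY_relations n \<subseteq> carrier (free_alg n)"
    using DY_relations_annihilate[of n] unfolding annihilator_def by blast
  have I: "ideal ?I (free_alg n)" by (rule genideal_ideal[OF sub])
  have Iann: "?I \<subseteq> annihilator n"
    by (rule genideal_minimal[OF annihilator_ideal DY_relations_annihilate])
  obtain a where a: "a \<in> carrier (free_alg n)" "P = a_r_coset (free_alg n) ?I a"
    using assms unfolding DY_def FactRing_def A_RCOSETS_def' by auto
  have ideal0: "\<zero>\<^bsub>free_alg n\<^esub> \<in> ?I"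
    by (rule additive_subgroup.zero_closed) (rule ideal.axioms(1)[OF I])
  have "free_act n b f = free_act n a f" if b: "b \<in> P" for b f
  proof -
    obtain h where h: "h \<in> ?I" "b = h \<oplus>\<^bsub>free_alg n\<^esub> a" using b unfolding a(2) a_r_coset_def' by blast
    then have hc: "h \<in> carrier (free_alg n)" "free_act n h f = 0" using Iann by (auto simp: annihilator_def)
    have "free_act n b f = free_act n h f + free_act n a f"
      unfolding h(2) free_act_def monoid_algebra_simps by (rule lin_act_add) (use a(1) hc(1) in auto)
    with hc(2) show ?thesis by simp
  qed
  moreover have "P \<noteq> {}" using ideal0 a(2) by (auto simp: a_r_coset_def')
  ultimately have "(\<lambda>b. free_act n b f) ` P = {free_act n a f}" for f
    by (simp add: image_constant_conv cong: image_cong_simp)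
  with a(1) show ?thesis by (auto simp: DY_act_def)
qed

lemma CW_act_DY_act:
  assumes "P \<in> carrier (DY n)" "b \<in> carrier (CW n)"
  shows "CW_act b (DY_act n P f) = DY_act n P (CW_act b f)"
  using DY_act_representative[OF assms(1)] CW_act_free_act[OF _ assms(2)] by auto

lemma DY_act_0: "P \<in> carrier (DY n) \<Longrightarrow> DY_act n P 0 = 0"
  using DY_act_representative[of P n] clinearD(3)[OF clinear_free_act] by auto

section \<open>Young symmetrizers of one component\<close>

abbreviation perm_act :: "(nat \<Rightarrow> nat) \<Rightarrow> mpoly \<Rightarrow> mpoly" where
  "perm_act \<pi> \<equiv> W_act_poly (\<lambda>i. 1, \<pi>)"

definition sign_change :: "nat \<Rightarrow> welt" where
  "sign_change k = (\<lambda>i. if i = k then -1 else 1, id)"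

lemma W_var_perm [simp]: "W_var (\<lambda>i. 1, \<pi>) i = X (\<pi> i)"
  by (simp add: W_var_def)

lemma W_var_sign_change [simp]: "W_var (sign_change k) i = (if i = k then - X i else X i)"
  by (simp add: W_var_def sign_change_def Cst_uminus)

lemma perm_act_comp: "perm_act (\<pi> \<circ> \<rho>) p = perm_act \<pi> (perm_act \<rho> p)"
  by (rule mpoly_hom_eq[OF is_hom_W_act_poly]) (simp_all add: is_hom_def W_act_poly_hom)

lemma uminus_if_power2 [simp]: "(if c then - p else p)\<^sup>2 = (p :: mpoly)\<^sup>2"
  by simp

text \<open>Higher Specht polynomials are built from these monomials with index tableaux as \<open>e\<close>; all that
  matters here is that the exponents are even, so that sign changes have no effect.\<close>

definition even_monomial :: "filling \<Rightarrow> (nat \<times> nat \<Rightarrow> nat) \<Rightarrow> mpoly" where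
  "even_monomial T e = (\<Prod>\<xi>\<in>dom T. X (the (T \<xi>)) ^ (2 * e \<xi>))"

lemma perm_act_even_monomial:
  "perm_act \<pi> (even_monomial T e) = (\<Prod>\<xi>\<in>dom T. X (\<pi> (the (T \<xi>))) ^ (2 * e \<xi>))"
  by (simp add: even_monomial_def is_hom_prod[OF is_hom_W_act_poly] W_act_poly_hom)

lemma sign_change_perm_act_even_monomial:
  "W_act_poly (sign_change k) (perm_act \<pi> (even_monomial T e)) = perm_act \<pi> (even_monomial T e)"
  by (simp add: perm_act_even_monomial is_hom_prod[OF is_hom_W_act_poly] W_act_poly_hom power_mult)

lemma perm_act_even_monomial_fixed:
  assumes "\<pi> permutes ran T" "\<And>k. k \<in> ran T \<Longrightarrow> t k = k"
  shows "perm_act t (perm_act \<pi> (even_monomial T e)) = perm_act \<pi> (even_monomial T e)"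
  unfolding perm_act_comp[symmetric]
  unfolding perm_act_even_monomial
proof (intro prod.cong refl)
  fix \<xi> assume "\<xi> \<in> dom T"
  then have "the (T \<xi>) \<in> ran T" by (metis domD option.sel ranI)
  then have "t (\<pi> (the (T \<xi>))) = \<pi> (the (T \<xi>))"
    using assms by (simp add: permutes_in_image)
  then show "X ((t \<circ> \<pi>) (the (T \<xi>))) ^ (2 * e \<xi>) = X (\<pi> (the (T \<xi>))) ^ (2 * e \<xi>)" by simp
qed

lemma row_stab_permutes: "\<sigma> \<in> row_stab T \<Longrightarrow> \<sigma> permutes ran T"
  and col_stab_permutes: "\<sigma> \<in> col_stab T \<Longrightarrow> \<sigma> permutes ran T"
  by (auto simp: row_stab_def col_stab_def)

lemma row_stab_comp: "\<sigma> \<in> row_stab T \<Longrightarrow> \<rho> \<in> row_stab T \<Longrightarrow> \<sigma> \<circ> \<rho> \<in> row_stab T"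
  and col_stab_comp: "\<sigma> \<in> col_stab T \<Longrightarrow> \<rho> \<in> col_stab T \<Longrightarrow> \<sigma> \<circ> \<rho> \<in> col_stab T"
proof -
  have *: "(\<sigma> \<circ> \<rho>) ` A = A" if "\<sigma> ` A = A" "\<rho> ` A = A" for A
    using that by (metis image_comp)
  show "\<sigma> \<in> row_stab T \<Longrightarrow> \<rho> \<in> row_stab T \<Longrightarrow> \<sigma> \<circ> \<rho> \<in> row_stab T"
    unfolding row_stab_def mem_Collect_eq by (intro conjI allI permutes_compose *) simp_all
  show "\<sigma> \<in> col_stab T \<Longrightarrow> \<rho> \<in> col_stab T \<Longrightarrow> \<sigma> \<circ> \<rho> \<in> col_stab T"
    unfolding col_stab_def mem_Collect_eq by (intro conjI allI permutes_compose *) simp_all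
qed

lemma transpose_row_stab:
  assumes "inj_on T (dom T)" "T (i, j) = Some k" "T (i, j') = Some l"
  shows "transpose k l \<in> row_stab T"
proof -
  have "k \<in> ran T" "l \<in> ran T" using assms by (auto simp: ran_def)
  moreover have "(\<exists>j. T (i', j) = Some k) \<longleftrightarrow> (\<exists>j. T (i', j) = Some l)" for i'
  proof -
    have "i' = i" if "T (i', j) = Some k" for j using that assms inj_onD[OF assms(1), of "(i', j)" "(i, _)"] by force
    moreover have "i' = i" if "T (i', j) = Some l" for j using that assms inj_onD[OF assms(1), of "(i', j)" "(i, _)"] by force
    ultimately show ?thesis using assms by blast
  qed
  ultimately show ?thesis by (auto simp: row_stab_def permutes_swap_id)
qed

lemma transpose_col_stab:
  assumes "inj_on T (dom T)" "T (i, j) = Some k" "T (i', j) = Some l"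
  shows "transpose k l \<in> col_stab T"
proof -
  have "k \<in> ran T" "l \<in> ran T" using assms by (auto simp: ran_def)
  moreover have "(\<exists>i. T (i, j') = Some k) \<longleftrightarrow> (\<exists>i. T (i, j') = Some l)" for j'
  proof -
    have "j' = j" if "T (i, j') = Some k" for i using that assms inj_onD[OF assms(1), of "(i, j')" "(_, j)"] by force
    moreover have "j' = j" if "T (i, j') = Some l" for i using that assms inj_onD[OF assms(1), of "(i, j')" "(_, j)"] by force
    ultimately show ?thesis using assms by blast
  qed
  ultimately show ?thesis by (auto simp: col_stab_def permutes_swap_id)
qed

lemma transpose_reindex:
  assumes "transpose k l \<in> A" "\<And>\<sigma> \<rho>. \<sigma> \<in> A \<Longrightarrow> \<rho> \<in> A \<Longrightarrow> \<sigma> \<circ> \<rho> \<in> A"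
  shows "(\<Sum>\<sigma>\<in>A. g (transpose k l \<circ> \<sigma>)) = (\<Sum>\<sigma>\<in>A. g \<sigma>)"
  by (rule sum.reindex_bij_witness[of _ "\<lambda>\<sigma>. transpose k l \<circ> \<sigma>" "\<lambda>\<sigma>. transpose k l \<circ> \<sigma>"])
    (use assms in \<open>auto simp: o_assoc\<close>)

definition young_coeff :: "filling \<Rightarrow> complex" where
  "young_coeff T = 1 / of_nat (\<Prod>\<xi> \<in> dom T. hook_length (dom T) \<xi>)"

lemma young_sym_col_transpose:
  assumes fin: "finite (dom T)" and kl: "transpose k l \<in> col_stab T" "k \<noteq> l"
  shows "perm_act (transpose k l) (young_sym T p) = - young_sym T p"
proof -
  have sgn: "sign (transpose k l \<circ> \<tau>) = - sign \<tau>" if "\<tau> \<in> col_stab T" for \<tau>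
  proof -
    have "permutation \<tau>"
      using col_stab_permutes[OF that] finite_ran[OF fin] permutation_permutes by blast
    then show ?thesis using kl(2) by (simp add: sign_compose permutation_swap_id sign_swap_id)
  qed
  have "(\<Sum>\<tau>\<in>col_stab T. Cst (of_int (sign \<tau>)) * perm_act (transpose k l) (perm_act (\<tau> \<circ> \<sigma>) p)) =
      - (\<Sum>\<tau>\<in>col_stab T. Cst (of_int (sign \<tau>)) * perm_act (\<tau> \<circ> \<sigma>) p)" for \<sigma>
  proof -
    have "(\<Sum>\<tau>\<in>col_stab T. Cst (of_int (sign \<tau>)) * perm_act (transpose k l) (perm_act (\<tau> \<circ> \<sigma>) p)) =
      (\<Sum>\<tau>\<in>col_stab T. - (Cst (of_int (sign (transpose k l \<circ> \<tau>))) * perm_act (transpose k l \<circ> \<tau> \<circ> \<sigma>) p))"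
      by (intro sum.cong refl) (simp add: sgn perm_act_comp Cst_uminus)
    also have "\<dots> = (\<Sum>\<tau>\<in>col_stab T. - (Cst (of_int (sign \<tau>)) * perm_act (\<tau> \<circ> \<sigma>) p))"
      by (rule transpose_reindex[OF kl(1) col_stab_comp])
    finally show ?thesis by (simp add: sum_negf)
  qed
  then show ?thesis
    by (simp add: young_sym_def W_act_poly_hom sum_negf)
qed

text \<open>The part of \<open>young_sym\<close> belonging to one column permutation \<open>\<tau>\<close>; it is invariant under the row
  group of the filling that arises from \<open>T\<close> by applying \<open>\<tau>\<close> to the entries.\<close>

definition row_sum :: "filling \<Rightarrow> (nat \<Rightarrow> nat) \<Rightarrow> mpoly \<Rightarrow> mpoly" where
  "row_sum T \<tau> p = (\<Sum>\<sigma>\<in>row_stab T. perm_act (\<tau> \<circ> \<sigma>) p)"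

lemma young_sym_row_sum:
  "young_sym T p = (\<Sum>\<tau>\<in>col_stab T. Cst (young_coeff T * of_int (sign \<tau>)) * row_sum T \<tau> p)"
proof -
  have "young_sym T p = Cst (young_coeff T) *
      (\<Sum>\<tau>\<in>col_stab T. \<Sum>\<sigma>\<in>row_stab T. Cst (of_int (sign \<tau>)) * perm_act (\<tau> \<circ> \<sigma>) p)"
    unfolding young_sym_def young_coeff_def by (subst sum.swap) (rule refl)
  then show ?thesis by (simp add: row_sum_def sum_distrib_left Cst_mult mult.assoc)
qed

lemma row_sum_row_transpose:
  assumes "bij \<tau>" "transpose k l \<in> row_stab T"
  shows "perm_act (transpose (\<tau> k) (\<tau> l)) (row_sum T \<tau> p) = row_sum T \<tau> p"
proof -
  have conj: "transpose (\<tau> k) (\<tau> l) \<circ> (\<tau> \<circ> \<sigma>) = \<tau> \<circ> (transpose k l \<circ> \<sigma>)" for \<sigma>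
    using bij_is_inj[OF assms(1)] by (auto simp: fun_eq_iff transpose_def inj_eq)
  have "perm_act (transpose (\<tau> k) (\<tau> l)) (row_sum T \<tau> p) =
      (\<Sum>\<sigma>\<in>row_stab T. perm_act (\<tau> \<circ> (transpose k l \<circ> \<sigma>)) p)"
    unfolding row_sum_def W_act_poly_hom(9) perm_act_comp[symmetric] conj ..
  also have "\<dots> = row_sum T \<tau> p"
    unfolding row_sum_def by (rule transpose_reindex[OF assms(2) row_stab_comp])
  finally show ?thesis .
qed

lemma row_sum_sign_change: "W_act_poly (sign_change k) (row_sum T \<tau> (even_monomial T e)) = row_sum T \<tau> (even_monomial T e)"
  by (simp add: row_sum_def W_act_poly_hom sign_change_perm_act_even_monomial)

lemma row_sum_fixed:
  assumes "\<tau> \<in> col_stab T" "\<And>k. k \<in> ran T \<Longrightarrow> t k = k"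
  shows "perm_act t (row_sum T \<tau> (even_monomial T e)) = row_sum T \<tau> (even_monomial T e)"
  unfolding row_sum_def W_act_poly_hom(9)
  by (intro sum.cong refl perm_act_even_monomial_fixed assms(2) permutes_compose row_stab_permutes
      col_stab_permutes assms(1))

lemma young_sym_sign_change: "W_act_poly (sign_change k) (young_sym T (even_monomial T e)) = young_sym T (even_monomial T e)"
  by (simp add: young_sym_row_sum W_act_poly_hom row_sum_sign_change)

lemma young_sym_fixed:
  assumes "\<And>k. k \<in> ran T \<Longrightarrow> t k = k"
  shows "perm_act t (young_sym T (even_monomial T e)) = young_sym T (even_monomial T e)"
  unfolding young_sym_row_sum W_act_poly_hom(9)
  by (intro sum.cong refl) (simp add: W_act_poly_hom row_sum_fixed[OF _ assms])

lemma prod_X_transpose: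
  assumes "k \<in> A \<longleftrightarrow> l \<in> A"
  shows "perm_act (transpose k l) (\<Prod>i\<in>A. X i ^ \<nu>) = (\<Prod>i\<in>A. X i ^ \<nu>)"
proof -
  have "perm_act (transpose k l) (\<Prod>i\<in>A. X i ^ \<nu>) = (\<Prod>i\<in>A. X (transpose k l i) ^ \<nu>)"
    by (simp add: is_hom_prod[OF is_hom_W_act_poly] W_act_poly_hom)
  also have "\<dots> = (\<Prod>i\<in>A. X i ^ \<nu>)"
    by (rule prod.reindex_bij_betw) (use assms in simp)
  finally show ?thesis .
qed

lemma prod_X_sign_change_1:
  assumes "finite A"
  shows "W_act_poly (sign_change k) (\<Prod>i\<in>A. X i ^ 1) = (if k \<in> A then - 1 else 1) * (\<Prod>i\<in>A. X i ^ 1)"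
proof -
  have "W_act_poly (sign_change k) (\<Prod>i\<in>A. X i ^ 1) = (\<Prod>i\<in>A. (if i = k then - 1 else 1) * X i)"
    by (auto simp: is_hom_prod[OF is_hom_W_act_poly] intro!: prod.cong)
  then show ?thesis using assms by (simp add: prod.distrib)
qed

lemma prod_X_sign_change_2: "W_act_poly (sign_change k) (\<Prod>i\<in>A. X i ^ 2) = (\<Prod>i\<in>A. X i ^ 2)"
  by (simp add: is_hom_prod[OF is_hom_W_act_poly] W_act_poly_hom)

section \<open>Higher Specht polynomials\<close>

lemma Tab_iff: "T \<in> Tab lam \<longleftrightarrow> dom (fst T) = fst lam \<and> dom (snd T) = snd lam \<and>
    inj_on (fst T) (dom (fst T)) \<and> inj_on (snd T) (dom (snd T)) \<and> ran (fst T) \<inter> ran (snd T) = {} \<and>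
    ran (fst T) \<union> ran (snd T) = {1..card (fst lam) + card (snd lam)}"
  by (cases T) (simp add: Tab_def)

lemma TabD:
  assumes "T \<in> Tab lam" "lam \<in> P2 n"
  shows "dom (fst T) = fst lam" "dom (snd T) = snd lam" "inj_on (fst T) (dom (fst T))" "inj_on (snd T) (dom (snd T))"
    "ran (fst T) \<inter> ran (snd T) = {}" "ran (fst T) \<union> ran (snd T) = {1..n}"
    "finite (dom (fst T))" "finite (dom (snd T))"
  using assms by (auto simp: Tab_def P2_def young_diagram_def)

lemma specht_poly_eq:
  assumes "dom (fst T) = dom (fst S)" "dom (snd T) = dom (snd S)"
  shows "specht_poly T S =
    (young_sym (fst T) (even_monomial (fst T) (index_tab 1 S)) * (\<Prod>k\<in>ran (fst T). X k ^ 1)) *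
    (young_sym (snd T) (even_monomial (snd T) (index_tab 2 S)) * (\<Prod>k\<in>ran (snd T). X k ^ 2))"
  by (simp add: specht_poly_def tab_monomial_def even_monomial_def tcomp_def assms)

definition swap_elt :: "nat \<Rightarrow> nat \<Rightarrow> welt" where
  "swap_elt k l = (\<lambda>i. 1, transpose k l)"

lemma swap_elt_W: "k \<in> {1..n} \<Longrightarrow> l \<in> {1..n} \<Longrightarrow> swap_elt k l \<in> carrier (W n)"
  unfolding W_carrier swap_elt_def by (simp only: fst_conv snd_conv) (simp add: permutes_swap_id)

lemma sign_change_W: "k \<in> {1..n} \<Longrightarrow> sign_change k \<in> carrier (W n)"
  by (auto simp: W_carrier sign_change_def permutes_id)

text \<open>The two symmetry types that are played off against each other: both prescribe the sign changes,
  one the behaviour under transpositions within columns, the other within rows.\<close>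

definition sign_type :: "tableau2 \<Rightarrow> ratf \<Rightarrow> bool" where
  "sign_type T f \<longleftrightarrow> (\<forall>k\<in>ran (fst T). W_act_rat (sign_change k) f = - f) \<and> (\<forall>k\<in>ran (snd T). W_act_rat (sign_change k) f = f)"

definition column_antisymmetric :: "tableau2 \<Rightarrow> ratf \<Rightarrow> bool" where
  "column_antisymmetric T f \<longleftrightarrow> sign_type T f \<and> (\<forall>A\<in>{fst T, snd T}. \<forall>i i' j k l.
     A (i, j) = Some k \<and> A (i', j) = Some l \<and> k \<noteq> l \<longrightarrow> W_act_rat (swap_elt k l) f = - f)"

definition row_symmetric :: "tableau2 \<Rightarrow> ratf \<Rightarrow> bool" where
  "row_symmetric T f \<longleftrightarrow> sign_type T f \<and> (\<forall>A\<in>{fst T, snd T}. \<forall>i j j' k l.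
     A (i, j) = Some k \<and> A (i, j') = Some l \<longrightarrow> W_act_rat (swap_elt k l) f = f)"

lemma sign_type_product:
  assumes T: "T \<in> Tab lam" and lam: "lam \<in> P2 n"
    and p: "\<And>k. W_act_poly (sign_change k) p = p" and q: "\<And>k. W_act_poly (sign_change k) q = q"
  shows "sign_type T (to_fract ((p * (\<Prod>k\<in>ran (fst T). X k ^ 1)) * (q * (\<Prod>k\<in>ran (snd T). X k ^ 2))))"
    (is "sign_type T ?f")
proof -
  note t = TabD[OF T lam]
  have act: "W_act_rat (sign_change k) ?f = (if k \<in> ran (fst T) then - 1 else 1) * ?f" if "k \<in> {1..n}" for k
    unfolding W_act_rat_to_fract[OF sign_change_W[OF that]] W_act_poly_hom(2) p q prod_X_sign_change_2
      prod_X_sign_change_1[OF finite_ran[OF t(7)]] by simp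
  show ?thesis
    unfolding sign_type_def
  proof (intro conjI ballI)
    fix k assume k: "k \<in> ran (fst T)"
    then have "k \<in> {1..n}" using t(6) by blast
    from act[OF this] k show "W_act_rat (sign_change k) ?f = - ?f" by (simp only: if_True) simp
  next
    fix k assume k: "k \<in> ran (snd T)"
    then have kn: "k \<in> {1..n}" and "k \<notin> ran (fst T)" using t(5,6) by blast+
    with act[OF kn] show "W_act_rat (sign_change k) ?f = ?f" by (simp only: if_False) simp
  qed
qed

text \<open>A transposition of two entries of one component fixes the variables of the other one.\<close>

lemma component_transposition:
  assumes T: "T \<in> Tab lam" and lam: "lam \<in> P2 n" and A: "A \<in> {fst T, snd T}" "k \<in> ran A" "l \<in> ran A"
    and p: "\<And>t. (\<And>k. k \<in> ran (fst T) \<Longrightarrow> t k = k) \<Longrightarrow> perm_act t p = p"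
    and q: "\<And>t. (\<And>k. k \<in> ran (snd T) \<Longrightarrow> t k = k) \<Longrightarrow> perm_act t q = q"
    and c: "A = fst T \<Longrightarrow> perm_act (transpose k l) p = c * p" "A = snd T \<Longrightarrow> perm_act (transpose k l) q = c * q"
  defines "f \<equiv> to_fract ((p * (\<Prod>k\<in>ran (fst T). X k ^ 1)) * (q * (\<Prod>k\<in>ran (snd T). X k ^ 2)))"
  shows "W_act_rat (swap_elt k l) f = to_fract c * f"
proof -
  note t = TabD[OF T lam]
  have kl: "k \<in> {1..n}" "l \<in> {1..n}" using A t(6) by auto
  have iff: "k \<in> ran B \<longleftrightarrow> l \<in> ran B" if "B \<in> {fst T, snd T}" for B using A that t(5) by blast
  have act: "W_act_rat (swap_elt k l) f = to_fract
      ((perm_act (transpose k l) p * (\<Prod>k\<in>ran (fst T). X k ^ 1)) * (perm_act (transpose k l) q * (\<Prod>k\<in>ran (snd T). X k ^ 2)))"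
    unfolding f_def W_act_rat_to_fract[OF swap_elt_W[OF kl]] W_act_poly_hom(2) unfolding swap_elt_def
    by (subst (1 2) prod_X_transpose) (simp_all add: iff)
  have fixes_other: "transpose k l j = j" if "j \<in> ran B" "k \<notin> ran B" "l \<notin> ran B" for j B
    using that by (metis transpose_apply_other)
  consider "A = fst T" "k \<notin> ran (snd T)" "l \<notin> ran (snd T)" | "A = snd T" "k \<notin> ran (fst T)" "l \<notin> ran (fst T)"
    using A t(5) by blast
  then show ?thesis
  proof cases
    case 1
    have "perm_act (transpose k l) q = q" by (rule q) (rule fixes_other[OF _ 1(2,3)])
    then show ?thesis unfolding act c(1)[OF 1(1)] by (simp add: f_def)
  next
    case 2
    have "perm_act (transpose k l) p = p" by (rule p) (rule fixes_other[OF _ 2(2,3)])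
    then show ?thesis unfolding act c(2)[OF 2(1)] by (simp add: f_def)
  qed
qed

text \<open>Multiplication by a transposition within a column permutes the summands of one Young symmetrizer and
  reverses their signs.\<close>

lemma column_antisymmetric_F:
  assumes T: "T \<in> Tab lam" and S: "S \<in> Tab lam" and lam: "lam \<in> P2 n"
  shows "column_antisymmetric T (F T S)"
proof -
  note t = TabD[OF T lam] and s = TabD[OF S lam]
  define p where "p = young_sym (fst T) (even_monomial (fst T) (index_tab 1 S))"
  define q where "q = young_sym (snd T) (even_monomial (snd T) (index_tab 2 S))"
  have F: "F T S = to_fract ((p * (\<Prod>k\<in>ran (fst T). X k ^ 1)) * (q * (\<Prod>k\<in>ran (snd T). X k ^ 2)))"
    unfolding F_def p_def q_def by (subst specht_poly_eq) (simp_all add: t s)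
  have "sign_type T (F T S)"
    unfolding F by (rule sign_type_product[OF T lam]) (simp_all add: p_def q_def young_sym_sign_change)
  moreover have "W_act_rat (swap_elt k l) (F T S) = - F T S"
    if h: "A \<in> {fst T, snd T}" "A (i, j) = Some k" "A (i', j) = Some l" "k \<noteq> l" for A i i' j k l
  proof -
    have "k \<in> ran A" "l \<in> ran A" using h by (auto simp: ran_def)
    then have "W_act_rat (swap_elt k l) (F T S) = to_fract (- 1) * F T S"
      unfolding F
    proof (rule component_transposition[OF T lam h(1)])
      show "perm_act (transpose k l) p = - 1 * p" if "A = fst T"
        using young_sym_col_transpose[OF t(7) transpose_col_stab[OF t(3)] h(4)] h(2,3) that by (simp add: p_def)
      show "perm_act (transpose k l) q = - 1 * q" if "A = snd T"
        using young_sym_col_transpose[OF t(8) transpose_col_stab[OF t(4)] h(4)] h(2,3) that by (simp add: q_def)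
    qed (unfold p_def q_def, erule young_sym_fixed, erule young_sym_fixed)
    then show ?thesis by simp
  qed
  ultimately show ?thesis unfolding column_antisymmetric_def by blast
qed

lemma ran_map_option_permutes:
  assumes "\<tau> permutes ran A"
  shows "ran (\<lambda>\<xi>. map_option \<tau> (A \<xi>)) = ran A"
proof -
  have "ran (\<lambda>\<xi>. map_option \<tau> (A \<xi>)) = \<tau> ` ran A" by (auto simp: ran_def)
  then show ?thesis using permutes_image[OF assms] by simp
qed

text \<open>Expand the sums over the column groups. The summand of a pair \<open>(\<tau>, \<rho>)\<close> of column permutations is
  symmetric in the rows of the tableau that arises by applying \<open>\<tau>\<close> and \<open>\<rho>\<close> to the entries of \<open>T\<close>.\<close>

lemma F_in_span_row_symmetric:
  assumes T: "T \<in> Tab lam" and S: "S \<in> Tab lam" and lam: "lam \<in> P2 n"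
  shows "F T S \<in> cvs.span {g. \<exists>U\<in>Tab lam. row_symmetric U g}"
proof -
  note t = TabD[OF T lam] and s = TabD[OF S lam]
  define p where "p \<tau> = row_sum (fst T) \<tau> (even_monomial (fst T) (index_tab 1 S))" for \<tau>
  define q where "q \<tau> = row_sum (snd T) \<tau> (even_monomial (snd T) (index_tab 2 S))" for \<tau>
  define a where "a = (\<Prod>k\<in>ran (fst T). X k ^ 1)"
  define b where "b = (\<Prod>k\<in>ran (snd T). X k ^ 2)"
  define cp where "cp \<tau> = young_coeff (fst T) * of_int (sign \<tau>)" for \<tau> :: "nat \<Rightarrow> nat"
  define cq where "cq \<tau> = young_coeff (snd T) * of_int (sign \<tau>)" for \<tau> :: "nat \<Rightarrow> nat"
  have ts: "to_fract (sum h A) = (\<Sum>x\<in>A. to_fract (h x))" for h :: "(nat \<Rightarrow> nat) \<Rightarrow> mpoly" and A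
    by (induction A rule: infinite_finite_induct) auto
  have "F T S = to_fract (((\<Sum>\<tau>\<in>col_stab (fst T). Cst (cp \<tau>) * p \<tau>) * a) * ((\<Sum>\<rho>\<in>col_stab (snd T). Cst (cq \<rho>) * q \<rho>) * b))"
    unfolding F_def p_def q_def a_def b_def cp_def cq_def
    by (subst specht_poly_eq) (simp_all add: t s young_sym_row_sum)
  also have "\<dots> = (\<Sum>\<tau>\<in>col_stab (fst T). \<Sum>\<rho>\<in>col_stab (snd T).
      cscale (cp \<tau> * cq \<rho>) (to_fract ((p \<tau> * a) * (q \<rho> * b))))"
    by (simp add: ts sum_distrib_left sum_distrib_right cscale_def Cst_mult mult_ac) (rule sum.swap)
  also have "\<dots> \<in> cvs.span {g. \<exists>U\<in>Tab lam. row_symmetric U g}"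
  proof (intro cvs.span_sum cvs.span_scale cvs.span_base)
    fix \<tau> \<rho> assume \<tau>: "\<tau> \<in> col_stab (fst T)" and \<rho>: "\<rho> \<in> col_stab (snd T)"
    define g where "g = to_fract ((p \<tau> * a) * (q \<rho> * b))"
    define U where "U = (\<lambda>\<xi>. map_option \<tau> (fst T \<xi>), \<lambda>\<xi>. map_option \<rho> (snd T \<xi>))"
    note \<tau>p = col_stab_permutes[OF \<tau>] and \<rho>p = col_stab_permutes[OF \<rho>]
    have ranU: "ran (fst U) = ran (fst T)" "ran (snd U) = ran (snd T)"
      using ran_map_option_permutes[OF \<tau>p] ran_map_option_permutes[OF \<rho>p] by (simp_all add: U_def)
    have domU: "dom (fst U) = dom (fst T)" "dom (snd U) = dom (snd T)"
      by (auto simp: U_def dom_def)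
    have inj: "inj_on (\<lambda>\<xi>. map_option f (A \<xi>)) D" if "inj f" "inj_on A D" for f :: "nat \<Rightarrow> nat" and A :: filling and D
      using inj_on_subset[OF option.inj_map[OF that(1)], of "A ` D"] comp_inj_on[OF that(2)] by (auto simp: comp_def)
    have "inj_on (fst U) (dom (fst T))" "inj_on (snd U) (dom (snd T))"
      using inj[OF permutes_inj[OF \<tau>p] t(3)] inj[OF permutes_inj[OF \<rho>p] t(4)] by (simp_all add: U_def)
    then have U: "U \<in> Tab lam"
      using T unfolding Tab_iff ranU domU by blast
    have "row_symmetric U g"
    proof -
      have g: "g = to_fract ((p \<tau> * (\<Prod>k\<in>ran (fst U). X k ^ 1)) * (q \<rho> * (\<Prod>k\<in>ran (snd U). X k ^ 2)))"
        by (simp add: g_def a_def b_def ranU)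
      have "sign_type U g"
        unfolding g by (rule sign_type_product[OF U lam]) (simp_all add: p_def q_def row_sum_sign_change)
      moreover have "W_act_rat (swap_elt k l) g = g"
        if h: "A \<in> {fst U, snd U}" "A (i, j) = Some k" "A (i, j') = Some l" for A i j j' k l
      proof -
        have "k \<in> ran A" "l \<in> ran A" using h by (auto simp: ran_def)
        then have "W_act_rat (swap_elt k l) g = to_fract 1 * g"
          unfolding g
        proof (rule component_transposition[OF U lam h(1)])
          show "perm_act (transpose k l) (p \<tau>) = 1 * p \<tau>" if A: "A = fst U"
          proof -
            obtain k' l' where k': "fst T (i, j) = Some k'" "k = \<tau> k'" "fst T (i, j') = Some l'" "l = \<tau> l'"
              using h A by (auto simp: U_def)
            show ?thesis unfolding p_def k'(2,4) mult_1
              by (rule row_sum_row_transpose[OF permutes_bij[OF \<tau>p] transpose_row_stab[OF t(3) k'(1,3)]])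
          qed
          show "perm_act (transpose k l) (q \<rho>) = 1 * q \<rho>" if A: "A = snd U"
          proof -
            obtain k' l' where k': "snd T (i, j) = Some k'" "k = \<rho> k'" "snd T (i, j') = Some l'" "l = \<rho> l'"
              using h A by (auto simp: U_def)
            show ?thesis unfolding q_def k'(2,4) mult_1
              by (rule row_sum_row_transpose[OF permutes_bij[OF \<rho>p] transpose_row_stab[OF t(4) k'(1,3)]])
          qed
        qed (unfold p_def q_def ranU, erule row_sum_fixed[OF \<tau>], erule row_sum_fixed[OF \<rho>])
        then show ?thesis by simp
      qed
      ultimately show ?thesis unfolding row_symmetric_def by blast
    qed
    with U show "to_fract ((p \<tau> * a) * (q \<rho> * b)) \<in> {g. \<exists>U\<in>Tab lam. row_symmetric U g}"
      by (auto simp: g_def)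
  qed
  finally show ?thesis .
qed

text \<open>Average over the group of all \<open>w\<close> that map \<open>f\<close> to \<open>\<plusminus>f\<close>, twisted by that sign: this operator
  multiplies \<open>f\<close> by the order of the group and kills every \<open>g\<close> on which some \<open>w\<close> acts with the
  opposite sign.\<close>

lemma compatible_summand:
  assumes f: "f \<in> cvs.span G" "f \<noteq> 0"
  shows "\<exists>g\<in>G. \<forall>t\<in>carrier (W n). \<not> (W_act_rat t f = f \<and> W_act_rat t g = - g) \<and>
    \<not> (W_act_rat t f = - f \<and> W_act_rat t g = g)"
proof (rule ccontr)
  interpret group "W n" by (rule group_W)
  assume contra: "\<not> ?thesis"
  define H where "H = {w \<in> carrier (W n). W_act_rat w f = f \<or> W_act_rat w f = - f}"
  define \<chi> where "\<chi> w = (if W_act_rat w f = f then 1 else - 1 :: complex)" for w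
  define B where "B v = (\<Sum>w\<in>H. cscale (\<chi> w) (W_act_rat w v))" for v
  have finH: "finite H" unfolding H_def using finite_W by simp
  have HW: "w \<in> carrier (W n)" if "w \<in> H" for w using that by (simp add: H_def)
  have act_f: "W_act_rat w f = cscale (\<chi> w) f" if "w \<in> H" for w
    using that by (auto simp: H_def \<chi>_def)
  have \<chi>\<chi>: "\<chi> w * \<chi> w = 1" for w by (simp add: \<chi>_def)
  have \<chi>I: "\<chi> w = c" if "W_act_rat w f = cscale c f" "c = 1 \<or> c = - 1" for w c
  proof -
    have "f \<noteq> - f"
    proof
      assume "f = - f"
      then have "cscale 2 f = 0" using cscale_add_left[of 1 1 f] by simp
      then show False using f(2) by simp
    qed
    then show ?thesis using that by (auto simp: \<chi>_def)
  qed
  have one: "\<one>\<^bsub>W n\<^esub> \<in> H" by (simp add: H_def W_act_rat_1)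
  have mult: "w \<otimes>\<^bsub>W n\<^esub> t \<in> H" "\<chi> (w \<otimes>\<^bsub>W n\<^esub> t) = \<chi> w * \<chi> t" if "w \<in> H" "t \<in> H" for w t
  proof -
    have *: "W_act_rat (w \<otimes>\<^bsub>W n\<^esub> t) f = cscale (\<chi> w * \<chi> t) f"
      using that by (simp add: W_act_rat_mult[OF HW HW] act_f clinearD(2)[OF clinear_W_act_rat[OF HW]]
          cscale_cscale mult.commute)
    have sgn: "\<chi> w * \<chi> t = 1 \<or> \<chi> w * \<chi> t = - 1" by (auto simp: \<chi>_def)
    have "w \<otimes>\<^bsub>W n\<^esub> t \<in> carrier (W n)" using HW[OF that(1)] HW[OF that(2)] by simp
    moreover have "W_act_rat (w \<otimes>\<^bsub>W n\<^esub> t) f = f \<or> W_act_rat (w \<otimes>\<^bsub>W n\<^esub> t) f = - f"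
      using sgn unfolding * by (elim disjE) (simp_all only: cscale_simps simp_thms)
    ultimately show "w \<otimes>\<^bsub>W n\<^esub> t \<in> H" unfolding H_def by blast
    show "\<chi> (w \<otimes>\<^bsub>W n\<^esub> t) = \<chi> w * \<chi> t" by (rule \<chi>I[OF * sgn])
  qed
  have inj: "inj_on (\<lambda>w. w \<otimes>\<^bsub>W n\<^esub> t) H" if "t \<in> H" for t
    using HW[OF that] HW by (auto simp: inj_on_def)
  have bij: "bij_betw (\<lambda>w. w \<otimes>\<^bsub>W n\<^esub> t) H H" if "t \<in> H" for t
    using endo_inj_surj[OF finH _ inj[OF that]] mult(1)[OF _ that] inj[OF that]
    by (auto simp: bij_betw_def image_subset_iff)
  have B_shift: "B (W_act_rat t v) = cscale (\<chi> t) (B v)" if t: "t \<in> H" for t v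
  proof -
    have "B (W_act_rat t v) = (\<Sum>w\<in>H. cscale (\<chi> t) (cscale (\<chi> (w \<otimes>\<^bsub>W n\<^esub> t)) (W_act_rat (w \<otimes>\<^bsub>W n\<^esub> t) v)))"
      unfolding B_def
    proof (intro sum.cong refl)
      fix w assume w: "w \<in> H"
      have "\<chi> t * (\<chi> w * \<chi> t) = \<chi> w * (\<chi> t * \<chi> t)" by simp
      then show "cscale (\<chi> w) (W_act_rat w (W_act_rat t v)) =
          cscale (\<chi> t) (cscale (\<chi> (w \<otimes>\<^bsub>W n\<^esub> t)) (W_act_rat (w \<otimes>\<^bsub>W n\<^esub> t) v))"
        using w t by (simp add: cscale_cscale mult \<chi>\<chi> W_act_rat_mult[OF HW HW])
    qed
    also have "\<dots> = cscale (\<chi> t) (\<Sum>w\<in>H. cscale (\<chi> (w \<otimes>\<^bsub>W n\<^esub> t)) (W_act_rat (w \<otimes>\<^bsub>W n\<^esub> t) v))"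
      by (simp add: cvs.scale_sum_right)
    also have "(\<Sum>w\<in>H. cscale (\<chi> (w \<otimes>\<^bsub>W n\<^esub> t)) (W_act_rat (w \<otimes>\<^bsub>W n\<^esub> t) v)) = B v"
      unfolding B_def by (rule sum.reindex_bij_betw[OF bij[OF t]])
    finally show ?thesis .
  qed
  have lin: "clinear B"
  proof -
    have "B (u + v) = B u + B v" for u v
      unfolding B_def sum.distrib[symmetric]
      by (intro sum.cong refl) (simp add: clinearD(1)[OF clinear_W_act_rat[OF HW]] cscale_add_right)
    moreover have "B (cscale c v) = cscale c (B v)" for c v
      unfolding B_def cvs.scale_sum_right
      by (intro sum.cong refl) (simp add: clinearD(2)[OF clinear_W_act_rat[OF HW]] cscale_cscale mult.commute)
    ultimately show ?thesis by (simp add: clinear_def)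
  qed
  have B0: "B g = 0" if g: "g \<in> G" for g
  proof -
    obtain t c where t: "t \<in> carrier (W n)" "W_act_rat t f = cscale c f" "W_act_rat t g = cscale (- c) g" "c = 1 \<or> c = - 1"
    proof -
      obtain t where "t \<in> carrier (W n)" "W_act_rat t f = f \<and> W_act_rat t g = - g \<or> W_act_rat t f = - f \<and> W_act_rat t g = g"
        using contra g by blast
      then show ?thesis using that[of t 1] that[of t "- 1"] by auto
    qed
    then have tH: "t \<in> H" by (auto simp: H_def)
    have "cscale (- c) (B g) = B (W_act_rat t g)"
      unfolding t(3) by (rule clinearD(2)[OF lin, symmetric])
    also have "\<dots> = cscale c (B g)" unfolding B_shift[OF tH] \<chi>I[OF t(2,4)] ..
    finally have "cscale (- c - c) (B g) = 0"
      by (simp only: cvs.scale_left_diff_distrib diff_self)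
    then show ?thesis using t(4) by auto
  qed
  have "cvs.subspace {v. B v = 0}"
    by (rule cvs.subspaceI) (auto simp: clinearD[OF lin])
  then have "cvs.span G \<subseteq> {v. B v = 0}" by (intro cvs.span_minimal) (auto simp: B0)
  then have "B f = 0" using f(1) by blast
  moreover have "B f = cscale (of_nat (card H)) f"
  proof -
    have "B f = (\<Sum>w\<in>H. cscale 1 f)"
      unfolding B_def by (intro sum.cong refl) (simp only: act_f cscale_cscale \<chi>\<chi>)
    then show ?thesis by (simp only: cvs.scale_sum_left[symmetric]) simp
  qed
  moreover have "card H \<noteq> 0" using one finH by auto
  ultimately show False using f(2) by simp
qed

section \<open>Dominance of shapes\<close>

lemma finite_down_closed_eq_lessThan:
  assumes "finite A" "\<And>a b :: nat. a \<in> A \<Longrightarrow> b \<le> a \<Longrightarrow> b \<in> A"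
  shows "A = {..<card A}"
proof -
  have "A \<subseteq> {..<card A}"
  proof
    fix a assume "a \<in> A"
    then have "{..a} \<subseteq> A" using assms(2) by auto
    from card_mono[OF assms(1) this] show "a \<in> {..<card A}" by simp
  qed
  then show ?thesis using card_subset_eq[of "{..<card A}" A] by simp
qed

lemma young_diagram_eq_if_row_counts:
  assumes D: "young_diagram D" and E: "young_diagram E"
    and eq: "\<And>k. card {\<xi> \<in> D. fst \<xi> < k} = card {\<xi> \<in> E. fst \<xi> < k}"
  shows "D = E"
proof -
  define row where "row D i = {j. (i, j) \<in> D}" for D :: diagram and i
  have row: "finite (row D i)" "row D i = {..<card (row D i)}"
      "card {\<xi> \<in> D. fst \<xi> < Suc i} = card {\<xi> \<in> D. fst \<xi> < i} + card (row D i)"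
    if D: "young_diagram D" for D i
  proof -
    have fin: "finite D" using D by (simp add: young_diagram_def)
    have r: "row D i = snd ` {\<xi> \<in> D. fst \<xi> = i}" by (force simp: row_def)
    show f: "finite (row D i)" unfolding r using fin by simp
    show "row D i = {..<card (row D i)}"
      by (rule finite_down_closed_eq_lessThan[OF f]) (use D in \<open>auto simp: row_def young_diagram_def\<close>)
    have "card (row D i) = card {\<xi> \<in> D. fst \<xi> = i}" unfolding r
      by (rule card_image) (auto simp: inj_on_def)
    moreover have "{\<xi> \<in> D. fst \<xi> < Suc i} = {\<xi> \<in> D. fst \<xi> < i} \<union> {\<xi> \<in> D. fst \<xi> = i}" by auto
    ultimately show "card {\<xi> \<in> D. fst \<xi> < Suc i} = card {\<xi> \<in> D. fst \<xi> < i} + card (row D i)"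
      using fin by (simp add: card_Un_disjoint disjoint_iff)
  qed
  have "card (row D i) = card (row E i)" for i
    using row(3)[OF D, of i] row(3)[OF E, of i] eq by simp
  then have "row D i = row E i" for i using row(2)[OF D, of i] row(2)[OF E, of i] by simp
  then show ?thesis by (auto simp: row_def set_eq_iff)
qed

text \<open>Sort the cells in the first \<open>m\<close> rows of \<open>D\<close> by the column in which \<open>B\<close> has their entry. By separation a
  column receives at most one cell of each row, so no more than \<open>m\<close>; it also receives no more cells
  than its length. The minimum of the two is the number of its cells in the first \<open>m\<close> rows of \<open>E\<close>.\<close>

lemma dominance:
  fixes A B :: filling
  assumes D: "finite D" and E: "young_diagram E" and dom: "dom A = D" "dom B = E"
    and inj: "inj_on A D" "inj_on B E" and ran: "ran A = ran B"
    and sep: "\<And>i j j' r r' c k l. A (i, j) = Some k \<Longrightarrow> A (i, j') = Some l \<Longrightarrow>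
      B (r, c) = Some k \<Longrightarrow> B (r', c) = Some l \<Longrightarrow> k = l"
  shows "card {\<xi> \<in> D. fst \<xi> < m} \<le> card {\<xi> \<in> E. fst \<xi> < m}"
proof -
  have finE: "finite E" using E by (simp add: young_diagram_def)
  have "\<exists>\<eta>. \<eta> \<in> E \<and> B \<eta> = A \<xi>" if "\<xi> \<in> D" for \<xi>
  proof -
    obtain k where k: "A \<xi> = Some k" using \<open>\<xi> \<in> D\<close> dom(1) by blast
    then have "k \<in> ran B" using ran by (metis ranI)
    then obtain \<eta> where "B \<eta> = Some k" by (auto simp: ran_def)
    then show ?thesis using k dom(2) by (intro exI[of _ \<eta>]) auto
  qed
  then obtain h where h: "\<And>\<xi>. \<xi> \<in> D \<Longrightarrow> h \<xi> \<in> E \<and> B (h \<xi>) = A \<xi>" by metis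
  have injh: "inj_on h D" using h inj(1) by (metis inj_on_def)
  have rowsep: "\<xi> = \<xi>'" if x: "\<xi> \<in> D" "\<xi>' \<in> D" "fst \<xi> = fst \<xi>'" "snd (h \<xi>) = snd (h \<xi>')" for \<xi> \<xi>'
  proof -
    obtain k l where kl: "A \<xi> = Some k" "A \<xi>' = Some l" using x(1,2) dom(1) by blast
    have "k = l"
    proof (rule sep)
      show "A (fst \<xi>, snd \<xi>) = Some k" "A (fst \<xi>, snd \<xi>') = Some l"
        using kl x(3) by (metis prod.collapse)+
      show "B (fst (h \<xi>), snd (h \<xi>)) = Some k" "B (fst (h \<xi>'), snd (h \<xi>)) = Some l"
        using kl h[OF x(1)] h[OF x(2)] x(4) by (metis prod.collapse)+
    qed
    then show ?thesis using inj(1) kl x(1,2) by (metis inj_on_def)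
  qed
  define P where "P c = {\<xi> \<in> D. fst \<xi> < m \<and> snd (h \<xi>) = c}" for c
  define Q where "Q c = {\<eta> \<in> E. fst \<eta> < m \<and> snd \<eta> = c}" for c
  have "card (P c) \<le> card (Q c)" for c
  proof (cases "\<forall>i<m. (i, c) \<in> E")
    case True
    have "card (P c) \<le> card {..<m}"
    proof (rule card_inj_on_le[of fst])
      show "inj_on fst (P c)" by (rule inj_onI, rule rowsep) (simp_all add: P_def)
    qed (auto simp: P_def)
    also have "\<dots> = card ((\<lambda>i. (i, c)) ` {..<m})" by (rule card_image[symmetric]) (simp add: inj_on_def)
    also have "\<dots> \<le> card (Q c)" by (rule card_mono) (use True finE in \<open>auto simp: Q_def\<close>)
    finally show ?thesis .
  next
    case False
    then obtain i where i: "i < m" "(i, c) \<notin> E" by blast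
    have "r < m" if rc: "(r, c) \<in> E" for r
    proof (rule ccontr)
      assume "\<not> r < m"
      with i(1) have "i \<le> r" by simp
      with rc i(2) E show False unfolding young_diagram_def by blast
    qed
    note below = this
    have "h \<xi> \<in> Q c" if "\<xi> \<in> P c" for \<xi>
    proof -
      have e: "h \<xi> \<in> E" "snd (h \<xi>) = c" using that h by (auto simp: P_def)
      then have "(fst (h \<xi>), c) \<in> E" by (cases "h \<xi>") simp
      from below[OF this] e show ?thesis by (simp add: Q_def)
    qed
    then have "h ` P c \<subseteq> Q c" by blast
    moreover have "inj_on h (P c)" by (rule inj_on_subset[OF injh]) (auto simp: P_def)
    ultimately show ?thesis by (intro card_inj_on_le[of h]) (use finE in \<open>auto simp: Q_def\<close>)
  qed
  then have "(\<Sum>c\<in>snd ` E. card (P c)) \<le> (\<Sum>c\<in>snd ` E. card (Q c))" by (rule sum_mono)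
  moreover have "(\<Sum>c\<in>snd ` E. card (P c)) = card (\<Union>c\<in>snd ` E. P c)"
    by (rule card_UN_disjoint[symmetric]) (use D finE in \<open>auto simp: P_def\<close>)
  moreover have "(\<Union>c\<in>snd ` E. P c) = {\<xi> \<in> D. fst \<xi> < m}"
    using h by (auto simp: P_def image_iff)
  moreover have "(\<Sum>c\<in>snd ` E. card (Q c)) = card (\<Union>c\<in>snd ` E. Q c)"
    by (rule card_UN_disjoint[symmetric]) (use finE in \<open>auto simp: Q_def\<close>)
  moreover have "(\<Union>c\<in>snd ` E. Q c) = {\<eta> \<in> E. fst \<eta> < m}"
    by (force simp: Q_def)
  ultimately show ?thesis by simp
qed

text \<open>Some row symmetric \<open>g\<close>, for a tableau \<open>U\<close>, is compatible with \<open>f\<close>. The sign changes force \<open>U\<close> and \<open>Y\<close>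
  to have the same entries in each component. Entries in a common row of \<open>U\<close> and a common column of \<open>Y\<close>
  cannot exist: their transposition would fix \<open>g\<close> and negate \<open>f\<close>.\<close>

lemma shape_dominance:
  assumes lam: "lam \<in> P2 n" and mu: "mu \<in> P2 n" and Y: "Y \<in> Tab mu"
    and f: "f \<noteq> 0" "column_antisymmetric Y f" "f \<in> cvs.span {g. \<exists>U\<in>Tab lam. row_symmetric U g}"
  shows "card {\<xi> \<in> fst lam. fst \<xi> < m} \<le> card {\<xi> \<in> fst mu. fst \<xi> < m}"
    and "card {\<xi> \<in> snd lam. fst \<xi> < m} \<le> card {\<xi> \<in> snd mu. fst \<xi> < m}"
proof -
  note y = TabD[OF Y mu]
  obtain g U where U: "U \<in> Tab lam" "row_symmetric U g"
    and comp: "\<And>t. t \<in> carrier (W n) \<Longrightarrow> \<not> (W_act_rat t f = f \<and> W_act_rat t g = - g)"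
      "\<And>t. t \<in> carrier (W n) \<Longrightarrow> \<not> (W_act_rat t f = - f \<and> W_act_rat t g = g)"
    using compatible_summand[OF f(3,1), of n] by blast
  note u = TabD[OF U(1) lam]
  have sf: "\<And>k. k \<in> ran (fst Y) \<Longrightarrow> W_act_rat (sign_change k) f = - f" "\<And>k. k \<in> ran (snd Y) \<Longrightarrow> W_act_rat (sign_change k) f = f"
    using f(2) by (auto simp: column_antisymmetric_def sign_type_def)
  have sg: "\<And>k. k \<in> ran (fst U) \<Longrightarrow> W_act_rat (sign_change k) g = - g" "\<And>k. k \<in> ran (snd U) \<Longrightarrow> W_act_rat (sign_change k) g = g"
    using U(2) by (auto simp: row_symmetric_def sign_type_def)
  have 12: "k \<notin> ran (snd U)" if "k \<in> ran (fst Y)" for k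
  proof -
    have "k \<in> {1..n}" using that y(6) by blast
    from comp(2)[OF sign_change_W[OF this]] show ?thesis using sf(1)[OF that] sg(2) by blast
  qed
  have 21: "k \<notin> ran (fst U)" if "k \<in> ran (snd Y)" for k
  proof -
    have "k \<in> {1..n}" using that y(6) by blast
    from comp(1)[OF sign_change_W[OF this]] show ?thesis using sf(2)[OF that] sg(1) by blast
  qed
  have ran: "ran (fst U) = ran (fst Y)" "ran (snd U) = ran (snd Y)"
    using 12 21 u(5,6) y(5,6) by blast+
  have sep: "k = l"
    if "(A, B) = (fst U, fst Y) \<or> (A, B) = (snd U, snd Y)"
      "A (i, j) = Some k" "A (i, j') = Some l" "B (r, c) = Some k" "B (r', c) = Some l"
    for A B i j j' k l r r' c
  proof (rule ccontr)
    assume "k \<noteq> l"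
    have "k \<in> ran B" "l \<in> ran B" using that by (auto simp: ran_def)
    then have kl: "k \<in> {1..n}" "l \<in> {1..n}" using that(1) y(6) by auto
    have "W_act_rat (swap_elt k l) f = - f"
      using f(2) that(1,4,5) \<open>k \<noteq> l\<close> unfolding column_antisymmetric_def by blast
    moreover have "W_act_rat (swap_elt k l) g = g"
      using U(2) that(1,2,3) unfolding row_symmetric_def by blast
    ultimately show False using comp(2)[OF swap_elt_W[OF kl]] by blast
  qed
  have yd: "young_diagram (fst mu)" "young_diagram (snd mu)" using mu by (auto simp: P2_def)
  show "card {\<xi> \<in> fst lam. fst \<xi> < m} \<le> card {\<xi> \<in> fst mu. fst \<xi> < m}"
  proof (rule dominance[OF _ yd(1) u(1) y(1) _ _ ran(1)])
    show "finite (fst lam)" "inj_on (fst U) (fst lam)" "inj_on (fst Y) (fst mu)"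
      using u y by simp_all
  qed (use sep[of "fst U" "fst Y"] in blast)
  show "card {\<xi> \<in> snd lam. fst \<xi> < m} \<le> card {\<xi> \<in> snd mu. fst \<xi> < m}"
  proof (rule dominance[OF _ yd(2) u(2) y(2) _ _ ran(2)])
    show "finite (snd lam)" "inj_on (snd U) (snd lam)" "inj_on (snd Y) (snd mu)"
      using u y by simp_all
  qed (use sep[of "snd U" "snd Y"] in blast)
qed

section \<open>Finiteness of the index sets\<close>

lemma young_diagram_bounded:
  assumes "young_diagram D"
  shows "D \<subseteq> {..<card D} \<times> {..<card D}"
proof (clarify, intro conjI SigmaI)
  fix i j assume ij: "(i, j) \<in> D"
  have fin: "finite D" using assms by (simp add: young_diagram_def)
  have "(\<lambda>i. (i, j)) ` {..i} \<subseteq> D" "(\<lambda>j. (i, j)) ` {..j} \<subseteq> D"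
    using assms ij by (auto simp: young_diagram_def)
  from this[THEN card_mono[OF fin]] show "i \<in> {..<card D}" "j \<in> {..<card D}"
    by (simp_all add: card_image inj_on_def)
qed

lemma finite_P2: "finite (P2 n)"
proof (rule finite_subset)
  let ?B = "Pow ({..<n} \<times> {..<n})"
  show "P2 n \<subseteq> ?B \<times> ?B"
  proof
    fix lam assume lam: "lam \<in> P2 n"
    then have "fst lam \<subseteq> {..<card (fst lam)} \<times> {..<card (fst lam)}" "snd lam \<subseteq> {..<card (snd lam)} \<times> {..<card (snd lam)}"
      "card (fst lam) \<le> n" "card (snd lam) \<le> n"
      using young_diagram_bounded[of "fst lam"] young_diagram_bounded[of "snd lam"]
      by (simp_all add: P2_def case_prod_beta)
    then show "lam \<in> ?B \<times> ?B" by (cases lam) fastforce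
  qed
qed simp

lemma finite_Tab:
  assumes "lam \<in> P2 n"
  shows "finite (Tab lam)"
proof (rule finite_subset)
  have fin: "finite {f :: filling. dom f = D \<and> ran f \<subseteq> {1..n}}" if "finite D" for D
    using that by (intro finite_set_of_finite_maps) auto
  show "Tab lam \<subseteq> {f. dom f = fst lam \<and> ran f \<subseteq> {1..n}} \<times> {f. dom f = snd lam \<and> ran f \<subseteq> {1..n}}"
  proof
    fix T assume "T \<in> Tab lam"
    note t = TabD[OF this assms]
    have "ran (fst T) \<subseteq> {1..n}" "ran (snd T) \<subseteq> {1..n}" using t(6) by blast+
    with t(1,2) show "T \<in> {f. dom f = fst lam \<and> ran f \<subseteq> {1..n}} \<times> {f. dom f = snd lam \<and> ran f \<subseteq> {1..n}}"
      by (simp add: mem_Times_iff)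
  qed
  show "finite ({f :: filling. dom f = fst lam \<and> ran f \<subseteq> {1..n}} \<times> {f :: filling. dom f = snd lam \<and> ran f \<subseteq> {1..n}})"
    using assms by (intro finite_cartesian_product fin) (auto simp: P2_def young_diagram_def)
qed

lemma STab_Tab: "T \<in> STab lam \<Longrightarrow> T \<in> Tab lam"
  by (simp add: STab_def)

lemma finite_STab: "lam \<in> P2 n \<Longrightarrow> finite (STab lam)"
  using finite_Tab by (simp add: STab_def)

lemma finite_STabs: "finite (STabs n)"
  unfolding STabs_def using finite_P2 finite_STab by blast

lemma shape_unique: "T \<in> Tab lam \<Longrightarrow> T \<in> Tab mu \<Longrightarrow> lam = mu"
  by (auto simp: Tab_iff prod_eq_iff)

section \<open>Internal direct sums\<close>

lemma direct_sum_group: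
  assumes ds: "is_direct_sum N (\<Union>l\<in>L. I l) M" and L: "finite L"
    and disj: "\<And>l l'. l \<in> L \<Longrightarrow> l' \<in> L \<Longrightarrow> l \<noteq> l' \<Longrightarrow> I l \<inter> I l' = {}"
    and zero: "\<And>i. i \<in> (\<Union>l\<in>L. I l) \<Longrightarrow> 0 \<in> M i"
  shows "is_direct_sum N L (\<lambda>l. sum_of (I l) M)"
    and "\<forall>l\<in>L. is_direct_sum (sum_of (I l) M) (I l) M"
proof -
  let ?I = "\<Union>l\<in>L. I l"
  have fin: "finite ?I" and N: "N = sum_of ?I M"
    and indep: "\<And>m. \<forall>i\<in>?I. m i \<in> M i \<Longrightarrow> (\<Sum>i\<in>?I. m i) = 0 \<Longrightarrow> \<forall>i\<in>?I. m i = 0"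
    using ds by (auto simp: is_direct_sum_def)
  have fin': "finite (I l)" if "l \<in> L" for l using fin that by (rule_tac finite_subset[of _ ?I]) auto
  have split: "(\<Sum>i\<in>?I. m i) = (\<Sum>l\<in>L. \<Sum>i\<in>I l. m i)" for m :: "'b \<Rightarrow> 'a"
    by (rule sum.UNION_disjoint) (use L fin' disj in auto)
  \<comment> \<open>Representatives chosen separately in each block are assembled into one family.\<close>
  have assemble: "\<exists>m. (\<forall>i\<in>?I. m i \<in> M i) \<and> (\<forall>l\<in>L. s l = (\<Sum>i\<in>I l. m i))"
    if s: "\<forall>l\<in>L. s l \<in> sum_of (I l) M" for s
  proof -
    obtain k where k: "\<And>l. l \<in> L \<Longrightarrow> (\<forall>i\<in>I l. k l i \<in> M i) \<and> s l = (\<Sum>i\<in>I l. k l i)"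
      using s unfolding sum_of_def mem_Collect_eq by metis
    define b where "b i = (SOME l. l \<in> L \<and> i \<in> I l)" for i
    have b: "b i = l" if "l \<in> L" "i \<in> I l" for i l
    proof -
      have "b i \<in> L \<and> i \<in> I (b i)" unfolding b_def by (rule someI[of _ l]) (use that in blast)
      then show ?thesis using disj that by blast
    qed
    show ?thesis
    proof (intro exI[of _ "\<lambda>i. k (b i) i"] conjI ballI)
      show "k (b i) i \<in> M i" if "i \<in> ?I" for i using that k b by auto
      show "s l = (\<Sum>i\<in>I l. k (b i) i)" if "l \<in> L" for l using that k b by (auto intro!: sum.cong)
    qed
  qed
  show "is_direct_sum N L (\<lambda>l. sum_of (I l) M)"
    unfolding is_direct_sum_def
  proof (intro conjI allI impI)
    show "N = sum_of L (\<lambda>l. sum_of (I l) M)"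
    proof (intro equalityI subsetI)
      fix x assume "x \<in> N"
      then obtain m where "\<forall>i\<in>?I. m i \<in> M i" "x = (\<Sum>i\<in>?I. m i)" by (auto simp: N sum_of_def)
      then have "x = (\<Sum>l\<in>L. \<Sum>i\<in>I l. m i)" "\<forall>l\<in>L. (\<Sum>i\<in>I l. m i) \<in> sum_of (I l) M"
        by (simp add: split) (use \<open>\<forall>i\<in>?I. m i \<in> M i\<close> in \<open>auto simp: sum_of_def\<close>)
      then show "x \<in> sum_of L (\<lambda>l. sum_of (I l) M)"
        unfolding sum_of_def[of L] by (intro CollectI exI[of _ "\<lambda>l. \<Sum>i\<in>I l. m i"]) simp
    next
      fix x assume "x \<in> sum_of L (\<lambda>l. sum_of (I l) M)"
      then obtain s where s: "\<forall>l\<in>L. s l \<in> sum_of (I l) M" "x = (\<Sum>l\<in>L. s l)"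
        unfolding sum_of_def[of L] by blast
      from assemble[OF s(1)] obtain m where "\<forall>i\<in>?I. m i \<in> M i" "\<forall>l\<in>L. s l = (\<Sum>i\<in>I l. m i)" by blast
      then show "x \<in> N" unfolding N sum_of_def s(2) by (intro CollectI exI[of _ m]) (simp add: split)
    qed
    fix s assume s: "(\<forall>l\<in>L. s l \<in> sum_of (I l) M) \<and> sum s L = 0"
    then obtain m where m: "\<forall>i\<in>?I. m i \<in> M i" "\<forall>l\<in>L. s l = (\<Sum>i\<in>I l. m i)"
      using assemble by blast
    have "\<forall>i\<in>?I. m i = 0" by (rule indep[OF m(1)]) (use s m(2) in \<open>simp add: split\<close>)
    then show "\<forall>l\<in>L. s l = 0" using m(2) by (auto intro!: sum.neutral)
  qed (rule L)
  show "\<forall>l\<in>L. is_direct_sum (sum_of (I l) M) (I l) M"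
    unfolding is_direct_sum_def
  proof (intro ballI conjI allI impI)
    fix l m i assume l: "l \<in> L" and m: "(\<forall>i\<in>I l. m i \<in> M i) \<and> sum m (I l) = 0" and i: "i \<in> I l"
    let ?m = "\<lambda>i. if i \<in> I l then m i else 0"
    have "(\<Sum>i\<in>?I. ?m i) = (\<Sum>i\<in>I l. ?m i)"
      by (rule sum.mono_neutral_right) (use fin l in auto)
    then have 0: "(\<Sum>i\<in>?I. ?m i) = 0" using m by (simp cong: sum.cong)
    have "\<forall>i\<in>?I. ?m i \<in> M i" using m zero by auto
    from indep[OF this 0] have "\<forall>i\<in>?I. ?m i = 0" .
    then have "?m i = 0" using l i by blast
    then show "m i = 0" using i by simp
  qed (auto simp: fin')
qed

lemma ext_dsum_cong: "(\<And>i. i \<in> I \<Longrightarrow> M i = N i) \<Longrightarrow> ext_dsum I M = ext_dsum I N"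
  by (simp add: ext_dsum_def cong: ball_cong)

section \<open>The Peirce decomposition for a system of idempotents\<close>

lemma CW_act_mult:
  assumes "a \<in> carrier (CW n)" "b \<in> carrier (CW n)"
  shows "CW_act (a \<otimes>\<^bsub>CW n\<^esub> b) v = CW_act a (CW_act b v)"
  by (rule lin_act_mult[OF assms]) (use group_W[of n] in \<open>auto simp: group_def clinear_W_act_rat W_act_rat_mult\<close>)

lemma clinear_CW_act: "a \<in> carrier (CW n) \<Longrightarrow> clinear (CW_act a)"
  by (rule clinear_lin_act[OF clinear_W_act_rat]) auto

lemma CW_act_scalar: "CW_act (scalar (W n) c) v = cscale c v"
  using lin_act_single[of W_act_rat "\<one>\<^bsub>W n\<^esub>" c v] by (simp add: scalar_def W_act_rat_1)

definition group_elt :: "welt \<Rightarrow> welt \<Rightarrow> complex" where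
  "group_elt t = (\<lambda>w. if w = t then 1 else 0)"

lemma group_elt_closed: "t \<in> carrier (W n) \<Longrightarrow> group_elt t \<in> carrier (CW n)"
  by (auto simp: group_elt_def intro: finite_subset[of _ "{t}"])

lemma CW_act_group_elt: "CW_act (group_elt t) v = W_act_rat t v"
  by (simp add: group_elt_def)

locale idempotent_system =
  fixes n :: nat and e :: "tableau2 \<Rightarrow> welt \<Rightarrow> complex"
  assumes system: "tableau_idempotents n e"

sublocale idempotent_system \<subseteq> star_algebra "CW n" "scalar (W n)" "adjoint (W n)"
  by (rule star_algebra_group_algebra[OF group_W finite_W])

context idempotent_system
begin

abbreviation mult_CW (infixl "\<cdot>" 70) where
  "a \<cdot> b \<equiv> a \<otimes>\<^bsub>CW n\<^esub> b"

declare monoid_algebra_simps [simp del]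

lemma STabsI: "lam \<in> P2 n \<Longrightarrow> T \<in> STab lam \<Longrightarrow> T \<in> STabs n"
  by (auto simp: STabs_def)

lemma e_primitive: "T \<in> STabs n \<Longrightarrow> primitive_idempotent (CW n) (e T)"
  using system by (simp add: tableau_idempotents_def)

lemma e_closed [simp]: "T \<in> STabs n \<Longrightarrow> e T \<in> carrier (CW n)"
  and e_idem: "T \<in> STabs n \<Longrightarrow> e T \<cdot> e T = e T"
  and e_nonzero: "T \<in> STabs n \<Longrightarrow> e T \<noteq> \<zero>\<^bsub>CW n\<^esub>"
  using primitive_idempotentD[OF e_primitive] by blast+

lemma e_orth: "T \<in> STabs n \<Longrightarrow> U \<in> STabs n \<Longrightarrow> T \<noteq> U \<Longrightarrow> e T \<cdot> e U = \<zero>\<^bsub>CW n\<^esub>"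
  using system by (simp add: tableau_idempotents_def)

lemma act_zero [simp]: "CW_act \<zero>\<^bsub>CW n\<^esub> v = 0"
  by (simp add: monoid_algebra_simps)

lemma sum_e_act: "(\<Sum>T\<in>STabs n. CW_act (e T) v) = v"
proof -
  have mon: "monoid (W n)" using group_W[of n] by (simp add: group_def)
  have "\<one>\<^bsub>CW n\<^esub> = (\<lambda>z. \<Sum>T\<in>STabs n. e T z)"
    using system finsum_monoid_algebra[OF mon finite_STabs, of n e] by (simp add: tableau_idempotents_def)
  moreover have "CW_act (\<lambda>z. \<Sum>T\<in>STabs n. e T z) v = (\<Sum>T\<in>STabs n. CW_act (e T) v)"
    by (rule lin_act_sum[OF finite_STabs]) (use e_closed in \<open>auto simp: monoid_algebra_simps\<close>)
  moreover have "CW_act \<one>\<^bsub>CW n\<^esub> v = v" using CW_act_scalar[of n 1 v] by simp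
  ultimately show ?thesis by simp
qed

text \<open>Such a \<open>v\<close> is the image of \<open>e\<^sub>T\<close> under an isomorphism \<open>\<complex>[W] e\<^sub>T \<cong> V(\<lambda>)\<close>.\<close>

definition generates :: "diagram \<times> diagram \<Rightarrow> tableau2 \<Rightarrow> ratf \<Rightarrow> bool" where
  "generates lam T v \<longleftrightarrow> V lam = {CW_act a v | a. a \<in> carrier (CW n)} \<and> CW_act (e T) v = v \<and>
    (\<forall>a\<in>carrier (CW n). \<forall>b\<in>carrier (CW n).
      CW_act a v = CW_act b v \<longleftrightarrow> a \<cdot> e T = b \<cdot> e T)"

lemma generator_exists:
  assumes lam: "lam \<in> P2 n" and T: "T \<in> STab lam"
  obtains v where "generates lam T v"
proof -
  note TS = STabsI[OF lam T]
  let ?L = "{a \<cdot> e T | a. a \<in> carrier (CW n)}"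
  have "module_iso (CW n) ?L (mult (CW n)) (V lam) CW_act"
    using system lam T unfolding tableau_idempotents_def by blast
  then obtain \<phi> where \<phi>: "bij_betw \<phi> ?L (V lam) \<and> (\<forall>u\<in>?L. \<forall>v\<in>?L. \<phi> (u + v) = \<phi> u + \<phi> v) \<and>
      (\<forall>a\<in>carrier (CW n). \<forall>u\<in>?L. \<phi> (a \<cdot> u) = CW_act a (\<phi> u))"
    unfolding module_iso_def by (rule exE)
  have bij: "bij_betw \<phi> ?L (V lam)" using \<phi> by (rule conjunct1)
  have equi: "\<phi> (a \<cdot> u) = CW_act a (\<phi> u)" if "a \<in> carrier (CW n)" "u \<in> ?L" for a u
    by (rule bspec[OF bspec[OF conjunct2[OF conjunct2[OF \<phi>]] that(1)] that(2)])
  have eL: "e T \<in> ?L" using TS l_one[of "e T"] one_closed by force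
  have act: "CW_act a (\<phi> (e T)) = \<phi> (a \<cdot> e T)" if "a \<in> carrier (CW n)" for a
    using equi[OF that eL] by simp
  have "V lam = {CW_act a (\<phi> (e T)) | a. a \<in> carrier (CW n)}"
  proof (intro equalityI subsetI)
    fix f assume "f \<in> V lam"
    then obtain u where u: "u \<in> ?L" "f = \<phi> u" unfolding bij_betw_imp_surj_on[OF bij, symmetric] by (elim imageE)
    then obtain a where a: "a \<in> carrier (CW n)" "u = a \<cdot> e T" by blast
    show "f \<in> {CW_act a (\<phi> (e T)) | a. a \<in> carrier (CW n)}"
      by (intro CollectI exI[of _ a]) (simp add: act a u(2))
  next
    fix f assume "f \<in> {CW_act a (\<phi> (e T)) | a. a \<in> carrier (CW n)}"
    then obtain a where a: "a \<in> carrier (CW n)" "f = CW_act a (\<phi> (e T))" by blast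
    show "f \<in> V lam"
      unfolding a(2) act[OF a(1)] by (rule bij_betw_apply[OF bij]) (use a(1) in blast)
  qed
  moreover have "CW_act (e T) (\<phi> (e T)) = \<phi> (e T)"
    using act[of "e T"] TS by (simp add: e_idem)
  moreover have "CW_act a (\<phi> (e T)) = CW_act b (\<phi> (e T)) \<longleftrightarrow> a \<cdot> e T = b \<cdot> e T"
    if a: "a \<in> carrier (CW n)" and b: "b \<in> carrier (CW n)" for a b
  proof -
    have "a \<cdot> e T \<in> ?L" "b \<cdot> e T \<in> ?L" using a b by blast+
    from inj_on_eq_iff[OF bij_betw_imp_inj_on[OF bij] this] show ?thesis by (simp only: act[OF a] act[OF b])
  qed
  ultimately show ?thesis using that unfolding generates_def by blast
qed

lemma generatesD:
  assumes v: "generates lam T v" and lam: "lam \<in> P2 n" and T: "T \<in> STab lam"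
  shows "V lam = {CW_act a v | a. a \<in> carrier (CW n)}" "CW_act (e T) v = v"
    "a \<in> carrier (CW n) \<Longrightarrow> CW_act a v = 0 \<longleftrightarrow> a \<cdot> e T = \<zero>\<^bsub>CW n\<^esub>"
    "a \<in> carrier (CW n) \<Longrightarrow> b \<in> carrier (CW n) \<Longrightarrow>
      CW_act a v = CW_act b v \<longleftrightarrow> a \<cdot> e T = b \<cdot> e T"
    "v \<noteq> 0" "v \<in> V lam"
proof -
  note TS = STabsI[OF lam T]
  show 1: "V lam = {CW_act a v | a. a \<in> carrier (CW n)}" and 2: "CW_act (e T) v = v"
    using v by (simp_all only: generates_def)
  show eq: "CW_act a v = CW_act b v \<longleftrightarrow> a \<cdot> e T = b \<cdot> e T"
    if "a \<in> carrier (CW n)" "b \<in> carrier (CW n)" for a b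
    using v that by (simp only: generates_def)
  show zero: "CW_act a v = 0 \<longleftrightarrow> a \<cdot> e T = \<zero>\<^bsub>CW n\<^esub>" if "a \<in> carrier (CW n)" for a
    using eq[OF that zero_closed] TS by simp
  show "v \<noteq> 0"
    using 2 zero[OF e_closed[OF TS]] e_nonzero[OF TS] by (auto simp: e_idem[OF TS])
  show "v \<in> V lam"
    unfolding 1 using 2 e_closed[OF TS] by (intro CollectI exI[of _ "e T"]) simp
qed

text \<open>Both left ideals are isomorphic to \<open>V(\<lambda>)\<close>, which yields a nonzero element of \<open>e\<^sub>T \<complex>[W] e\<^sub>U\<close>.\<close>

lemma same_shape_intertwiners:
  assumes lam: "lam \<in> P2 n" and T: "T \<in> STab lam" and U: "U \<in> STab lam"
  shows "\<exists>a\<in>carrier (CW n). \<exists>b\<in>carrier (CW n). e T \<cdot> a = a \<and> a \<cdot> e U = a \<and>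
    e U \<cdot> b = b \<and> b \<cdot> e T = b \<and> a \<cdot> b = e T \<and> b \<cdot> a = e U"
proof -
  note TS = STabsI[OF lam T] and US = STabsI[OF lam U]
  obtain v where "generates lam T v" by (rule generator_exists[OF lam T])
  note v = generatesD[OF this lam T]
  obtain w where "generates lam U w" by (rule generator_exists[OF lam U])
  note w = generatesD[OF this lam U]
  obtain x where x: "x \<in> carrier (CW n)" "v = CW_act x w" using v(6) unfolding w(1) by blast
  define z where "z = e T \<cdot> x \<cdot> e U"
  have zc: "z \<in> carrier (CW n)" using x TS US by (simp add: z_def)
  have "CW_act z w = v"
    using x TS US v(2) w(2) by (simp add: z_def CW_act_mult)
  then have "z \<noteq> \<zero>\<^bsub>CW n\<^esub>" using v(5) by (metis act_zero)
  moreover have "e T \<cdot> z = z" "z \<cdot> e U = z"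
    using x TS US by (simp_all add: z_def m_assoc e_idem) (simp add: m_assoc[symmetric] e_idem)
  ultimately show ?thesis
    using primitive_hom_invertible[OF e_primitive[OF US] e_primitive[OF TS] zc] zc by metis
qed

text \<open>An isomorphism \<open>V(\<mu>) \<rightarrow> V(\<lambda>)\<close> sends \<open>F\<^sub>Y\<close> to a nonzero vector that is still antisymmetric in the columns
  of \<open>Y\<close>, while \<open>V(\<lambda>)\<close> is spanned by vectors that are symmetric in the rows of tableaux of shape \<open>\<lambda>\<close>.\<close>

lemma isomorphic_shape_dominance:
  assumes lam: "lam \<in> P2 n" and T: "T \<in> STab lam" and mu: "mu \<in> P2 n" and U: "U \<in> STab mu"
    and a: "a \<in> carrier (CW n)" "e U \<cdot> a = a" "a \<cdot> e T = a"
    and b: "b \<in> carrier (CW n)" "a \<cdot> b = e U"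
  shows "card {\<xi> \<in> fst lam. fst \<xi> < m} \<le> card {\<xi> \<in> fst mu. fst \<xi> < m}"
    and "card {\<xi> \<in> snd lam. fst \<xi> < m} \<le> card {\<xi> \<in> snd mu. fst \<xi> < m}"
proof -
  note TS = STabsI[OF lam T] and US = STabsI[OF mu U]
  obtain v where "generates lam T v" by (rule generator_exists[OF lam T])
  note v = generatesD[OF this lam T]
  obtain w where "generates mu U w" by (rule generator_exists[OF mu U])
  note w = generatesD[OF this mu U]
  define S0 where "S0 = (SOME S. S \<in> STab mu)"
  have S0: "S0 \<in> STab mu" unfolding S0_def using U by (rule someI)
  define S1 where "S1 = (SOME S. S \<in> STab lam)"
  have S1: "S1 \<in> STab lam" unfolding S1_def using T by (rule someI)
  obtain c where c: "w = (\<Sum>Y\<in>Tab mu. cscale (c Y) (F Y S0))"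
    using w(6) unfolding V_def V_S_def S0_def by blast
  have "\<exists>Y\<in>Tab mu. F Y S0 \<noteq> 0"
  proof (rule ccontr)
    assume "\<not> ?thesis"
    then have "w = 0" unfolding c by (intro sum.neutral) auto
    with w(5) show False by simp
  qed
  then obtain Y where Y: "Y \<in> Tab mu" "F Y S0 \<noteq> 0" by blast
  have "F Y S0 = (\<Sum>Z\<in>Tab mu. if Z = Y then F Z S0 else 0)"
    using Y(1) finite_Tab[OF mu] by simp
  also have "\<dots> = (\<Sum>Z\<in>Tab mu. cscale (if Z = Y then 1 else 0) (F Z S0))"
    by (intro sum.cong) auto
  finally have "F Y S0 \<in> V mu"
    unfolding V_def V_S_def S0_def[symmetric] by (intro CollectI exI[of _ "\<lambda>Z. if Z = Y then 1 else 0"]) simp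
  then obtain x where x: "x \<in> carrier (CW n)" "F Y S0 = CW_act x w" unfolding w(1) by blast
  define f where "f = CW_act (x \<cdot> a) v"
  have f0: "f \<noteq> 0"
  proof
    assume "f = 0"
    then have "x \<cdot> a = \<zero>\<^bsub>CW n\<^esub>"
      using v(3)[of "x \<cdot> a"] x(1) a TS by (simp add: f_def m_assoc)
    then have "x \<cdot> a \<cdot> b = \<zero>\<^bsub>CW n\<^esub>" using b(1) by simp
    then have "x \<cdot> e U = \<zero>\<^bsub>CW n\<^esub>" using x(1) a(1) b by (simp add: m_assoc)
    then show False using w(3)[OF x(1)] x(2) Y(2) by simp
  qed
  have transfer: "W_act_rat t f = cscale \<delta> f"
    if t: "t \<in> carrier (W n)" and F: "W_act_rat t (F Y S0) = cscale \<delta> (F Y S0)" for t \<delta>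
  proof -
    let ?t = "group_elt t" and ?d = "scalar (W n) \<delta>"
    have tc: "?t \<in> carrier (CW n)" using group_elt_closed[OF t] .
    have "CW_act (?t \<cdot> x) w = CW_act (?d \<cdot> x) w"
      using F tc x by (simp add: CW_act_mult CW_act_group_elt CW_act_scalar)
    then have "?t \<cdot> x \<cdot> e U = ?d \<cdot> x \<cdot> e U"
      using w(4) tc x(1) by simp
    then have "?t \<cdot> x \<cdot> (e U \<cdot> a) = ?d \<cdot> x \<cdot> (e U \<cdot> a)"
      using tc x(1) a(1) US by (simp add: m_assoc[symmetric])
    then have "?t \<cdot> (x \<cdot> a) = ?d \<cdot> (x \<cdot> a)"
      using tc x(1) a(1,2) by (simp add: m_assoc)
    from arg_cong[OF this, of "\<lambda>z. CW_act z v"] show ?thesis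
      using CW_act_mult[OF tc m_closed[OF x(1) a(1)]] CW_act_mult[OF sc_closed m_closed[OF x(1) a(1)]]
      by (simp add: CW_act_group_elt CW_act_scalar f_def)
  qed
  have "column_antisymmetric Y f"
  proof -
    note y = TabD[OF Y(1) mu]
    have ca: "column_antisymmetric Y (F Y S0)" by (rule column_antisymmetric_F[OF Y(1) STab_Tab[OF S0] mu])
    have neg: "W_act_rat t f = - f" if "t \<in> carrier (W n)" "W_act_rat t (F Y S0) = - F Y S0" for t
      using transfer[of t "- 1"] that by simp
    have pos: "W_act_rat t f = f" if "t \<in> carrier (W n)" "W_act_rat t (F Y S0) = F Y S0" for t
      using transfer[of t 1] that by simp
    have "sign_type Y f"
      using ca y(6) unfolding column_antisymmetric_def sign_type_def by (blast intro: neg pos sign_change_W)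
    moreover have "W_act_rat (swap_elt k l) f = - f"
      if h: "A \<in> {fst Y, snd Y}" "A (i, j) = Some k" "A (i', j) = Some l" "k \<noteq> l" for A i i' j k l
    proof (rule neg[OF swap_elt_W])
      have "k \<in> ran A" "l \<in> ran A" using h by (auto simp: ran_def)
      then show "k \<in> {1..n}" "l \<in> {1..n}" using h(1) y(6) by auto
      show "W_act_rat (swap_elt k l) (F Y S0) = - F Y S0"
        using ca h unfolding column_antisymmetric_def by blast
    qed
    ultimately show ?thesis unfolding column_antisymmetric_def by blast
  qed
  moreover have "f \<in> V lam" unfolding v(1) f_def using x(1) a(1) by blast
  then obtain d where "f = (\<Sum>Z\<in>Tab lam. cscale (d Z) (F Z S1))"
    unfolding V_def V_S_def S1_def by blast
  then have "f \<in> cvs.span {g. \<exists>U\<in>Tab lam. row_symmetric U g}"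
    by (simp only:) (intro cvs.span_sum cvs.span_scale F_in_span_row_symmetric[OF _ STab_Tab[OF S1] lam])
  ultimately show "card {\<xi> \<in> fst lam. fst \<xi> < m} \<le> card {\<xi> \<in> fst mu. fst \<xi> < m}"
    and "card {\<xi> \<in> snd lam. fst \<xi> < m} \<le> card {\<xi> \<in> snd mu. fst \<xi> < m}"
    using shape_dominance[OF lam mu Y(1) f0] by blast+
qed

text \<open>A nonzero \<open>z\<close> induces isomorphisms in both directions, so each shape dominates the other.\<close>

lemma corner_nonzero_same_shape:
  assumes lam: "lam \<in> P2 n" and T: "T \<in> STab lam" and mu: "mu \<in> P2 n" and U: "U \<in> STab mu"
    and z: "z \<in> carrier (CW n)" "e U \<cdot> z = z" "z \<cdot> e T = z" "z \<noteq> \<zero>\<^bsub>CW n\<^esub>"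
  shows "lam = mu"
proof -
  note TS = STabsI[OF lam T] and US = STabsI[OF mu U]
  obtain b where b: "b \<in> carrier (CW n)" "e T \<cdot> b = b" "b \<cdot> e U = b"
      "z \<cdot> b = e U" "b \<cdot> z = e T"
    using primitive_hom_invertible[OF e_primitive[OF TS] e_primitive[OF US] z] by blast
  note le = isomorphic_shape_dominance[OF lam T mu U z(1,2,3) b(1,4)]
  note ge = isomorphic_shape_dominance[OF mu U lam T b(1,2,3) z(1) b(5)]
  have yd: "young_diagram (fst lam)" "young_diagram (snd lam)" "young_diagram (fst mu)" "young_diagram (snd mu)"
    using lam mu by (auto simp: P2_def)
  have "fst lam = fst mu" by (rule young_diagram_eq_if_row_counts[OF yd(1,3)]) (rule antisym[OF le(1) ge(1)])
  moreover have "snd lam = snd mu" by (rule young_diagram_eq_if_row_counts[OF yd(2,4)]) (rule antisym[OF le(2) ge(2)])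
  ultimately show ?thesis by (simp add: prod_eq_iff)
qed

text \<open>As \<open>V(\<lambda>) \<cong> \<complex>[W] e\<^sub>T\<close>, the component \<open>e\<^sub>U V(\<lambda>)\<close> is isomorphic to \<open>e\<^sub>U \<complex>[W] e\<^sub>T\<close>. This is a line if \<open>U\<close> has
  shape \<open>\<lambda>\<close> and zero otherwise, so \<open>V(\<lambda>)\<close> has a basis indexed by the standard tableaux of shape \<open>\<lambda>\<close>.\<close>

lemma f_dim_eq_card_STab:
  assumes lam: "lam \<in> P2 n" and T: "T \<in> STab lam"
  shows "f_dim lam = card (STab lam)"
proof -
  note TS = STabsI[OF lam T]
  obtain v where "generates lam T v" by (rule generator_exists[OF lam T])
  note v = generatesD[OF this lam T]
  note v0 = v(5)
  obtain a b where ab: "\<And>U. U \<in> STab lam \<Longrightarrow> a U \<in> carrier (CW n) \<and> b U \<in> carrier (CW n) \<and>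
      e U \<cdot> a U = a U \<and> a U \<cdot> e T = a U \<and> e T \<cdot> b U = b U \<and> b U \<cdot> e U = b U \<and>
      a U \<cdot> b U = e U \<and> b U \<cdot> a U = e T"
    using same_shape_intertwiners[OF lam _ T] by metis
  have US: "U \<in> STabs n" if "U \<in> STab lam" for U using STabsI[OF lam that] .
  define vec where "vec U = CW_act (a U) v" for U
  have dual: "CW_act (b U) (vec U') = (if U = U' then v else 0)" if "U \<in> STab lam" "U' \<in> STab lam" for U U'
  proof -
    have "CW_act (b U) (vec U') = CW_act (b U \<cdot> a U') v"
      using ab that by (simp add: vec_def CW_act_mult)
    moreover have "b U \<cdot> a U' = \<zero>\<^bsub>CW n\<^esub>" if ne: "U \<noteq> U'"
    proof -
      note u = ab[OF \<open>U \<in> STab lam\<close>] and u' = ab[OF \<open>U' \<in> STab lam\<close>]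
      have "b U \<cdot> a U' = (b U \<cdot> e U) \<cdot> (e U' \<cdot> a U')"
        using u u' by simp
      also have "\<dots> = b U \<cdot> ((e U \<cdot> e U') \<cdot> a U')"
        using conjunct1[OF u] conjunct1[OF conjunct2[OF u]] conjunct1[OF u'] US that(1) \<open>U' \<in> STab lam\<close> \<open>U \<in> STab lam\<close>
        by (simp only: m_assoc m_closed e_closed)
      finally show ?thesis
        using u u' e_orth[OF US[OF \<open>U \<in> STab lam\<close>] US[OF \<open>U' \<in> STab lam\<close>] ne] by simp
    qed
    ultimately show ?thesis using ab that v(2) by auto
  qed
  have inj: "inj_on vec (STab lam)"
    by (rule inj_onI) (metis dual v0)
  have "cvs.dim (V lam) = card (STab lam)"
  proof (rule cvs.dim_unique[of "vec ` STab lam"])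
    show "vec ` STab lam \<subseteq> V lam" unfolding v(1) vec_def using ab by blast
    show "card (vec ` STab lam) = card (STab lam)" by (rule card_image[OF inj])
    show "cvs.independent (vec ` STab lam)"
    proof
      assume "cvs.dependent (vec ` STab lam)"
      then obtain u where u: "\<exists>x\<in>vec ` STab lam. u x \<noteq> 0" "(\<Sum>x\<in>vec ` STab lam. cscale (u x) x) = 0"
        using cvs.dependent_finite[of "vec ` STab lam"] finite_STab[OF lam] by auto
      then obtain U where U: "U \<in> STab lam" "u (vec U) \<noteq> 0" by blast
      have bU: "b U \<in> carrier (CW n)" using ab[OF U(1)] by blast
      have "0 = CW_act (b U) (\<Sum>U'\<in>STab lam. cscale (u (vec U')) (vec U'))"
        using u(2) unfolding sum.reindex[OF inj] by (simp add: clinearD(3)[OF clinear_CW_act[OF bU]])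
      also have "\<dots> = (\<Sum>U'\<in>STab lam. cscale (u (vec U')) (CW_act (b U) (vec U')))"
        by (simp add: clinearD(6,2)[OF clinear_CW_act[OF bU]])
      also have "\<dots> = (\<Sum>U'\<in>STab lam. if U = U' then cscale (u (vec U')) v else 0)"
        by (intro sum.cong refl) (simp add: dual[OF U(1)])
      also have "\<dots> = cscale (u (vec U)) v" using U(1) finite_STab[OF lam] by simp
      finally show False using U(2) v0 by simp
    qed
    show "V lam \<subseteq> cvs.span (vec ` STab lam)"
    proof
      fix y assume "y \<in> V lam"
      then obtain x where x: "x \<in> carrier (CW n)" "y = CW_act x v" unfolding v(1) by blast
      have "CW_act (e U) y \<in> cvs.span (vec ` STab lam)" if U: "U \<in> STabs n" for U
      proof -
        define z where "z = e U \<cdot> x \<cdot> e T"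
        have z: "z \<in> carrier (CW n)" "e U \<cdot> z = z" "z \<cdot> e T = z"
          using x(1) U TS by (simp_all add: z_def m_assoc e_idem) (simp add: m_assoc[symmetric] e_idem)
        have zy: "CW_act (e U) y = CW_act z v"
          using x U TS v(2) by (simp add: z_def CW_act_mult)
        show ?thesis
        proof (cases "z = \<zero>\<^bsub>CW n\<^esub>")
          case True
          then show ?thesis by (simp only: zy act_zero cvs.span_zero)
        next
          case False
          obtain mu where mu: "mu \<in> P2 n" "U \<in> STab mu" using U by (auto simp: STabs_def)
          have "U \<in> STab lam" using corner_nonzero_same_shape[OF lam T mu z False] mu(2) by simp
          note u = ab[OF this]
          obtain c where c: "b U \<cdot> z = scalar (W n) c \<cdot> e T"
          proof -
            have "b U \<cdot> z \<in> carrier (CW n)" "e T \<cdot> (b U \<cdot> z) = b U \<cdot> z"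
                "b U \<cdot> z \<cdot> e T = b U \<cdot> z"
              using u z TS by (simp_all add: m_assoc) (simp add: m_assoc[symmetric])
            from primitive_corner_scalar[OF e_primitive[OF TS] this] show ?thesis using that by blast
          qed
          have "z = a U \<cdot> (b U \<cdot> z)" using u z by (simp add: m_assoc[symmetric])
          then have "CW_act z v = CW_act (a U) (CW_act (scalar (W n) c \<cdot> e T) v)"
            using u TS by (metis CW_act_mult c m_closed sc_closed)
          also have "\<dots> = cscale c (vec U)"
            using u TS v(2) by (simp add: CW_act_mult CW_act_scalar vec_def clinearD(2)[OF clinear_CW_act[where n = n]])
          finally show ?thesis using \<open>U \<in> STab lam\<close>
            by (simp only: zy) (intro cvs.span_scale cvs.span_base imageI)
        qed
      qed
      then have "(\<Sum>U\<in>STabs n. CW_act (e U) y) \<in> cvs.span (vec ` STab lam)" by (intro cvs.span_sum)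
      then show "y \<in> cvs.span (vec ` STab lam)" by (simp only: sum_e_act)
    qed
  qed
  then show ?thesis by (simp add: f_dim_def)
qed

section \<open>The decomposition of the polynomial module\<close>

lemma OX_direct_sum: "is_direct_sum (OX n) (STabs n) (\<lambda>T. CW_act (e T) ` OX n)"
  unfolding is_direct_sum_def
proof (intro conjI allI impI)
  show "OX n = sum_of (STabs n) (\<lambda>T. CW_act (e T) ` OX n)"
  proof (intro equalityI subsetI)
    fix f assume "f \<in> OX n"
    then show "f \<in> sum_of (STabs n) (\<lambda>T. CW_act (e T) ` OX n)"
      unfolding sum_of_def by (intro CollectI exI[of _ "\<lambda>T. CW_act (e T) f"]) (simp add: sum_e_act)
  next
    fix f assume "f \<in> sum_of (STabs n) (\<lambda>T. CW_act (e T) ` OX n)"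
    then obtain m where "f = (\<Sum>T\<in>STabs n. m T)" "\<forall>T\<in>STabs n. m T \<in> CW_act (e T) ` OX n"
      by (auto simp: sum_of_def)
    moreover have "m T \<in> OX n" if "T \<in> STabs n" for T
      using calculation(2) that OX_CW_act[OF e_closed[OF that]] by auto
    ultimately show "f \<in> OX n" using OX_sum by blast
  qed
  fix m assume m: "(\<forall>T\<in>STabs n. m T \<in> CW_act (e T) ` OX n) \<and> sum m (STabs n) = 0"
  show "\<forall>T\<in>STabs n. m T = 0"
  proof
    fix T assume T: "T \<in> STabs n"
    have "CW_act (e T) (m U) = (if U = T then m U else 0)" if U: "U \<in> STabs n" for U
    proof -
      obtain g where "m U = CW_act (e U) g" using m U by blast
      then show ?thesis
        using CW_act_mult[OF e_closed[OF T] e_closed[OF U], of g] e_idem[OF T] e_orth[OF T U] by auto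
    qed
    then have "(\<Sum>U\<in>STabs n. CW_act (e T) (m U)) = (\<Sum>U\<in>STabs n. if U = T then m U else 0)"
      by (intro sum.cong) auto
    also have "\<dots> = m T" using T finite_STabs by simp
    finally show "m T = 0"
      using m clinearD(3,6)[OF clinear_CW_act[OF e_closed[OF T]]] by metis
  qed
qed (rule finite_STabs)

text \<open>For \<open>T\<close> of shape \<open>\<lambda>\<close> an invertible element of \<open>e\<^sub>T\<^sub>* \<complex>[W] e\<^sub>T\<close> carries \<open>e\<^sub>T \<O>\<^sub>X\<close> isomorphically to \<open>e\<^sub>T\<^sub>* \<O>\<^sub>X\<close> and
  commutes with all differential operators. The pairs \<open>(\<lambda>, k)\<close> with \<open>k < f\<^sup>\<lambda>\<close> number the standard tableaux.\<close>

lemma OX_module_iso: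
  assumes Tstar: "\<And>lam. lam \<in> P2 n \<Longrightarrow> Tstar lam \<in> STab lam"
  shows "module_iso (DY n) (OX n) (DY_act n)
    (ext_dsum (SIGMA lam : P2 n. {..<f_dim lam}) (\<lambda>(lam, k). CW_act (e (Tstar lam)) ` OX n))
    (ext_dsum_act (DY_act n))"
proof -
  let ?I = "SIGMA lam : P2 n. {..<f_dim lam}"
  let ?N = "ext_dsum ?I (\<lambda>(lam, k). CW_act (e (Tstar lam)) ` OX n)"
  have finI: "finite ?I" using finite_P2 by simp
  have "\<exists>h. bij_betw h {..<f_dim lam} (STab lam)" if "lam \<in> P2 n" for lam
    using ex_bij_betw_nat_finite[OF finite_STab[OF that]] f_dim_eq_card_STab[OF that Tstar[OF that]]
    by (simp add: atLeast0LessThan)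
  then obtain h where h: "\<And>lam. lam \<in> P2 n \<Longrightarrow> bij_betw (h lam) {..<f_dim lam} (STab lam)" by metis
  define t where "t p = h (fst p) (snd p)" for p
  have tS: "t p \<in> STab (fst p)" "fst p \<in> P2 n" if "p \<in> ?I" for p
  proof -
    obtain lam k where p: "p = (lam, k)" by (cases p)
    show "t p \<in> STab (fst p)" "fst p \<in> P2 n"
      using that bij_betwE[OF h[of lam]] by (simp_all add: p t_def)
  qed
  have t_inj: "inj_on t ?I"
  proof (rule inj_onI)
    fix p q assume pq: "p \<in> ?I" "q \<in> ?I" "t p = t q"
    then have "fst p = fst q" using tS shape_unique STab_Tab by metis
    moreover have "snd p = snd q"
      using pq h[of "fst q"] \<open>fst p = fst q\<close> by (auto simp: t_def bij_betw_def inj_on_def)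
    ultimately show "p = q" by (simp add: prod_eq_iff)
  qed
  have t_bij: "bij_betw t ?I (STabs n)"
    unfolding bij_betw_def
  proof (intro conjI t_inj equalityI subsetI)
    fix T assume "T \<in> STabs n"
    then obtain lam where lam: "lam \<in> P2 n" "T \<in> STab lam" by (auto simp: STabs_def)
    then obtain k where "k < f_dim lam" "T = h lam k" using h[OF lam(1)] by (auto simp: bij_betw_def)
    then show "T \<in> t ` ?I" using lam(1) by (intro image_eqI[of _ _ "(lam, k)"]) (auto simp: t_def)
  qed (use tS STabsI in blast)
  define s where "s p = Tstar (fst p)" for p :: "(diagram \<times> diagram) \<times> nat"
  have sS: "s p \<in> STab (fst p)" if "p \<in> ?I" for p using Tstar tS(2)[OF that] by (simp add: s_def)
  have tN: "t p \<in> STabs n" "s p \<in> STabs n" if "p \<in> ?I" for p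
    using STabsI[OF tS(2)[OF that]] tS(1)[OF that] sS[OF that] by blast+
  have N: "g \<in> ?N \<longleftrightarrow> (\<forall>p\<in>?I. g p \<in> CW_act (e (s p)) ` OX n) \<and> (\<forall>p. p \<notin> ?I \<longrightarrow> g p = 0)" for g
  proof -
    have "finite {p. g p \<noteq> 0}" if "\<forall>p. p \<notin> ?I \<longrightarrow> g p = 0"
      by (rule finite_subset[OF _ finI]) (use that in auto)
    then show ?thesis by (auto simp: ext_dsum_def s_def case_prod_beta)
  qed
  obtain a b where ab: "\<And>p. p \<in> ?I \<Longrightarrow> a p \<in> carrier (CW n) \<and> b p \<in> carrier (CW n) \<and>
      e (t p) \<cdot> a p = a p \<and> a p \<cdot> e (s p) = a p \<and> e (s p) \<cdot> b p = b p \<and>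
      b p \<cdot> e (t p) = b p \<and> a p \<cdot> b p = e (t p) \<and> b p \<cdot> a p = e (s p)"
    using same_shape_intertwiners[OF tS(2) tS(1) sS] by metis
  have cl: "a p \<in> carrier (CW n)" "b p \<in> carrier (CW n)" if "p \<in> ?I" for p
    using ab[OF that] by simp_all
  have act: "CW_act (a p) (CW_act (b p) u) = CW_act (e (t p)) u"
      "CW_act (b p) (CW_act (a p) u) = CW_act (e (s p)) u"
      "CW_act (e (t p)) (CW_act (a p) u) = CW_act (a p) u"
      "CW_act (b p) (CW_act (e (t p)) u) = CW_act (b p) u"
      "CW_act (e (s p)) (CW_act (b p) u) = CW_act (b p) u"
      "CW_act (e (s p)) (CW_act (e (s p)) u) = CW_act (e (s p)) u" if p: "p \<in> ?I" for p u
    using ab[OF p] CW_act_mult[OF cl(1)[OF p] cl(2)[OF p], of u] CW_act_mult[OF cl(2)[OF p] cl(1)[OF p], of u]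
      CW_act_mult[OF e_closed[OF tN(1)[OF p]] cl(1)[OF p], of u]
      CW_act_mult[OF cl(2)[OF p] e_closed[OF tN(1)[OF p]], of u]
      CW_act_mult[OF e_closed[OF tN(2)[OF p]] cl(2)[OF p], of u]
      CW_act_mult[OF e_closed[OF tN(2)[OF p]] e_closed[OF tN(2)[OF p]], of u] e_idem[OF tN(2)[OF p]]
    by simp_all
  define \<phi> where "\<phi> u = (\<lambda>p. if p \<in> ?I then CW_act (b p) u else 0)" for u
  define \<psi> where "\<psi> g = (\<Sum>p\<in>?I. CW_act (a p) (g p))" for g
  have "bij_betw \<phi> (OX n) ?N"
  proof (rule bij_betw_byWitness[where f' = \<psi>])
    show "\<forall>u\<in>OX n. \<psi> (\<phi> u) = u"
    proof
      fix u
      have "\<psi> (\<phi> u) = (\<Sum>p\<in>?I. CW_act (e (t p)) u)"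
        unfolding \<psi>_def \<phi>_def by (intro sum.cong refl) (simp add: act(1))
      also have "\<dots> = (\<Sum>T\<in>STabs n. CW_act (e T) u)"
        by (rule sum.reindex_bij_betw[OF t_bij])
      finally show "\<psi> (\<phi> u) = u" by (simp only: sum_e_act)
    qed
    show "\<forall>g\<in>?N. \<phi> (\<psi> g) = g"
    proof (intro ballI ext)
      fix g p assume g: "g \<in> ?N"
      have gI: "g p \<in> CW_act (e (s p)) ` OX n" if "p \<in> ?I"
        by (rule bspec[OF conjunct1[OF iffD1[OF N g]] that])
      have gO: "g p = 0" if "p \<notin> ?I"
        by (rule mp[OF spec[OF conjunct2[OF iffD1[OF N g]]] that])
      show "\<phi> (\<psi> g) p = g p"
      proof (cases "p \<in> ?I")
        case False
        then show ?thesis by (simp only: gO[OF False] \<phi>_def if_False)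
      next
        case p: True
        have "\<phi> (\<psi> g) p = (\<Sum>q\<in>?I. CW_act (b p) (CW_act (a q) (g q)))"
          using p by (simp only: \<phi>_def \<psi>_def if_True clinearD(6)[OF clinear_CW_act[OF cl(2)[OF p]]])
        also have "\<dots> = (\<Sum>q\<in>?I. if q = p then g q else 0)"
        proof (intro sum.cong refl)
          fix q assume q: "q \<in> ?I"
          show "CW_act (b p) (CW_act (a q) (g q)) = (if q = p then g q else 0)"
          proof (cases "q = p")
            case True
            obtain f where f: "g p = CW_act (e (s p)) f" using gI p by blast
            have "CW_act (b p) (CW_act (a p) (g p)) = CW_act (e (s p)) (g p)"
              by (rule act(2)[OF p])
            also have "\<dots> = g p" unfolding f by (rule act(6)[OF p])
            finally show ?thesis using True by simp
          next
            case False
            then have ne: "t p \<noteq> t q" using t_inj p q by (auto simp: inj_on_def)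
            have "CW_act (b p) (CW_act (a q) (g q)) =
                CW_act (b p) (CW_act (e (t p)) (CW_act (e (t q)) (CW_act (a q) (g q))))"
              by (simp only: act(3)[OF q] act(4)[OF p])
            also have "CW_act (e (t p)) (CW_act (e (t q)) w) = 0" for w
              using CW_act_mult[OF e_closed[OF tN(1)[OF p]] e_closed[OF tN(1)[OF q]], of w]
                e_orth[OF tN(1)[OF p] tN(1)[OF q] ne] by simp
            finally show ?thesis using False by (simp add: clinearD(3)[OF clinear_CW_act[OF cl(2)[OF p]]])
          qed
        qed
        also have "\<dots> = g p" using p finI by simp
        finally show ?thesis .
      qed
    qed
    show "\<phi> ` OX n \<subseteq> ?N"
    proof
      fix g assume "g \<in> \<phi> ` OX n"
      then obtain u where u: "u \<in> OX n" "g = \<phi> u" by blast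
      have "CW_act (b p) u \<in> CW_act (e (s p)) ` OX n" if p: "p \<in> ?I" for p
      proof (rule image_eqI)
        show "CW_act (b p) u = CW_act (e (s p)) (CW_act (b p) u)"
          by (rule act(5)[OF p, symmetric])
        show "CW_act (b p) u \<in> OX n" by (rule OX_CW_act[OF cl(2)[OF p] u(1)])
      qed
      then show "g \<in> ?N"
        unfolding N u(2) \<phi>_def by (intro conjI ballI allI impI) (simp_all only: if_True if_False)
    qed
    show "\<psi> ` ?N \<subseteq> OX n"
    proof
      fix u assume "u \<in> \<psi> ` ?N"
      then obtain g where g: "g \<in> ?N" "u = \<psi> g" by blast
      have "g p \<in> OX n" if p: "p \<in> ?I" for p
      proof -
        from bspec[OF conjunct1[OF iffD1[OF N g(1)]] p]
        obtain f where "g p = CW_act (e (s p)) f" "f \<in> OX n" by (rule imageE)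
        then show ?thesis by (simp only: OX_CW_act[OF e_closed[OF tN(2)[OF p]]])
      qed
      then show "u \<in> OX n" unfolding g(2) \<psi>_def by (intro OX_sum OX_CW_act cl)
    qed
  qed
  moreover have "\<phi> (u + v) = \<phi> u + \<phi> v" for u v
    using cl(2) by (auto simp: \<phi>_def fun_eq_iff clinearD(1)[OF clinear_CW_act[where n = n]])
  moreover have "\<phi> (DY_act n P u) = ext_dsum_act (DY_act n) P (\<phi> u)" if "P \<in> carrier (DY n)" for P u
    using cl(2) by (auto simp: \<phi>_def ext_dsum_act_def fun_eq_iff CW_act_DY_act[OF that] DY_act_0[OF that])
  ultimately show ?thesis unfolding module_iso_def by blast
qed

end

theorem proposition3p7:
  fixes n :: nat
    and e :: "tableau2 \<Rightarrow> welt \<Rightarrow> complex"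
    and S :: "tableau2 \<Rightarrow> tableau2"
  assumes "n \<ge> 1"
    and "tableau_idempotents n e"
    and "\<forall>lam \<in> P2 n. \<forall>T \<in> STab lam.
           S T \<in> STab lam \<and> CW_act (e T) ` OX n = DY_span n (F T (S T))"
  shows
    "is_direct_sum (OX n) (STabs n) (\<lambda>T. DY_span n (F T (S T))) \<and>
     is_direct_sum (OX n) (P2 n) (\<lambda>lam. sum_of (STab lam) (\<lambda>T. DY_span n (F T (S T)))) \<and>
     (\<forall>lam \<in> P2 n. is_direct_sum (sum_of (STab lam) (\<lambda>T. DY_span n (F T (S T))))
                      (STab lam) (\<lambda>T. DY_span n (F T (S T)))) \<and>
     (\<forall>Tstar. (\<forall>lam \<in> P2 n. Tstar lam \<in> STab lam) \<longrightarrow>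
        module_iso (DY n) (OX n) (DY_act n)
          (ext_dsum (SIGMA lam : P2 n. {..<f_dim lam})
             (\<lambda>(lam, k). DY_span n (F (Tstar lam) (S (Tstar lam)))))
          (ext_dsum_act (DY_act n)))"
proof -
  interpret idempotent_system n e by unfold_locales (rule assms(2))
  let ?M = "\<lambda>T. DY_span n (F T (S T))"
  have M: "CW_act (e T) ` OX n = ?M T" if "lam \<in> P2 n" "T \<in> STab lam" for lam T
    using assms(3) that by blast
  have M': "CW_act (e T) ` OX n = ?M T" if T: "T \<in> STabs n" for T
  proof -
    obtain lam where "lam \<in> P2 n" "T \<in> STab lam" using T unfolding STabs_def by blast
    then show ?thesis by (rule M)
  qed
  have ds: "is_direct_sum (OX n) (STabs n) ?M"
  proof -
    have "sum_of (STabs n) ?M = sum_of (STabs n) (\<lambda>T. CW_act (e T) ` OX n)"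
      unfolding sum_of_def using M' by (intro Collect_cong ex_cong1 conj_cong refl ball_cong) auto
    then show ?thesis
      using OX_direct_sum M' unfolding is_direct_sum_def by (simp cong: ball_cong)
  qed
  have zero: "0 \<in> ?M T" if T: "T \<in> STabs n" for T
    unfolding M'[OF T, symmetric] using OX_0[of n] clinearD(3)[OF clinear_CW_act[OF e_closed[OF T]]]
    by (metis image_eqI)
  have "STab lam \<inter> STab mu = {}" if "lam \<noteq> mu" for lam mu
    using shape_unique STab_Tab that by blast
  from direct_sum_group[OF ds[unfolded STabs_def] finite_P2 this zero[unfolded STabs_def]]
  have "is_direct_sum (OX n) (P2 n) (\<lambda>lam. sum_of (STab lam) ?M)"
    "\<forall>lam \<in> P2 n. is_direct_sum (sum_of (STab lam) ?M) (STab lam) ?M" by blast+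
  moreover have "module_iso (DY n) (OX n) (DY_act n)
      (ext_dsum (SIGMA lam : P2 n. {..<f_dim lam}) (\<lambda>(lam, k). ?M (Tstar lam))) (ext_dsum_act (DY_act n))"
    if Tstar: "\<forall>lam \<in> P2 n. Tstar lam \<in> STab lam" for Tstar
  proof -
    have "ext_dsum (SIGMA lam : P2 n. {..<f_dim lam}) (\<lambda>(lam, k). ?M (Tstar lam)) =
      ext_dsum (SIGMA lam : P2 n. {..<f_dim lam}) (\<lambda>(lam, k). CW_act (e (Tstar lam)) ` OX n)"
    proof (rule ext_dsum_cong)
      fix p assume "p \<in> (SIGMA lam : P2 n. {..<f_dim lam})"
      then obtain lam k where p: "p = (lam, k)" "lam \<in> P2 n" by (elim SigmaE)
      then show "(case p of (lam, k) \<Rightarrow> ?M (Tstar lam)) = (case p of (lam, k) \<Rightarrow> CW_act (e (Tstar lam)) ` OX n)"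
        using M[OF p(2)] Tstar by (simp only: prod.case)
    qed
    then show ?thesis using OX_module_iso[of Tstar] Tstar by simp
  qed
  ultimately show ?thesis using ds by blast
qed

end
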